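(* Let $H_1\in(0,1/2]$, $H_2\in(1/2,1)$, $x_0\in\mathbb{R}$, and let $b\colon[0,T]\times\mathbb{R}\to\mathbb{R}$ be measurable and such that: (B1) there exists $c\in(0,\infty)$ with $|b(t,x)|\le c$ for all $(t,x)\in[0,T]\times\mathbb{R}$; (B2) there are points $a_1<\dots<a_m$ and $L>0$ such that, with $I_0=(-\infty,a_1)$, $I_j=(a_j,a_{j+1})$ for $1\le j\le m-1$, $I_m=(a_m,\infty)$, one has $|b(t,x)-b(t,y)|\le L|x-y|$ for all $j=0,\dots,m$, all $t\in[0,T]$ and all $x,y\in I_j$. For $N\in\mathbb{N}$ let $X^N$ be the solution of $$X^N_t=x_0+\int_0^tb(s,X^N_s)\,\mathrm{d}s+\frac1NB^{H_1}_t+B^{H_2}_t,\quad t\in[0,T],$$ where $B^{H_1},B^{H_2}$ are completely correlated fractional Brownian motions. Let $(N_l)_{l\in\mathbb{N}}$ be a subsequence and $(\tilde\Omega,\tilde{\mathcal{A}},\tilde{\mathbb{P}})$ a probability space carrying versions (denoted by the same symbols) of $\big(X^{N_l},\int_0^\cdot b(s,X^{N_l}_s)\,\mathrm{d}s,B^{H_1}/N_l,B^{H_2}\big)$, equal in law to the original ones, satisfying the same equation, and converging almost surely in $C([0,T];\mathbb{R}^4)$ as $l\to\infty$. Let $X$ be the almost sure limit of $X^{N_l}$ and define $$X'_t:=x_0+\int_0^tb(s,X_s)\,\mathrm{d}s+B^{H_2}_t,\quad t\in[0,T].$$ Then $X=X'$ almost surely on $(\tilde\Omega,\tilde{\mathcal{A}},\tilde{\mathbb{P}})$.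 Moreover, $X^{N_l}\to X'$ in $L^2$, i.e. $\lim_{l\to\infty}\mathbb{E}\big[(X^{N_l}_t-X'_t)^2\big]=0$ for every $t\in[0,T]$.
   Context: $T\in(0,\infty)$ is fixed. Fractional Brownian motion with Hurst parameter $H\in(0,1)$ is the centered Gaussian process with covariance $\frac12(|t|^{2H}+|s|^{2H}-|t-s|^{2H})$; it has the representation $B^H_t=\int_0^tK_H(t,s)\,\mathrm{d}W_s$ with $K_H(t,s)=c_H(t-s)^{H-1/2}F(H-\tfrac12,\tfrac12-H,H+\tfrac12,1-\tfrac ts)$ for $0<s<t$, where $F$ is the Gauss hypergeometric function and $c_H>0$ a normalizing constant. $B^{H_1}$ and $B^{H_2}$ are completely correlated if both are represented in this way with the same Brownian motion $W$, so that $\frac1NB^{H_1}_t+B^{H_2}_t=\int_0^t\big(\frac1NK_{H_1}(t,s)+K_{H_2}(t,s)\big)\mathrm{d}W_s$. Under (B1), for each $N$ the equation for $X^N$ is known to have a unique strong solution (adapted to the augmented filtration generated by $W$). As in the paper, the versions of $B^{H_1},B^{H_2}$ on $(\tilde\Omega,\tilde{\mathcal{A}},\tilde{\mathbb{P}})$ are written without dependence on $l$. Existence of such a subsequence and probability space is established separately (via tightness and Skorohod's theorem). *)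

theory Defs
  imports "HOL-Probability.Probability" "HOL-Complex_Analysis.Complex_Analysis"
begin

text \<open>Processes are written \<open>X t \<omega>\<close>. All processes are indexed by \<open>{0..T}\<close>; their values at other
  times are irrelevant.\<close>

section \<open>Continuous processes and their laws\<close>

definition continuous_process ::
  "'a measure \<Rightarrow> real \<Rightarrow> (real \<Rightarrow> 'a \<Rightarrow> 'v::topological_space) \<Rightarrow> bool" where
  "continuous_process M T X \<longleftrightarrow>
     (\<forall>t\<in>{0..T}. X t \<in> borel_measurable M) \<and>
     (\<forall>\<omega>\<in>space M. continuous_on {0..T} (\<lambda>t. X t \<omega>))"

text \<open>The trace of the product sigma-algebra on the continuous paths is the Borel sigma-algebra of
  the uniform topology, so for continuous processes equality of \<open>path_law\<close> is equality in law as
  random elements of the space of continuous functions on \<open>{0..T}\<close>.\<close>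

definition path_law ::
  "'a measure \<Rightarrow> real \<Rightarrow> (real \<Rightarrow> 'a \<Rightarrow> 'v::topological_space) \<Rightarrow> (real \<Rightarrow> 'v) measure" where
  "path_law M T X = distr M (PiM {0..T} (\<lambda>_. borel)) (\<lambda>\<omega>. \<lambda>t\<in>{0..T}. X t \<omega>)"


section \<open>Brownian motion and its augmented filtration\<close>

definition brownian_motion :: "'a measure \<Rightarrow> real \<Rightarrow> (real \<Rightarrow> 'a \<Rightarrow> real) \<Rightarrow> bool" where
  "brownian_motion M T W \<longleftrightarrow>
     continuous_process M T W \<and>
     (AE \<omega> in M. W 0 \<omega> = 0) \<and>
     (\<forall>s t. 0 \<le> s \<and> s < t \<and> t \<le> T \<longrightarrow>
        distributed M lborel (\<lambda>\<omega>. W t \<omega> - W s \<omega>) (\<lambda>x. ennreal (normal_density 0 (sqrt (t - s)) x))) \<and>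
     (\<forall>(n::nat) (u::nat \<Rightarrow> real). strict_mono_on {..n} u \<and> u ` {..n} \<subseteq> {0..T} \<longrightarrow>
        prob_space.indep_vars M (\<lambda>_. borel) (\<lambda>i \<omega>. W (u (Suc i)) \<omega> - W (u i) \<omega>) {..<n})"

text \<open>The null sets are those of the completion, i.e. all subsets of measurable sets of measure zero;
  \<open>M\<close> itself need not be complete.\<close>

definition augmented_filtration ::
  "'a measure \<Rightarrow> (real \<Rightarrow> 'a \<Rightarrow> real) \<Rightarrow> real \<Rightarrow> 'a measure" where
  "augmented_filtration M W t =
     sigma (space M)
       ({W s -` A \<inter> space M | s A. s \<in> {0..t} \<and> A \<in> sets borel} \<union> null_sets (completion M))"


section \<open>Wiener integral of a deterministic function\<close>

definition step_fun :: "nat \<Rightarrow> (nat \<Rightarrow> real) \<Rightarrow> (nat \<Rightarrow> real) \<Rightarrow> real \<Rightarrow> real" where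
  "step_fun n u c s = (\<Sum>i<n. c i * indicator {u i<..u (Suc i)} s)"

definition step_integral ::
  "(real \<Rightarrow> 'a \<Rightarrow> real) \<Rightarrow> nat \<Rightarrow> (nat \<Rightarrow> real) \<Rightarrow> (nat \<Rightarrow> real) \<Rightarrow> 'a \<Rightarrow> real" where
  "step_integral W n u c \<omega> = (\<Sum>i<n. c i * (W (u (Suc i)) \<omega> - W (u i) \<omega>))"

text \<open>\<open>Y\<close> is (a version of) \<open>\<integral>\<^sub>0\<^sup>t f(s) dW\<^sub>s\<close>: the limit in \<open>L\<^sup>2(M)\<close> of the integrals of step functions
  that converge to \<open>f\<close> in \<open>L\<^sup>2(0,t)\<close>. By the Ito isometry \<open>Y\<close> is unique up to null sets and does not
  depend on the approximating sequence.\<close>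

definition has_wiener_integral ::
  "'a measure \<Rightarrow> (real \<Rightarrow> 'a \<Rightarrow> real) \<Rightarrow> real \<Rightarrow> (real \<Rightarrow> real) \<Rightarrow> ('a \<Rightarrow> real) \<Rightarrow> bool" where
  "has_wiener_integral M W t f Y \<longleftrightarrow>
     Y \<in> borel_measurable M \<and> set_borel_measurable lborel {0<..<t} f \<and>
     (\<exists>(n :: nat \<Rightarrow> nat) (u :: nat \<Rightarrow> nat \<Rightarrow> real) (c :: nat \<Rightarrow> nat \<Rightarrow> real).
        (\<forall>k. mono_on {..n k} (u k) \<and> u k ` {..n k} \<subseteq> {0..t}) \<and>
        ((\<lambda>k. \<integral>\<^sup>+s\<in>{0<..<t}. ennreal ((f s - step_fun (n k) (u k) (c k) s)\<^sup>2) \<partial>lborel) \<longlonglongrightarrow> 0) \<and>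
        ((\<lambda>k. \<integral>\<^sup>+\<omega>. ennreal ((Y \<omega> - step_integral W (n k) (u k) (c k) \<omega>)\<^sup>2) \<partial>M) \<longlonglongrightarrow> 0))"


section \<open>Fractional Brownian motion\<close>

definition centered_gaussian_process ::
  "'a measure \<Rightarrow> real \<Rightarrow> (real \<Rightarrow> 'a \<Rightarrow> real) \<Rightarrow> bool" where
  "centered_gaussian_process M T B \<longleftrightarrow>
     (\<forall>t\<in>{0..T}. B t \<in> borel_measurable M) \<and>
     (\<forall>J c. finite J \<and> J \<subseteq> {0..T} \<longrightarrow>
        (AE \<omega> in M. (\<Sum>t\<in>J. c t * B t \<omega>) = 0) \<or>
        (\<exists>\<sigma>>0. distributed M lborel (\<lambda>\<omega>. \<Sum>t\<in>J. c t * B t \<omega>) (\<lambda>x. ennreal (normal_density 0 \<sigma> x))))"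

definition fractional_brownian_motion ::
  "'a measure \<Rightarrow> real \<Rightarrow> real \<Rightarrow> (real \<Rightarrow> 'a \<Rightarrow> real) \<Rightarrow> bool" where
  "fractional_brownian_motion M T H B \<longleftrightarrow>
     continuous_process M T B \<and> centered_gaussian_process M T B \<and>
     (\<forall>s\<in>{0..T}. \<forall>t\<in>{0..T}.
        prob_space.expectation M (\<lambda>\<omega>. B s \<omega> * B t \<omega>)
          = (\<bar>t\<bar> powr (2 * H) + \<bar>s\<bar> powr (2 * H) - \<bar>t - s\<bar> powr (2 * H)) / 2)"

text \<open>Gauss hypergeometric function, principal branch: the value at \<open>z\<close> of the holomorphic function on
  the plane cut along \<open>[1,\<infinity>)\<close> that is given by the hypergeometric series in the unit disc. The
  continuation is needed because the kernel below uses the arguments \<open>1 - t/s\<close>, which range over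
  all negative numbers.\<close>

definition gauss_hypergeometric :: "complex \<Rightarrow> complex \<Rightarrow> complex \<Rightarrow> complex \<Rightarrow> complex" where
  "gauss_hypergeometric a b c z =
     (THE w. \<exists>f. f holomorphic_on - (complex_of_real ` {1..}) \<and>
                 (\<forall>\<zeta>\<in>ball 0 1. f \<zeta> = eval_fps (fps_hypergeo [a, b] [c] 1) \<zeta>) \<and> w = f z)"

definition volterra_kernel_unnormalized :: "real \<Rightarrow> real \<Rightarrow> real \<Rightarrow> real" where
  "volterra_kernel_unnormalized H t s =
     (t - s) powr (H - 1/2) *
     Re (gauss_hypergeometric (of_real (H - 1/2)) (of_real (1/2 - H)) (of_real (H + 1/2))
           (of_real (1 - t / s)))"

text \<open>The normalizing constant makes \<open>\<integral>\<^sub>0\<^sup>1 K\<^sub>H(1,s)\<^sup>2 ds = 1\<close>, the variance of fractional Brownian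
  motion at time 1. In closed form it is the square root of
  \<open>2 H Gamma(3/2 - H) / (Gamma(H + 1/2) Gamma(2 - 2 H))\<close>.\<close>

definition volterra_const :: "real \<Rightarrow> real" where
  "volterra_const H =
     1 / sqrt (LBINT s:{0<..<1}. (volterra_kernel_unnormalized H 1 s)\<^sup>2)"

definition volterra_kernel :: "real \<Rightarrow> real \<Rightarrow> real \<Rightarrow> real" where
  "volterra_kernel H t s = volterra_const H * volterra_kernel_unnormalized H t s"

text \<open>Two fractional Brownian motions represented in this way by the same \<open>W\<close> are completely
  correlated.\<close>

definition represented_by ::
  "'a measure \<Rightarrow> real \<Rightarrow> (real \<Rightarrow> 'a \<Rightarrow> real) \<Rightarrow> real \<Rightarrow> (real \<Rightarrow> 'a \<Rightarrow> real) \<Rightarrow> bool" where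
  "represented_by M T W H B \<longleftrightarrow>
     (\<forall>t\<in>{0..T}. has_wiener_integral M W t (volterra_kernel H t) (B t))"

definition completely_correlated_fBm ::
  "'a measure \<Rightarrow> real \<Rightarrow> (real \<Rightarrow> 'a \<Rightarrow> real) \<Rightarrow> real \<Rightarrow> real \<Rightarrow>
     (real \<Rightarrow> 'a \<Rightarrow> real) \<Rightarrow> (real \<Rightarrow> 'a \<Rightarrow> real) \<Rightarrow> bool" where
  "completely_correlated_fBm M T W H\<^sub>1 H\<^sub>2 B\<^sub>1 B\<^sub>2 \<longleftrightarrow>
     brownian_motion M T W \<and>
     fractional_brownian_motion M T H\<^sub>1 B\<^sub>1 \<and> fractional_brownian_motion M T H\<^sub>2 B\<^sub>2 \<and>
     represented_by M T W H\<^sub>1 B\<^sub>1 \<and> represented_by M T W H\<^sub>2 B\<^sub>2"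


section \<open>The equation\<close>

definition drift_integral ::
  "(real \<Rightarrow> real \<Rightarrow> real) \<Rightarrow> (real \<Rightarrow> 'a \<Rightarrow> real) \<Rightarrow> real \<Rightarrow> 'a \<Rightarrow> real" where
  "drift_integral b X t \<omega> = (LBINT s:{0..t}. b s (X s \<omega>))"

definition satisfies_equation ::
  "'a measure \<Rightarrow> real \<Rightarrow> real \<Rightarrow> (real \<Rightarrow> real \<Rightarrow> real) \<Rightarrow>
     (real \<Rightarrow> 'a \<Rightarrow> real) \<Rightarrow> (real \<Rightarrow> 'a \<Rightarrow> real) \<Rightarrow> bool" where
  "satisfies_equation M T x\<^sub>0 b Z X \<longleftrightarrow>
     (AE \<omega> in M. \<forall>t\<in>{0..T}. X t \<omega> = x\<^sub>0 + drift_integral b X t \<omega> + Z t \<omega>)"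

definition strong_solution ::
  "'a measure \<Rightarrow> real \<Rightarrow> (real \<Rightarrow> 'a \<Rightarrow> real) \<Rightarrow> real \<Rightarrow> (real \<Rightarrow> real \<Rightarrow> real) \<Rightarrow>
     (real \<Rightarrow> 'a \<Rightarrow> real) \<Rightarrow> (real \<Rightarrow> 'a \<Rightarrow> real) \<Rightarrow> bool" where
  "strong_solution M T W x\<^sub>0 b Z X \<longleftrightarrow>
     continuous_process M T X \<and>
     (\<forall>t\<in>{0..T}. X t \<in> borel_measurable (augmented_filtration M W t)) \<and>
     satisfies_equation M T x\<^sub>0 b Z X"

text \<open>The open intervals cut out of the line by the points \<open>a 1 < \<dots> < a m\<close>, for \<open>j \<le> m\<close> and \<open>m \<ge> 1\<close>.\<close>

definition piece :: "(nat \<Rightarrow> real) \<Rightarrow> nat \<Rightarrow> nat \<Rightarrow> real set" where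
  "piece a m j =
     (if j = 0 then {..<a 1} else if j = m then {a m<..} else {a j<..<a (Suc j)})"

end

theory Submission
  imports Defs
begin

text \<open>
  Fix \<open>0 < t \<le> T\<close>, a point \<open>y\<close> and \<open>s = t - \<delta>\<close>. Over \<open>[s, t]\<close> the drift moves the solution by at most
  \<open>c \<delta>\<close>, whereas, given the past up to time \<open>s\<close>, the increment of \<open>B\<^sub>2\<close> contains an independent
  Gaussian part whose standard deviation is at least of order \<open>\<delta> powr H\<^sub>2\<close>, because the Volterra kernel
  dominates a multiple of \<open>(t - r) powr (H\<^sub>2 - 1/2)\<close>. Since \<open>H\<^sub>2 < 1\<close>, the drift is negligible against
  this noise: up to the probability that \<open>(B\<^sub>1 t - B\<^sub>1 s) / N\<close> exceeds \<open>\<delta>\<close>, which vanishes as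
  \<open>N \<rightarrow> \<infinity>\<close>, the probability of \<open>\<bar>X\<^sup>N t - y\<bar> < \<delta>\<close> is at most of order \<open>\<delta> powr (1 - H\<^sub>2)\<close>, uniformly
  in \<open>N\<close>. Hence the limit \<open>X t\<close> has no atoms, so by Fubini almost every path spends
  Lebesgue-null time in the discontinuities of the drift, and dominated convergence identifies the
  limit of the drift integrals. The \<open>L\<^sup>2\<close> convergence follows since the drift is bounded, the second
  moment of \<open>B\<^sub>1 t / N\<close> tends to 0, and the versions of \<open>B\<^sub>2 t\<close> share one law with finite variance.
\<close>

section \<open>A lower bound for the Volterra kernel\<close>

text \<open>The small ball estimate cannot be run on the limit itself: the new probability space
  carries neither \<open>W\<close> nor a filtration, so nothing there says that later noise is
  independent of X s. It is proved on the original space, where each solution is adapted, and moved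
  over through one-dimensional marginal laws; this is why it has to be uniform in N.
  \<open>B\<^sub>1\<close> and \<open>B\<^sub>2\<close> are driven by the same \<open>W\<close>, so
  no independence between them is available. The increment of \<open>B\<^sub>1\<close> is therefore
  charged to the error, and the order of the limits matters: N grows for fixed \<delta>, and only
  then \<delta> tends to 0. The increment of \<open>B\<^sub>2\<close> over [s, t] also depends on
  the past, because the kernel changes with its first argument. That part is merged into one
  past-measurable variable Y. For Y + G with G Gaussian and independent of Y, the mass of a small
  interval is bounded in terms of the variance of G alone, so nothing has to be known about
  Y.\<close>

text \<open>Euler's integral for \<open>F(\<alpha>, -\<alpha>; 1 + \<alpha>; z)\<close>, after the substitution \<open>u = v powr (1/\<alpha>)\<close>
  that removes the singularity of \<open>u powr (\<alpha> - 1)\<close> at 0.\<close>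

definition hypergeo_integral :: "real \<Rightarrow> complex \<Rightarrow> complex" where
  "hypergeo_integral \<alpha> z = integral {0..1} (\<lambda>v. (1 - z * of_real (v powr (1/\<alpha>))) powr of_real \<alpha>)"

text \<open>Keeps the base of the power in Euler's integral off the branch cut of the complex power:
  from 1 - z w = r \<le> 0 one gets z = (1 - r) / w \<ge> 1, a point of the cut.\<close>

lemma slit_plane_not_nonpos_Reals:
  assumes "z \<notin> complex_of_real ` {1..}" and "0 \<le> w" "w \<le> 1"
  shows "1 - z * of_real w \<notin> \<real>\<^sub>\<le>\<^sub>0"
proof
  assume "1 - z * of_real w \<in> \<real>\<^sub>\<le>\<^sub>0"
  then obtain r where r: "1 - z * of_real w = of_real r" "r \<le> 0"
    by (auto elim!: nonpos_Reals_cases)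
  then have zw: "z * of_real w = of_real (1 - r)"
    by (simp add: algebra_simps)
  with r have "w \<noteq> 0" by auto
  then have z: "z = of_real ((1 - r) / w)"
    using zw by (simp add: field_simps)
  moreover have "1 \<le> (1 - r) / w"
    using assms r \<open>w \<noteq> 0\<close> by (simp add: field_simps)
  ultimately show False using assms(1) unfolding z by blast
qed

lemma continuous_on_powr_unit:
  assumes "0 < \<alpha>" shows "continuous_on {0..1} (\<lambda>v::real. v powr (1/\<alpha>))"
  using assms by (intro continuous_on_powr') (auto intro!: continuous_intros)

lemma continuous_on_powr_const_complex:
  fixes f :: "'a::topological_space \<Rightarrow> complex"
  assumes "continuous_on S f" "\<And>x. x \<in> S \<Longrightarrow> f x \<notin> \<real>\<^sub>\<le>\<^sub>0"
  shows "continuous_on S (\<lambda>x. f x powr a)"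
proof (rule continuous_on_compose2[OF _ assms(1)])
  show "continuous_on (- \<real>\<^sub>\<le>\<^sub>0) (\<lambda>w. w powr a)"
    by (intro holomorphic_on_imp_continuous_on holomorphic_intros) auto
qed (use assms in auto)

lemma open_slit_plane: "open (- (complex_of_real ` {1..}))"
proof -
  have "closed (complex_of_real ` {1..})"
    by (intro closed_injective_linear_image) (auto simp: linear_iff inj_on_def scaleR_conv_of_real)
  then show ?thesis by auto
qed

text \<open>Differentiation under the integral sign. \<open>leibniz_rule_holomorphic\<close> asks
  for a convex domain and the slit plane is not convex, so the argument runs on balls inside
  it.\<close>

lemma holomorphic_hypergeo_integral:
  assumes "0 < \<alpha>"
  shows "hypergeo_integral \<alpha> holomorphic_on - (complex_of_real ` {1..})"
proof -
  let ?U = "- (complex_of_real ` {1..})"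
  let ?w = "\<lambda>v. v powr (1/\<alpha>)"
  have w: "0 \<le> ?w v" "?w v \<le> 1" if "v \<in> {0..1}" for v
    using that assms by (auto intro: powr_le1)
  have ball: "hypergeo_integral \<alpha> holomorphic_on ball z e" if e: "ball z e \<subseteq> ?U" for z e
  proof -
    have nr: "1 - x * of_real (?w v) \<notin> \<real>\<^sub>\<le>\<^sub>0" if "x \<in> ball z e" "v \<in> {0..1}" for x v
      using that e w by (intro slit_plane_not_nonpos_Reals) auto
    have "(\<lambda>x. integral (cbox 0 1) (\<lambda>v. (1 - x * of_real (?w v)) powr of_real \<alpha>)) holomorphic_on ball z e"
    proof (rule leibniz_rule_holomorphic)
      show "((\<lambda>x. (1 - x * of_real (?w v)) powr of_real \<alpha>) has_field_derivative
          of_real \<alpha> * (1 - x * of_real (?w v)) powr (of_real \<alpha> - 1) * (- of_real (?w v)))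
          (at x within ball z e)" if "x \<in> ball z e" "v \<in> cbox 0 1" for x v
        using nr[of x v] that by (auto intro!: derivative_eq_intros)
      show "(\<lambda>v. (1 - x * of_real (?w v)) powr of_real \<alpha>) integrable_on cbox 0 1"
        if "x \<in> ball z e" for x
      proof -
        have "continuous_on {0..1} (\<lambda>v. complex_of_real (?w v))"
          by (rule continuous_on_of_real[OF continuous_on_powr_unit[OF assms]])
        then have "continuous_on {0..1} (\<lambda>v. 1 - x * of_real (?w v))"
          by (rule continuous_on_diff[OF continuous_on_const continuous_on_mult_left])
        then have "continuous_on {0..1} (\<lambda>v. (1 - x * of_real (?w v)) powr of_real \<alpha>)"
          by (rule continuous_on_powr_const_complex) (rule nr[OF that])
        then show ?thesis
          unfolding cbox_interval by (rule integrable_continuous_interval)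
      qed
      let ?S = "ball z e \<times> {0..1::real}"
      have "continuous_on ?S (\<lambda>p. ?w (snd p))"
        by (rule continuous_on_compose2[OF continuous_on_powr_unit[OF assms]])
          (auto intro: continuous_on_snd)
      then have W: "continuous_on ?S (\<lambda>p. complex_of_real (?w (snd p)))"
        by (rule continuous_on_of_real)
      then have "continuous_on ?S (\<lambda>p. 1 - fst p * of_real (?w (snd p)))"
        by (intro continuous_on_diff continuous_on_const continuous_on_mult
            continuous_on_fst continuous_on_id)
      then have "continuous_on ?S (\<lambda>p. (1 - fst p * of_real (?w (snd p))) powr (of_real \<alpha> - 1))"
      proof (rule continuous_on_powr_const_complex)
        fix p assume "p \<in> ?S"
        then have "fst p \<in> ball z e" "snd p \<in> {0..1}" by auto
        then show "1 - fst p * of_real (?w (snd p)) \<notin> \<real>\<^sub>\<le>\<^sub>0" by (rule nr)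
      qed
      with W have "continuous_on ?S (\<lambda>p. of_real \<alpha> *
          (1 - fst p * of_real (?w (snd p))) powr (of_real \<alpha> - 1) * (- of_real (?w (snd p))))"
        by (intro continuous_on_mult continuous_on_minus continuous_on_const)
      then show "continuous_on (ball z e \<times> cbox 0 1)
          (\<lambda>(x, v). of_real \<alpha> * (1 - x * of_real (?w v)) powr (of_real \<alpha> - 1) * (- of_real (?w v)))"
        by (simp only: case_prod_unfold cbox_interval)
    qed simp
    then show ?thesis
      by (simp add: hypergeo_integral_def[abs_def] cbox_interval)
  qed
  show ?thesis
    unfolding holomorphic_on_def
  proof
    fix z assume "z \<in> ?U"
    then obtain e where e: "0 < e" "ball z e \<subseteq> ?U"
      using open_slit_plane open_contains_ball by blast
    then have "hypergeo_integral \<alpha> field_differentiable at z"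
      using holomorphic_on_imp_differentiable_at[OF ball[OF e(2)]] by auto
    then show "hypergeo_integral \<alpha> field_differentiable at z within ?U"
      by (rule field_differentiable_at_within)
  qed
qed

lemma has_integral_powr_unit:
  assumes "0 < \<alpha>"
  shows "((\<lambda>v. of_real ((v powr (1/\<alpha>)) ^ n)) has_integral (of_real (\<alpha> / (\<alpha> + real n)) :: complex)) {0..1}"
proof -
  have "((\<lambda>v. v powr (real n / \<alpha>)) has_integral (1 powr (real n / \<alpha> + 1) / (real n / \<alpha> + 1))) {0..1}"
    by (rule has_integral_powr_from_0) (use assms in \<open>auto simp: less_le_trans[of _ 0]\<close>)
  moreover have "(1::real) powr (real n / \<alpha> + 1) / (real n / \<alpha> + 1) = \<alpha> / (\<alpha> + real n)"
    using assms by (simp add: field_simps)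
  ultimately have 1: "((\<lambda>v. v powr (real n / \<alpha>)) has_integral (\<alpha> / (\<alpha> + real n))) {0..1}"
    by simp
  \<comment> \<open>For n = 0 the two integrands differ at v = 0, since \<open>0 powr 0 = 0\<close>
    while \<open>x ^ 0 = 1\<close>; the point 0 is removed as a null set.\<close>
  have "((\<lambda>v. (v powr (1/\<alpha>)) ^ n) has_integral (\<alpha> / (\<alpha> + real n))) {0..1}"
  proof (rule has_integral_spike[OF _ _ 1])
    show "(v powr (1/\<alpha>)) ^ n = v powr (real n / \<alpha>)" if "v \<in> {0..1} - {0}" for v
      using that by (auto simp: powr_realpow[symmetric] powr_powr)
  qed simp
  then show ?thesis
    by (rule has_integral_of_real)
qed

text \<open>For rising factorials (\<alpha>)_n (\<alpha> + n) = \<alpha> (1 + \<alpha>)_n, so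
  (\<alpha>)_n / (1 + \<alpha>)_n collapses to the moment of \<open>has_integral_powr_unit\<close>,
  while (-\<alpha>)_n / n! is a binomial coefficient up to sign.\<close>

lemma hypergeo_coeff:
  assumes "0 < \<alpha>"
  shows "fps_hypergeo [complex_of_real \<alpha>, - of_real \<alpha>] [1 + of_real \<alpha>] 1 $ n =
    (of_real \<alpha> gchoose n) * (- 1) ^ n * of_real (\<alpha> / (\<alpha> + real n))"
proof -
  let ?a = "complex_of_real \<alpha>"
  have nz: "?a + of_nat k \<noteq> 0" for k
    using assms by (metis add_nonneg_pos of_nat_0_le_iff of_real_add of_real_eq_0_iff of_real_of_nat_eq order_less_irrefl add.commute)
  have "pochhammer ?a (Suc n) = ?a * pochhammer (1 + ?a) n"
    by (simp add: pochhammer_rec add.commute)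
  moreover have "pochhammer ?a (Suc n) = pochhammer ?a n * (?a + of_nat n)"
    by (simp add: pochhammer_Suc)
  ultimately have eq: "pochhammer ?a n * (?a + of_nat n) = ?a * pochhammer (1 + ?a) n" by simp
  have "pochhammer (1 + ?a) n \<noteq> 0"
    using nz by (auto simp: pochhammer_eq_0_iff) (metis add.commute add.left_commute nz of_nat_Suc add_eq_0_iff)
  then show ?thesis
    using eq nz[of n]
    by (simp add: gbinomial_pochhammer frac_eq_eq divide_simps flip: power_mult_distrib)
qed

text \<open>Newton's binomial series for the integrand, integrated term by term. As 0 \<le> w \<le>
  1, the terms at w = 1 form a summable majorant, which makes the convergence uniform.\<close>

lemma hypergeo_integral_eq_series:
  assumes "0 < \<alpha>" "norm z < 1"
  shows "hypergeo_integral \<alpha> z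
    = eval_fps (fps_hypergeo [of_real \<alpha>, - of_real \<alpha>] [1 + of_real \<alpha>] 1) z"
proof -
  let ?w = "\<lambda>v. v powr (1/\<alpha>)"
  let ?g = "\<lambda>n v. (of_real \<alpha> gchoose n) * (- z * of_real (?w v)) ^ n"
  have w: "0 \<le> ?w v" "?w v \<le> 1" if "v \<in> {0..1}" for v
    using that assms by (auto intro: powr_le1)
  have conv: "of_real (norm z) \<in> ball (0::complex) 1" using assms by simp
  have "summable (\<lambda>n. norm ((complex_of_real \<alpha> gchoose n) * (- z) ^ n))"
  proof (rule abs_summable_in_conv_radius)
    show "ereal (norm (- z)) < conv_radius (\<lambda>n. complex_of_real \<alpha> gchoose n)"
    \<comment> \<open>The radius of convergence is 1, or infinite if \<alpha> is natural and the
      series terminates.\<close>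
    proof (cases "complex_of_real \<alpha> \<in> \<nat>")
      case True
      then show ?thesis by (subst conv_radius_gchoose) (use assms in auto)
    next
      case False
      then show ?thesis by (subst conv_radius_gchoose) (use assms in auto)
    qed
  qed
  then have lim: "uniform_limit {0..1} (\<lambda>n v. \<Sum>i<n. ?g i v) (\<lambda>v. \<Sum>i. ?g i v) sequentially"
  proof (rule Weierstrass_m_test[rotated])
    show "norm (?g n v) \<le> norm ((complex_of_real \<alpha> gchoose n) * (- z) ^ n)" if "v \<in> {0..1}" for n v
    proof -
      have "norm (?g n v) = norm ((complex_of_real \<alpha> gchoose n) * (- z) ^ n) * ?w v ^ n"
        using w[OF that] by (simp add: norm_mult norm_power power_mult_distrib)
      also have "\<dots> \<le> norm ((complex_of_real \<alpha> gchoose n) * (- z) ^ n) * 1"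
        using w[OF that] by (intro mult_left_mono power_le_one) auto
      finally show ?thesis by simp
    qed
  qed
  have sum_g: "(\<Sum>i. ?g i v) = (1 - z * of_real (?w v)) powr of_real \<alpha>" if "v \<in> {0..1}" for v
  proof -
    have "norm (- z * of_real (?w v)) < 1"
      using assms w[OF that] by (simp add: norm_mult) (metis mult_left_le norm_ge_zero order_le_less_trans)
    from gen_binomial_complex[OF this] show ?thesis
      by (simp add: sums_iff)
  qed
  have int_g: "(?g n has_integral
      fps_hypergeo [complex_of_real \<alpha>, - of_real \<alpha>] [1 + of_real \<alpha>] 1 $ n * z ^ n) {0..1}" for n
  proof -
    have "((\<lambda>v. ((complex_of_real \<alpha> gchoose n) * (- z) ^ n) * of_real (?w v ^ n)) has_integral
        ((complex_of_real \<alpha> gchoose n) * (- z) ^ n) * of_real (\<alpha> / (\<alpha> + real n))) {0..1}"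
      by (intro has_integral_mult_right has_integral_powr_unit assms)
    then show ?thesis
      unfolding hypergeo_coeff[OF assms(1)]
      by (simp add: power_mult_distrib power_minus[of z] power_minus[of "z * _"] mult_ac)
  qed
  obtain I J where IJ: "\<And>n. ((\<lambda>v. \<Sum>i<n. ?g i v) has_integral I n) {0..1}"
    "((\<lambda>v. \<Sum>i. ?g i v) has_integral J) {0..1}" "I \<longlonglongrightarrow> J"
  proof (rule uniform_limit_integral[OF lim])
    show "continuous_on {0..1} (\<lambda>v. \<Sum>i<n. ?g i v)" for n
      using continuous_on_powr_unit[OF assms(1)] by (auto intro!: continuous_intros)
  qed auto
  have "I n = (\<Sum>i<n. fps_hypergeo [complex_of_real \<alpha>, - of_real \<alpha>] [1 + of_real \<alpha>] 1 $ i * z ^ i)" for n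
    by (rule has_integral_unique[OF IJ(1)]) (intro has_integral_sum int_g finite_lessThan)
  with IJ(3) have "J = eval_fps (fps_hypergeo [of_real \<alpha>, - of_real \<alpha>] [1 + of_real \<alpha>] 1) z"
    unfolding eval_fps_def by (metis (mono_tags, lifting) LIMSEQ_unique sums_def sums_unique tendsto_cong always_eventually)
  moreover have "hypergeo_integral \<alpha> z = J"
    unfolding hypergeo_integral_def
    by (rule integral_unique, rule has_integral_eq[OF _ IJ(2)]) (use sum_g in auto)
  ultimately show ?thesis by simp
qed

text \<open>The slit plane is connected, so the continuation is unique.\<close>

lemma gauss_hypergeometric_eq_integral:
  assumes "0 < \<alpha>" "z \<notin> complex_of_real ` {1..}"
  shows "gauss_hypergeometric (of_real \<alpha>) (- of_real \<alpha>) (1 + of_real \<alpha>) z = hypergeo_integral \<alpha> z"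
  unfolding gauss_hypergeometric_def
proof (rule the_equality)
  let ?U = "- (complex_of_real ` {1..})"
  let ?F = "eval_fps (fps_hypergeo [of_real \<alpha>, - of_real \<alpha>] [1 + of_real \<alpha>] 1)"
  show "\<exists>f. f holomorphic_on ?U \<and> (\<forall>\<zeta>\<in>ball 0 1. f \<zeta> = ?F \<zeta>) \<and> hypergeo_integral \<alpha> z = f z"
    using holomorphic_hypergeo_integral[OF assms(1)] hypergeo_integral_eq_series[OF assms(1)]
    by (intro exI[of _ "hypergeo_integral \<alpha>"]) auto
  fix w assume "\<exists>f. f holomorphic_on ?U \<and> (\<forall>\<zeta>\<in>ball 0 1. f \<zeta> = ?F \<zeta>) \<and> w = f z"
  then obtain f where f: "f holomorphic_on ?U" "\<And>\<zeta>. \<zeta> \<in> ball 0 1 \<Longrightarrow> f \<zeta> = ?F \<zeta>" "w = f z"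
    by blast
  \<comment> \<open>The centre is 0: if q x = r \<ge> 1 with 0 < q \<le> 1, then x = r / q is itself
    on the cut.\<close>
  have star: "starlike ?U"
    unfolding starlike_def
  proof (intro bexI[of _ 0] ballI subsetI ComplI)
    fix x y :: complex assume "x \<in> ?U" and yx: "y \<in> closed_segment 0 x" and "y \<in> complex_of_real ` {1..}"
    then have "x \<notin> complex_of_real ` {1..}" by blast
    obtain r where y: "y = complex_of_real r" "r \<in> {1..}"
      using \<open>y \<in> complex_of_real ` {1..}\<close> by blast
    show False
    proof -
      obtain q where q: "0 \<le> q" "q \<le> 1" "complex_of_real r = of_real q * x"
        using yx y by (auto simp: closed_segment_def scaleR_conv_of_real)
      with y have "q \<noteq> 0" by auto
      with q have "x = of_real (r / q)" by (simp add: field_simps)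
      moreover have "1 \<le> r / q" using q y \<open>q \<noteq> 0\<close> by (simp add: field_simps)
      ultimately show False using \<open>x \<notin> complex_of_real ` {1..}\<close> by blast
    qed
  qed auto
  have "f z - hypergeo_integral \<alpha> z = 0"
  proof (rule analytic_continuation[of "\<lambda>z. f z - hypergeo_integral \<alpha> z" ?U "ball 0 1" 0])
    show "(\<lambda>z. f z - hypergeo_integral \<alpha> z) holomorphic_on ?U"
      by (intro holomorphic_intros f holomorphic_hypergeo_integral assms)
    show "connected ?U"
      using star by (rule starlike_imp_connected)
    show "ball 0 1 \<subseteq> ?U" by auto
    show "f \<zeta> - hypergeo_integral \<alpha> \<zeta> = 0" if "\<zeta> \<in> ball 0 1" for \<zeta>
      using f(2)[OF that] hypergeo_integral_eq_series[OF assms(1)] that by simp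
    show "(0::complex) islimpt ball 0 1"
      by (simp add: islimpt_ball)
  qed (use assms open_slit_plane in auto)
  then show "w = hypergeo_integral \<alpha> z" using f by simp
qed

text \<open>At z = -x the integrand is (1 + x w) to the power \<alpha> with 0 \<le> w \<le> 1. The
  lower bound will yield enough noise, the upper one a finite normalizing integral.\<close>

lemma hypergeo_integral_bounds:
  assumes "0 < \<alpha>" "0 \<le> x"
  shows "1 \<le> Re (hypergeo_integral \<alpha> (of_real (- x)))"
    and "Re (hypergeo_integral \<alpha> (of_real (- x))) \<le> (1 + x) powr \<alpha>"
proof -
  let ?h = "\<lambda>v. (1 + x * v powr (1/\<alpha>)) powr \<alpha>"
  have bounds: "1 \<le> ?h v" "?h v \<le> (1 + x) powr \<alpha>" if "v \<in> {0..1}" for v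
  proof -
    have w: "0 \<le> v powr (1/\<alpha>)" "v powr (1/\<alpha>) \<le> 1"
      using that assms by (auto intro: powr_le1)
    then show "1 \<le> ?h v" using assms by (intro ge_one_powr_ge_zero) auto
    show "?h v \<le> (1 + x) powr \<alpha>"
      using w assms by (intro powr_mono2) (auto simp: mult_left_le intro: add_nonneg_nonneg)
  qed
  have "1 + x * v powr (1/\<alpha>) > 0" for v
    using assms by (simp add: add_pos_nonneg)
  then have nz: "1 + x * v powr (1/\<alpha>) \<noteq> 0" for v
    by (rule less_imp_neq[THEN not_sym])
  moreover have "continuous_on {0..1} (\<lambda>v. 1 + x * v powr (1/\<alpha>))"
    by (rule continuous_on_add[OF continuous_on_const
          continuous_on_mult_left[OF continuous_on_powr_unit[OF assms(1)]]])
  ultimately have "continuous_on {0..1} ?h"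
    using continuous_on_powr[OF _ continuous_on_const] by blast
  then have int: "?h integrable_on {0..1}"
    by (rule integrable_continuous_interval)
  have "((\<lambda>v. (1 - of_real (- x) * of_real (v powr (1/\<alpha>))) powr of_real \<alpha>) has_integral
      complex_of_real (integral {0..1} ?h)) {0..1}"
  proof (rule has_integral_eq[OF _ has_integral_of_real[OF integrable_integral[OF int]]])
    show "complex_of_real (?h v) = (1 - of_real (- x) * of_real (v powr (1/\<alpha>))) powr of_real \<alpha>"
      if "v \<in> {0..1}" for v
    proof -
      have "1 - of_real (- x) * of_real (v powr (1/\<alpha>)) = complex_of_real (1 + x * v powr (1/\<alpha>))"
        by simp
      then show ?thesis
        using \<open>1 + x * v powr (1/\<alpha>) > 0\<close> by (simp only: powr_of_real less_imp_le)
    qed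
  qed
  then have eq: "Re (hypergeo_integral \<alpha> (of_real (- x))) = integral {0..1} ?h"
    unfolding hypergeo_integral_def by (simp add: integral_unique)
  show "1 \<le> Re (hypergeo_integral \<alpha> (of_real (- x)))"
    unfolding eq using integral_le[OF integrable_const_ivl int, of 1] bounds by simp
  show "Re (hypergeo_integral \<alpha> (of_real (- x))) \<le> (1 + x) powr \<alpha>"
    unfolding eq using integral_le[OF int integrable_const_ivl, of "(1 + x) powr \<alpha>"] bounds by simp
qed

section \<open>Bounds for the kernel and positivity of its constant\<close>

lemma volterra_kernel_unnormalized_eq:
  assumes "1/2 < H" "0 < s" "s \<le> t"
  shows "volterra_kernel_unnormalized H t s
    = (t - s) powr (H - 1/2) * Re (hypergeo_integral (H - 1/2) (of_real (- (t / s - 1))))"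
proof -
  have "complex_of_real (1 - t / s) \<notin> complex_of_real ` {1..}"
  proof
    assume "complex_of_real (1 - t / s) \<in> complex_of_real ` {1..}"
    then have "1 \<le> 1 - t / s" by (metis atLeast_iff image_iff of_real_eq_iff)
    moreover have "0 < t / s" using assms by simp
    ultimately show False by linarith
  qed
  then have "gauss_hypergeometric (of_real (H - 1/2)) (- of_real (H - 1/2)) (1 + of_real (H - 1/2))
      (of_real (1 - t / s)) = hypergeo_integral (H - 1/2) (of_real (1 - t / s))"
    using assms(1) by (intro gauss_hypergeometric_eq_integral) auto
  moreover have "- complex_of_real (H - 1/2) = of_real (1/2 - H)"
    "1 + complex_of_real (H - 1/2) = of_real (H + 1/2)" "- (t / s - 1) = 1 - t / s"
    by simp_all
  ultimately show ?thesis
    unfolding volterra_kernel_unnormalized_def by (simp only:)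
qed

lemma volterra_kernel_unnormalized_bounds:
  assumes "1/2 < H" "0 < s" "s \<le> t"
  shows "(t - s) powr (H - 1/2) \<le> volterra_kernel_unnormalized H t s"
    and "volterra_kernel_unnormalized H t s \<le> (t - s) powr (H - 1/2) * (t / s) powr (H - 1/2)"
proof -
  \<comment> \<open>The bounds are applied at x = t / s - 1, where 1 + x = t / s.\<close>
  have "0 \<le> t / s - 1" using assms by (simp add: field_simps)
  from hypergeo_integral_bounds[OF _ this, of "H - 1/2"] assms
  show "(t - s) powr (H - 1/2) \<le> volterra_kernel_unnormalized H t s"
    and "volterra_kernel_unnormalized H t s \<le> (t - s) powr (H - 1/2) * (t / s) powr (H - 1/2)"
    unfolding volterra_kernel_unnormalized_eq[OF assms]
    by (auto intro!: mult_left_mono mult_left_le[where c = "_ powr _"] simp: mult_le_cancel_left1)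
qed

text \<open>The upper bound gives the majorant s powr (1 - 2 H), whose exponent exceeds -1 because H
  < 1. Without integrability the integral in \<open>volterra_const\<close> would be 0 by
  default.\<close>

lemma set_integrable_volterra_kernel_square:
  assumes H: "1/2 < H" "H < 1"
  shows "set_integrable lborel {0<..<1} (\<lambda>s. (volterra_kernel_unnormalized H 1 s)\<^sup>2)"
proof (rule set_integrable_bound)
  let ?K = "volterra_kernel_unnormalized H 1"
  have "(\<lambda>s::real. s powr (1 - 2 * H)) absolutely_integrable_on {0<..1}"
  proof (rule nonnegative_absolutely_integrable_1)
    have "(\<lambda>s. s powr (1 - 2 * H)) integrable_on {0..1}"
      using has_integral_powr_from_0[of "1 - 2 * H" 1] H by (auto simp: integrable_on_def)
    then show "(\<lambda>s. s powr (1 - 2 * H)) integrable_on {0<..1}"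
      by (rule integrable_spike_set) (auto intro: negligible_subset[of "{0}"])
  qed auto
  then have "set_integrable lebesgue {0<..<1} (\<lambda>s::real. s powr (1 - 2 * H))"
    by (rule set_integrable_subset) auto
  then show "set_integrable lborel {0<..<1} (\<lambda>s::real. s powr (1 - 2 * H))"
    unfolding set_integrable_def by (subst (asm) integrable_completion) auto
  have "continuous_on {0<..<1} ?K"
  proof -
    have "continuous_on {0<..<1} (\<lambda>s. (1 - s) powr (H - 1/2) *
        Re (hypergeo_integral (H - 1/2) (of_real (- (1 / s - 1)))))"
    proof (intro continuous_intros)
      show "continuous_on {0<..<1::real} (\<lambda>s. hypergeo_integral (H - 1/2) (of_real (- (1 / s - 1))))"
      proof (rule continuous_on_compose2[OF holomorphic_on_imp_continuous_on[OF holomorphic_hypergeo_integral]])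
        show "(\<lambda>s. complex_of_real (- (1 / s - 1))) ` {0<..<1::real} \<subseteq> - (complex_of_real ` {1..})"
        proof clarify
          fix s r :: real
          assume s: "s \<in> {0<..<1}" and "1 \<le> r" and "complex_of_real (- (1 / s - 1)) = complex_of_real r"
          then have "- (1 / s - 1) = r" by (metis of_real_eq_iff)
          with \<open>1 \<le> r\<close> have "1 / s \<le> 0" by linarith
          with s show False by simp
        qed
      qed (use H in \<open>auto intro!: continuous_intros\<close>)
    qed auto
    then show ?thesis
      using H by (subst continuous_on_cong[OF refl volterra_kernel_unnormalized_eq]) auto
  qed
  then have "?K \<in> borel_measurable (restrict_space borel {0<..<1})"
    by (rule borel_measurable_continuous_on_restrict)
  then have "(\<lambda>s. (?K s)\<^sup>2) \<in> borel_measurable (restrict_space borel {0<..<1})"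
    by measurable
  then show "set_borel_measurable lborel {0<..<1} (\<lambda>s. (?K s)\<^sup>2)"
    unfolding set_borel_measurable_def
    by (subst (asm) borel_measurable_restrict_space_iff) auto
  show "AE s in lborel. s \<in> {0<..<1} \<longrightarrow> norm ((?K s)\<^sup>2) \<le> norm (s powr (1 - 2 * H))"
  proof (intro AE_I2 impI)
    fix s :: real assume s: "s \<in> {0<..<1}"
    have "0 \<le> ?K s" "?K s \<le> (1 / s) powr (H - 1/2)"
    proof -
      have "0 \<le> (1 - s) powr (H - 1/2)" by simp
      also have "\<dots> \<le> ?K s" using volterra_kernel_unnormalized_bounds(1)[of H s 1] H s by simp
      finally show "0 \<le> ?K s" .
      have "?K s \<le> (1 - s) powr (H - 1/2) * (1 / s) powr (H - 1/2)"
        using volterra_kernel_unnormalized_bounds(2)[of H s 1] H s by simp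
      also have "\<dots> \<le> 1 * (1 / s) powr (H - 1/2)"
        using H s by (intro mult_right_mono powr_le1) auto
      finally show "?K s \<le> (1 / s) powr (H - 1/2)" by simp
    qed
    then have "(?K s)\<^sup>2 \<le> ((1 / s) powr (H - 1/2))\<^sup>2"
      by (intro power_mono)
    also have "(1 / s) powr (H - 1/2) = s powr (- (H - 1/2))"
      using s by (subst powr_minus_divide) (simp add: powr_divide)
    also have "(s powr (- (H - 1/2)))\<^sup>2 = s powr (1 - 2 * H)"
      unfolding power2_eq_square powr_add[symmetric] by (rule arg_cong[of _ _ "(powr) s"]) simp
    finally show "norm ((?K s)\<^sup>2) \<le> norm (s powr (1 - 2 * H))" by simp
  qed
qed

text \<open>Since \<open>1 / 0 = 0\<close>, positivity amounts to a nonzero integral. An integrable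
  nonnegative function with integral 0 vanishes almost everywhere, but the kernel is strictly
  positive on (0, 1).\<close>

lemma volterra_const_pos:
  assumes H: "1/2 < H" "H < 1"
  shows "0 < volterra_const H"
proof -
  let ?f = "\<lambda>s. indicator {0<..<1} s *\<^sub>R (volterra_kernel_unnormalized H 1 s)\<^sup>2"
  have int: "integrable lborel ?f"
    using set_integrable_volterra_kernel_square[OF H] by (simp add: set_integrable_def)
  have "(LBINT s:{0<..<1}. (volterra_kernel_unnormalized H 1 s)\<^sup>2) \<noteq> 0"
  proof
    assume "(LBINT s:{0<..<1}. (volterra_kernel_unnormalized H 1 s)\<^sup>2) = 0"
    then have "AE s in lborel. ?f s = 0"
      unfolding set_lebesgue_integral_def
      by (subst (asm) integral_nonneg_eq_0_iff_AE[OF int]) auto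
    then have "AE s in lborel. s \<notin> {0<..<1::real}"
    proof eventually_elim
      case (elim s)
      have "volterra_kernel_unnormalized H 1 s > 0" if "s \<in> {0<..<1}"
      proof -
        have "0 < (1 - s) powr (H - 1/2)" using that by simp
        also have "\<dots> \<le> volterra_kernel_unnormalized H 1 s"
          using that H by (intro volterra_kernel_unnormalized_bounds) auto
        finally show ?thesis .
      qed
      with elim show ?case by (auto split: split_indicator_asm)
    qed
    then have "{0<..<1::real} \<in> null_sets lborel"
      using AE_iff_null_sets[of "{0<..<1::real}" lborel] by simp
    then have "emeasure lborel {0<..<1::real} = 0"
      by (rule null_setsD1)
    then show False by simp
  qed
  moreover have "0 \<le> (LBINT s:{0<..<1}. (volterra_kernel_unnormalized H 1 s)\<^sup>2)"
    unfolding set_lebesgue_integral_def by (intro Bochner_Integration.integral_nonneg) auto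
  ultimately show ?thesis unfolding volterra_const_def by simp
qed

lemma volterra_kernel_ge:
  assumes "1/2 < H" "H < 1" "0 < s" "s \<le> t"
  shows "volterra_const H * (t - s) powr (H - 1/2) \<le> volterra_kernel H t s"
  unfolding volterra_kernel_def
  using assms by (intro mult_left_mono volterra_kernel_unnormalized_bounds)
    (use volterra_const_pos[of H] in auto)

section \<open>Step integrals against Brownian motion\<close>

text \<open>\<open>has_wiener_integral\<close> provides weakly increasing partition points, whereas
  \<open>brownian_motion\<close> states independence for strictly increasing ones. Enumerating the
  set of points removes repetitions.\<close>

lemma finite_set_strict_enumeration:
  fixes P :: "real set"
  assumes "finite P" "P \<noteq> {}"
  shows "\<exists>m (v :: nat \<Rightarrow> real). strict_mono_on {..m} v \<and> v ` {..m} = P"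
proof -
  obtain l where l: "sorted_wrt (<) l" "set l = P"
    using finite_set_strict_sorted[OF assms(1)] by blast
  with assms have ne: "l \<noteq> []" by auto
  then have m: "{..length l - 1} = {..<length l}"
    by (cases l) auto
  show ?thesis
  proof (intro exI conjI)
    show "strict_mono_on {..length l - 1} ((!) l)"
      unfolding m using l(1) by (auto intro!: strict_mono_onI sorted_wrt_nth_less)
    show "(!) l ` {..length l - 1} = P"
      unfolding m using l(2) by (auto simp: set_conv_nth)
  qed
qed

lemma strict_mono_on_atMost_less_iff:
  fixes v :: "nat \<Rightarrow> real"
  assumes "strict_mono_on {..m} v" "i \<le> m" "j \<le> m"
  shows "v i < v j \<longleftrightarrow> i < j" "v i \<le> v j \<longleftrightarrow> i \<le> j"
  using assms strict_mono_on_less[OF assms(1), of i j] strict_mono_on_less_eq[OF assms(1), of i j] by auto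

text \<open>Telescoping over the grid cells inside (x, y]. Since x and y are grid points, a cell
  lies in this interval exactly if its right end does; hence the indicator at
  \<open>v (Suc j)\<close>.\<close>

lemma increment_refine:
  fixes f :: "real \<Rightarrow> real"
  assumes v: "strict_mono_on {..m} v" and "x \<in> v ` {..m}" "y \<in> v ` {..m}" "x \<le> y"
  shows "f y - f x = (\<Sum>j<m. indicator {x<..y} (v (Suc j)) * (f (v (Suc j)) - f (v j)))"
proof -
  obtain p q where pq: "p \<le> m" "q \<le> m" "x = v p" "y = v q"
    using assms by auto
  note iff = strict_mono_on_atMost_less_iff[OF v]
  have "p \<le> q" using assms pq iff by auto
  have "(\<Sum>j<m. indicator {x<..y} (v (Suc j)) * (f (v (Suc j)) - f (v j)))
      = (\<Sum>j\<in>{p..<q}. f (v (Suc j)) - f (v j))"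
    using pq iff by (intro sum.mono_neutral_cong_right) (auto simp: less_Suc_eq_le)
  also have "\<dots> = f (v q) - f (v p)"
    using sum_Suc_diff'[OF \<open>p \<le> q\<close>, of "\<lambda>j. f (v j)"] .
  finally show ?thesis using pq by simp
qed

text \<open>On a finer grid the step function is constant on each cell, so its value there can be
  read off at the right end.\<close>

lemma step_integral_refine:
  assumes v: "strict_mono_on {..m} v" and u: "mono_on {..n} u" "u ` {..n} \<subseteq> v ` {..m}"
  shows "step_integral W n u c \<omega> =
    (\<Sum>j<m. step_fun n u c (v (Suc j)) * (W (v (Suc j)) \<omega> - W (v j) \<omega>))"
proof -
  have "step_integral W n u c \<omega> = (\<Sum>i<n. c i * (\<Sum>j<m. indicator {u i<..u (Suc i)} (v (Suc j)) *
      (W (v (Suc j)) \<omega> - W (v j) \<omega>)))"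
    unfolding step_integral_def
  proof (intro sum.cong refl arg_cong2[where f = "(*)"])
    fix i assume "i \<in> {..<n}"
    then show "W (u (Suc i)) \<omega> - W (u i) \<omega> = (\<Sum>j<m. indicator {u i<..u (Suc i)} (v (Suc j)) *
        (W (v (Suc j)) \<omega> - W (v j) \<omega>))"
      using u by (intro increment_refine[OF v, of _ _ "\<lambda>x. W x \<omega>"]) (auto intro: mono_onD)
  qed
  also have "\<dots> = (\<Sum>j<m. step_fun n u c (v (Suc j)) * (W (v (Suc j)) \<omega> - W (v j) \<omega>))"
    unfolding step_fun_def sum_distrib_left sum_distrib_right
    by (subst sum.swap) (simp add: mult.assoc)
  finally show ?thesis .
qed

text \<open>A step function is its own integral against the path that jumps from 0 to 1 at \<open>x\<close>, so
  facts about \<open>step_integral\<close> also apply to \<open>step_fun\<close>.\<close>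

lemma step_fun_eq_step_integral:
  assumes "mono_on {..n} u"
  shows "step_fun n u c x = step_integral (\<lambda>y z. of_bool (z \<le> y)) n u c x"
  unfolding step_fun_def step_integral_def
proof (intro sum.cong refl arg_cong2[where f = "(*)"])
  fix i assume "i \<in> {..<n}"
  then have "u i \<le> u (Suc i)" using assms by (auto intro: mono_onD)
  then show "indicator {u i<..u (Suc i)} x = of_bool (x \<le> u (Suc i)) - (of_bool (x \<le> u i) :: real)"
    by (auto split: split_indicator)
qed

lemma step_fun_refine:
  assumes "strict_mono_on {..m} v" and "mono_on {..n} u" "u ` {..n} \<subseteq> v ` {..m}"
  shows "step_fun n u c x = step_fun m v (\<lambda>j. step_fun n u c (v (Suc j))) x"
proof -
  have "mono_on {..m} v"
    using assms(1) by (rule strict_mono_on_imp_mono_on)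
  show ?thesis
    by (subst (1 2) step_fun_eq_step_integral)
      (use assms \<open>mono_on {..m} v\<close> step_integral_refine[OF assms, of "\<lambda>y z. of_bool (z \<le> y)" c x]
        in \<open>auto simp: step_integral_def\<close>)
qed

text \<open>The cells are disjoint, so no mixed products arise.\<close>

lemma step_fun_square:
  assumes v: "strict_mono_on {..m} v"
  shows "(step_fun m v d x)\<^sup>2 = (\<Sum>j<m. (d j)\<^sup>2 * indicator {v j<..v (Suc j)} x)"
proof (cases "\<exists>k<m. x \<in> {v k<..v (Suc k)}")
  case True
  then obtain k where k: "k < m" "x \<in> {v k<..v (Suc k)}" by blast
  have zero: "x \<notin> {v j<..v (Suc j)}" if "j < m" "j \<noteq> k" for j
  proof (cases "j < k")
    case True
    then have "v (Suc j) \<le> v k"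
      using k that by (subst strict_mono_on_atMost_less_iff[OF v]) auto
    then show ?thesis using k by auto
  next
    case False
    then have "v (Suc k) \<le> v j"
      using k that by (subst strict_mono_on_atMost_less_iff[OF v]) auto
    then show ?thesis using k by auto
  qed
  have ind: "indicator {v j<..v (Suc j)} x = (if j = k then 1 else 0 :: real)" if "j < m" for j
    using zero[OF that] k(2) by (auto simp del: greaterThanAtMost_iff)
  have "step_fun m v d x = (\<Sum>j<m. if j = k then d j else 0)"
    unfolding step_fun_def by (intro sum.cong) (auto simp: ind)
  moreover have "(\<Sum>j<m. (d j)\<^sup>2 * indicator {v j<..v (Suc j)} x) = (\<Sum>j<m. if j = k then (d j)\<^sup>2 else 0)"
    by (intro sum.cong) (auto simp: ind)
  ultimately show ?thesis using k by simp
next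
  case False
  then have "indicator {v j<..v (Suc j)} x = (0 :: real)" if "j < m" for j
    using that by (auto simp del: greaterThanAtMost_iff)
  then show ?thesis by (simp add: step_fun_def)
qed

lemma borel_measurable_step_fun [measurable]: "step_fun n u c \<in> borel_measurable borel"
  unfolding step_fun_def[abs_def] by measurable

text \<open>For a Brownian motion the right-hand side is also the variance of the step integral:
  this is the Ito isometry for step functions.\<close>

lemma nn_integral_step_fun_square:
  assumes v: "strict_mono_on {..m} v"
  shows "(\<integral>\<^sup>+x. ennreal ((step_fun m v d x)\<^sup>2) \<partial>lborel) = ennreal (\<Sum>j<m. (d j)\<^sup>2 * (v (Suc j) - v j))"
proof -
  have le: "v j \<le> v (Suc j)" if "j < m" for j
    using that by (subst strict_mono_on_atMost_less_iff[OF v]) auto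
  have "(\<integral>\<^sup>+x. ennreal ((step_fun m v d x)\<^sup>2) \<partial>lborel)
      = (\<integral>\<^sup>+x. (\<Sum>j<m. ennreal ((d j)\<^sup>2) * indicator {v j<..v (Suc j)} x) \<partial>lborel)"
    unfolding step_fun_square[OF v]
    by (intro nn_integral_cong, subst sum_ennreal[symmetric])
      (simp, intro sum.cong refl, simp split: split_indicator)
  also have "\<dots> = (\<Sum>j<m. ennreal ((d j)\<^sup>2) * ennreal (v (Suc j) - v j))"
    by (subst nn_integral_sum) (auto simp: nn_integral_cmult le)
  also have "\<dots> = ennreal (\<Sum>j<m. (d j)\<^sup>2 * (v (Suc j) - v j))"
    using le by (subst sum_ennreal[symmetric]) (auto intro!: sum.cong simp: ennreal_mult)
  finally show ?thesis .
qed

section \<open>Gaussian law of a step integral\<close>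

lemma brownian_motion_measurable:
  assumes "brownian_motion M T W" "t \<in> {0..T}"
  shows "W t \<in> borel_measurable M"
  using assms by (auto simp: brownian_motion_def continuous_process_def)

lemma step_integral_measurable:
  assumes "\<And>i. i \<le> n \<Longrightarrow> W (u i) \<in> borel_measurable M"
  shows "step_integral W n u c \<in> borel_measurable M"
  unfolding step_integral_def[abs_def] using assms by (intro borel_measurable_sum borel_measurable_times borel_measurable_diff) auto

lemma (in prob_space) brownian_increments:
  assumes W: "brownian_motion M T W" and v: "strict_mono_on {..m} v" "v ` {..m} \<subseteq> {0..T}"
  shows "indep_vars (\<lambda>_. borel) (\<lambda>j \<omega>. W (v (Suc j)) \<omega> - W (v j) \<omega>) {..<m}"
    and "j < m \<Longrightarrow> distributed M lborel (\<lambda>\<omega>. W (v (Suc j)) \<omega> - W (v j) \<omega>)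
      (normal_density 0 (sqrt (v (Suc j) - v j)))"
proof -
  show "indep_vars (\<lambda>_. borel) (\<lambda>j \<omega>. W (v (Suc j)) \<omega> - W (v j) \<omega>) {..<m}"
    using W v unfolding brownian_motion_def by blast
  assume "j < m"
  moreover from this have "v j < v (Suc j)"
    by (subst strict_mono_on_atMost_less_iff[OF v(1)]) auto
  moreover have "v j \<in> {0..T}" "v (Suc j) \<in> {0..T}"
    using \<open>j < m\<close> v(2) unfolding image_subset_iff by simp_all
  ultimately show "distributed M lborel (\<lambda>\<omega>. W (v (Suc j)) \<omega> - W (v j) \<omega>)
      (normal_density 0 (sqrt (v (Suc j) - v j)))"
    using W unfolding brownian_motion_def by auto
qed

lemma (in prob_space) distributed_step_integral:
  assumes W: "brownian_motion M T W" and u: "mono_on {..n} u" "u ` {..n} \<subseteq> {0..T}"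
    and V: "0 < V" "(\<integral>\<^sup>+x. ennreal ((step_fun n u c x)\<^sup>2) \<partial>lborel) = ennreal V"
  shows "distributed M lborel (step_integral W n u c) (normal_density 0 (sqrt V))"
proof -
  have "finite (u ` {..n})" "u ` {..n} \<noteq> {}" by auto
  then obtain m and v :: "nat \<Rightarrow> real" where v: "strict_mono_on {..m} v" "v ` {..m} = u ` {..n}"
    using finite_set_strict_enumeration by blast
  define d where "d j = step_fun n u c (v (Suc j))" for j
  define D where "D j \<omega> = W (v (Suc j)) \<omega> - W (v j) \<omega>" for j \<omega>
  have lt: "v j < v (Suc j)" if "j < m" for j
    using that by (subst strict_mono_on_atMost_less_iff[OF v(1)]) auto
  have VT: "v ` {..m} \<subseteq> {0..T}" using v u by simp
  have V_eq: "V = (\<Sum>j<m. (d j)\<^sup>2 * (v (Suc j) - v j))"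
  proof -
    have "step_fun n u c = step_fun m v d"
      unfolding d_def using v(2) by (intro ext step_fun_refine[OF v(1) u(1)]) simp
    then have "ennreal V = ennreal (\<Sum>j<m. (d j)\<^sup>2 * (v (Suc j) - v j))"
      using V(2) nn_integral_step_fun_square[OF v(1), of d] by simp
    then show ?thesis
      using V(1) lt by (subst (asm) ennreal_inj) (auto intro!: sum_nonneg mult_nonneg_nonneg simp: less_imp_le)
  qed
  \<comment> \<open>Cells with coefficient 0 are dropped, because the lemmas on normal densities ask
    for nonzero factors and positive standard deviations. The assumption 0 < V keeps the index set
    nonempty.\<close>
  define I where "I = {j\<in>{..<m}. d j \<noteq> 0}"
  have I: "finite I" "I \<subseteq> {..<m}" by (auto simp: I_def)
  have "V = (\<Sum>j\<in>I. (d j)\<^sup>2 * (v (Suc j) - v j))"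
    unfolding V_eq by (intro sum.mono_neutral_right) (auto simp: I_def)
  also have "\<dots> = (\<Sum>j\<in>I. (\<bar>d j\<bar> * sqrt (v (Suc j) - v j))\<^sup>2)"
    using I lt by (intro sum.cong) (auto simp: power_mult_distrib less_imp_le)
  finally have V_I: "V = (\<Sum>j\<in>I. (\<bar>d j\<bar> * sqrt (v (Suc j) - v j))\<^sup>2)" .
  with V(1) have "I \<noteq> {}" by auto
  note incr = brownian_increments[OF W v(1) VT, folded D_def]
  have "distributed M lborel (\<lambda>\<omega>. \<Sum>j\<in>I. d j * D j \<omega>)
      (normal_density (\<Sum>j\<in>I. 0) (sqrt (\<Sum>j\<in>I. (\<bar>d j\<bar> * sqrt (v (Suc j) - v j))\<^sup>2)))"
  proof (rule sum_indep_normal[OF \<open>finite I\<close> \<open>I \<noteq> {}\<close>])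
    have "indep_vars (\<lambda>_. borel) (\<lambda>j \<omega>. d j * D j \<omega>) {..<m}"
      by (rule indep_vars_compose2[OF incr(1)[folded D_def]]) auto
    then show "indep_vars (\<lambda>_. borel) (\<lambda>j \<omega>. d j * D j \<omega>) I"
      using I(2) by (rule indep_vars_subset)
    fix j assume j: "j \<in> I"
    then show "0 < \<bar>d j\<bar> * sqrt (v (Suc j) - v j)"
      using lt by (auto simp: I_def)
    have "distributed M lborel (D j) (normal_density 0 (sqrt (v (Suc j) - v j)))"
      using incr(2) j I unfolding D_def by auto
    from normal_density_affine[OF this, of "d j" 0] j lt
    show "distributed M lborel (\<lambda>\<omega>. d j * D j \<omega>) (normal_density 0 (\<bar>d j\<bar> * sqrt (v (Suc j) - v j)))"
      by (auto simp: I_def)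
  qed
  moreover have "(\<lambda>\<omega>. \<Sum>j\<in>I. d j * D j \<omega>) = step_integral W n u c"
  proof
    fix \<omega>
    have "step_integral W n u c \<omega> = (\<Sum>j<m. d j * D j \<omega>)"
      unfolding d_def D_def using v by (intro step_integral_refine[OF v(1) u(1)]) auto
    also have "\<dots> = (\<Sum>j\<in>I. d j * D j \<omega>)"
      by (intro sum.mono_neutral_right) (auto simp: I_def)
    finally show "(\<Sum>j\<in>I. d j * D j \<omega>) = step_integral W n u c \<omega>" ..
  qed
  ultimately show ?thesis using V_I by simp
qed

section \<open>Independence of the future from the augmented past\<close>

lemma (in prob_space) step_integral_indep_cylinder:
  assumes W: "brownian_motion M T W" and s: "0 \<le> s" "s \<le> T"
    and J: "finite J" "J \<subseteq> {0..s}" "\<And>x. x \<in> J \<Longrightarrow> A x \<in> sets borel"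
    and u: "mono_on {..n} u" "u ` {..n} \<subseteq> {s..T}" and B: "B \<in> sets borel"
  shows "prob ({\<omega>\<in>space M. \<forall>x\<in>J. W x \<omega> \<in> A x} \<inter> (step_integral W n u c -` B \<inter> space M))
    = prob {\<omega>\<in>space M. \<forall>x\<in>J. W x \<omega> \<in> A x} * prob (step_integral W n u c -` B \<inter> space M)"
proof -
  \<comment> \<open>One grid for everything. With 0 and s among its points no cell straddles s, so
    the past is a function of the increments before s and the step integral one of those after
    s.\<close>
  let ?P = "insert 0 (insert s (J \<union> u ` {..n}))"
  have "finite ?P" "?P \<noteq> {}" using J by auto
  then obtain m and v :: "nat \<Rightarrow> real" where v: "strict_mono_on {..m} v" "v ` {..m} = ?P"
    using finite_set_strict_enumeration by blast
  have VT: "v ` {..m} \<subseteq> {0..T}" using v u J s by auto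
  note iff = strict_mono_on_atMost_less_iff[OF v(1)]
  obtain r where r: "r \<le> m" "v r = s"
    using v(2) by (metis (no_types, lifting) atMost_iff imageE insertCI)
  define D where "D j \<omega> = W (v (Suc j)) \<omega> - W (v j) \<omega>" for j \<omega>
  have split: "v j < s \<longleftrightarrow> v (Suc j) \<le> s" if "j < m" for j
    using that r iff[of j r] iff[of "Suc j" r] by auto
  define I1 where "I1 = {j\<in>{..<m}. v j < s}"
  define I2 where "I2 = {j\<in>{..<m}. s \<le> v j}"
  have past: "W x \<omega> - W 0 \<omega> = (\<Sum>j\<in>I1. indicator {0<..x} (v (Suc j)) * D j \<omega>)" if "x \<in> J" for x \<omega>
  proof -
    have "W x \<omega> - W 0 \<omega> = (\<Sum>j<m. indicator {0<..x} (v (Suc j)) * D j \<omega>)"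
      unfolding D_def by (rule increment_refine[OF v(1), of _ _ "\<lambda>x. W x \<omega>"]) (use that v J in auto)
    also have "\<dots> = (\<Sum>j\<in>I1. indicator {0<..x} (v (Suc j)) * D j \<omega>)"
    proof (intro sum.mono_neutral_right ballI)
      fix j assume "j \<in> {..<m} - I1"
      then have "s < v (Suc j)" using split by (auto simp: I1_def not_le)
      moreover have "x \<le> s" using that J by auto
      ultimately show "indicator {0<..x} (v (Suc j)) * D j \<omega> = 0" by simp
    qed (auto simp: I1_def)
    finally show ?thesis .
  qed
  have future: "step_integral W n u c \<omega> = (\<Sum>j\<in>I2. step_fun n u c (v (Suc j)) * D j \<omega>)" for \<omega>
  proof -
    have "step_integral W n u c \<omega> = (\<Sum>j<m. step_fun n u c (v (Suc j)) * D j \<omega>)"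
      unfolding D_def using v by (intro step_integral_refine[OF v(1) u(1)]) auto
    also have "\<dots> = (\<Sum>j\<in>I2. step_fun n u c (v (Suc j)) * D j \<omega>)"
    proof (intro sum.mono_neutral_right ballI)
      fix j assume j: "j \<in> {..<m} - I2"
      then have "v (Suc j) \<le> s" using split[of j] by (simp add: I2_def not_le)
      moreover have "s \<le> u i" if "i < n" for i
        using u(2) that unfolding image_subset_iff by simp
      \<comment> \<open>The step function lives on cells (u i, u (Suc i)] to the right of s.\<close>
      ultimately have "step_fun n u c (v (Suc j)) = 0"
        unfolding step_fun_def by (intro sum.neutral) (force split: split_indicator)
      then show "step_fun n u c (v (Suc j)) * D j \<omega> = 0" by simp
    qed (auto simp: I2_def)
    finally show ?thesis .
  qed
  have indep: "indep_var (PiM I1 (\<lambda>_. borel)) (\<lambda>\<omega>. restrict (\<lambda>j. D j \<omega>) I1)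
      (PiM I2 (\<lambda>_. borel)) (\<lambda>\<omega>. restrict (\<lambda>j. D j \<omega>) I2)"
    using brownian_increments(1)[OF W v(1) VT] unfolding D_def[symmetric]
    by (rule indep_var_restrict) (auto simp: I1_def I2_def)
  let ?S1 = "{f\<in>space (PiM I1 (\<lambda>_. borel)). \<forall>x\<in>J. (\<Sum>j\<in>I1. indicator {0<..x} (v (Suc j)) * f j) \<in> A x}"
  let ?S2 = "{f\<in>space (PiM I2 (\<lambda>_. borel)). (\<Sum>j\<in>I2. step_fun n u c (v (Suc j)) * f j) \<in> B}"
  have S1: "?S1 \<in> sets (PiM I1 (\<lambda>_. borel))"
  proof (rule sets.sets_Collect_finite_All)
    fix x assume "x \<in> J"
    with J(3) have [measurable]: "A x \<in> sets borel" .
    show "{f\<in>space (PiM I1 (\<lambda>_. borel)). (\<Sum>j\<in>I1. indicator {0<..x} (v (Suc j)) * f j) \<in> A x}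
        \<in> sets (PiM I1 (\<lambda>_. borel))"
      by measurable
  qed (rule J)
  have S2: "?S2 \<in> sets (PiM I2 (\<lambda>_. borel))"
    using B by measurable
  let ?C = "{\<omega>\<in>space M. \<forall>x\<in>J. W x \<omega> \<in> A x}"
  \<comment> \<open>\<open>W 0\<close> vanishes only almost surely, so the cylinder is replaced by
    one formed with increments from time 0, which changes it by a null set.\<close>
  let ?C' = "{\<omega>\<in>space M. \<forall>x\<in>J. W x \<omega> - W 0 \<omega> \<in> A x}"
  let ?G = "step_integral W n u c -` B \<inter> space M"
  have WM: "W x \<in> borel_measurable M" if "x \<in> {0..T}" for x
    using W that by (rule brownian_motion_measurable)
  have W0: "W 0 \<in> borel_measurable M" by (rule WM) (use s in auto)
  have C: "?C \<in> events" "?C' \<in> events"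
  proof -
    have meas: "W x \<in> borel_measurable M" "A x \<in> sets borel" if "x \<in> J" for x
      using that J s by (auto intro!: WM)
    have "{\<omega>\<in>space M. W x \<omega> \<in> A x} \<in> events" "{\<omega>\<in>space M. W x \<omega> - W 0 \<omega> \<in> A x} \<in> events"
      if "x \<in> J" for x
      using meas[OF that] W0 by measurable
    then show "?C \<in> events" "?C' \<in> events"
      using J(1) by (simp_all add: sets.sets_Collect_finite_All)
  qed
  have G: "?G \<in> events"
    by (rule measurable_sets[OF step_integral_measurable B]) (use u s in \<open>auto intro!: WM\<close>)
  have ae: "AE \<omega> in M. W 0 \<omega> = 0"
    using W by (auto simp: brownian_motion_def)
  have S1_eq: "(\<lambda>\<omega>. restrict (\<lambda>j. D j \<omega>) I1) -` ?S1 \<inter> space M = ?C'"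
    by (auto simp: past space_PiM)
  have S2_eq: "(\<lambda>\<omega>. restrict (\<lambda>j. D j \<omega>) I2) -` ?S2 \<inter> space M = ?G"
    by (auto simp: future space_PiM)
  have "prob (?C \<inter> ?G) = prob (?C' \<inter> ?G)"
    using ae C G by (intro finite_measure_eq_AE) (auto elim!: eventually_mono)
  also have "?C' \<inter> ?G = (\<lambda>\<omega>. (restrict (\<lambda>j. D j \<omega>) I1, restrict (\<lambda>j. D j \<omega>) I2)) -` (?S1 \<times> ?S2) \<inter> space M"
    unfolding S1_eq[symmetric] S2_eq[symmetric] by auto
  also have "prob \<dots> = prob ?C' * prob ?G"
    using indep_varD[OF indep S1 S2] unfolding S1_eq S2_eq .
  also have "prob ?C' = prob ?C"
    using ae C by (intro finite_measure_eq_AE) (auto elim!: eventually_mono)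
  finally show ?thesis .
qed

text \<open>Several times are allowed at once so that these events are stable under intersection;
  this is what extending independence to the generated sigma-algebra requires.\<close>

definition past_cylinders :: "'a measure \<Rightarrow> (real \<Rightarrow> 'a \<Rightarrow> real) \<Rightarrow> real \<Rightarrow> 'a set set" where
  "past_cylinders M W s =
     {{\<omega>\<in>space M. \<forall>x\<in>J. W x \<omega> \<in> A x} | J A.
        finite J \<and> J \<subseteq> {0..s} \<and> (\<forall>x\<in>J. A x \<in> sets borel)}"

lemma Int_stable_past_cylinders: "Int_stable (past_cylinders M W s)"
proof (rule Int_stableI)
  fix a b assume "a \<in> past_cylinders M W s" "b \<in> past_cylinders M W s"
  then obtain J A J' A' where
    a: "a = {\<omega>\<in>space M. \<forall>x\<in>J. W x \<omega> \<in> A x}" "finite J" "J \<subseteq> {0..s}" "\<forall>x\<in>J. A x \<in> sets borel" and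
    b: "b = {\<omega>\<in>space M. \<forall>x\<in>J'. W x \<omega> \<in> A' x}" "finite J'" "J' \<subseteq> {0..s}" "\<forall>x\<in>J'. A' x \<in> sets borel"
    unfolding past_cylinders_def by blast
  let ?A = "\<lambda>x. (if x \<in> J then A x else UNIV) \<inter> (if x \<in> J' then A' x else UNIV)"
  have "a \<inter> b = {\<omega>\<in>space M. \<forall>x\<in>J \<union> J'. W x \<omega> \<in> ?A x}"
    using a b by (auto split: if_splits)
  moreover have "\<forall>x\<in>J \<union> J'. ?A x \<in> sets borel"
    using a b by auto
  ultimately show "a \<inter> b \<in> past_cylinders M W s"
    unfolding past_cylinders_def using a b by (intro CollectI exI[of _ "J \<union> J'"] exI[of _ ?A]) auto
qed

lemma past_cylinders_subset_sets:
  assumes W: "brownian_motion M T W" and "s \<le> T"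
  shows "past_cylinders M W s \<subseteq> sets M"
proof
  fix a assume "a \<in> past_cylinders M W s"
  then obtain J A where
    a: "a = {\<omega>\<in>space M. \<forall>x\<in>J. W x \<omega> \<in> A x}" "finite J" "J \<subseteq> {0..s}" "\<forall>x\<in>J. A x \<in> sets borel"
    unfolding past_cylinders_def by blast
  have W_meas: "W x \<in> borel_measurable M" if "x \<in> J" for x
    using that a assms by (intro brownian_motion_measurable[OF W]) auto
  show "a \<in> sets M"
    unfolding a(1)
  proof (intro sets.sets_Collect_finite_All[OF _ a(2)])
    fix x assume "x \<in> J"
    with a(4) W_meas
    have [measurable]: "W x \<in> borel_measurable M" "A x \<in> sets borel" by auto
    show "{\<omega>\<in>space M. W x \<omega> \<in> A x} \<in> sets M" by measurable
  qed
qed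

text \<open>The sets that agree with an event of the unaugmented past up to a null set of
  \<open>M\<close> form a sigma-algebra containing all generators. The detour is forced because null
  sets of the completion may fail to be events of \<open>M\<close>.\<close>

lemma augmented_filtration_approx:
  assumes "E \<in> sets (augmented_filtration M W s)"
  shows "\<exists>E'\<in>sigma_sets (space M) (past_cylinders M W s). \<exists>N\<in>null_sets M. (E - E') \<union> (E' - E) \<subseteq> N"
proof -
  let ?P = "past_cylinders M W s"
  let ?A = "{W r -` A \<inter> space M | r A. r \<in> {0..s} \<and> A \<in> sets borel} \<union> null_sets (completion M)"
  have "?A \<subseteq> Pow (space M)"
    using sets.sets_into_space[of _ "completion M"] by (auto simp: null_sets_def)
  then have "E \<in> sigma_sets (space M) ?A"
    using assms unfolding augmented_filtration_def by (simp add: sets_measure_of)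
  then show ?thesis
  proof induction
    case (Basic a)
    then show ?case
    proof
      assume "a \<in> {W r -` A \<inter> space M | r A. r \<in> {0..s} \<and> A \<in> sets borel}"
      then obtain r A where r: "a = W r -` A \<inter> space M" "r \<in> {0..s}" "A \<in> sets borel" by blast
      have "a \<in> ?P"
        unfolding past_cylinders_def using r by (intro CollectI exI[of _ "{r}"] exI[of _ "\<lambda>_. A"]) auto
      then show ?case by (intro bexI[of _ a] bexI[of _ "{}"]) auto
    next
      assume "a \<in> null_sets (completion M)"
      then obtain N where N: "N \<in> null_sets M" "a \<subseteq> N"
        unfolding null_sets_completion_iff2 by (rule bexE)
      show ?case
        by (rule bexI[OF bexI[OF _ N(1)] sigma_sets.Empty]) (use N(2) in simp)
    qed
  next
    case Empty
    show ?case by (rule bexI[OF bexI[of _ "{}"] sigma_sets.Empty]) simp_all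
  next
    case (Compl a)
    then obtain E' N where "E' \<in> sigma_sets (space M) ?P" "N \<in> null_sets M" "(a - E') \<union> (E' - a) \<subseteq> N"
      by blast
    then show ?case
      by (intro bexI[OF bexI[of _ N] sigma_sets.Compl[of E']]) auto
  next
    case (Union a)
    have "\<forall>i. \<exists>E'\<in>sigma_sets (space M) ?P. \<exists>N\<in>null_sets M. (a i - E') \<union> (E' - a i) \<subseteq> N"
      by (rule allI) (rule Union.IH)
    then obtain E' where
      "\<forall>i. E' i \<in> sigma_sets (space M) ?P \<and> (\<exists>N. N \<in> null_sets M \<and> (a i - E' i) \<union> (E' i - a i) \<subseteq> N)"
      unfolding Bex_def choice_iff by (rule exE)
    then have E': "\<And>i. E' i \<in> sigma_sets (space M) ?P"
      and "\<forall>i. \<exists>N. N \<in> null_sets M \<and> (a i - E' i) \<union> (E' i - a i) \<subseteq> N"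
      by simp_all
    then obtain N where "\<forall>i. N i \<in> null_sets M \<and> (a i - E' i) \<union> (E' i - a i) \<subseteq> N i"
      unfolding choice_iff by (elim exE)
    then have N: "\<And>i. N i \<in> null_sets M" "\<And>i. (a i - E' i) \<union> (E' i - a i) \<subseteq> N i"
      by simp_all
    have "(\<Union>i. E' i) \<in> sigma_sets (space M) ?P" using E' by (rule sigma_sets.Union)
    moreover have "(\<Union>i. N i) \<in> null_sets M" using N(1) by (rule null_sets_UN)
    moreover have "((\<Union>i. a i) - (\<Union>i. E' i)) \<union> ((\<Union>i. E' i) - (\<Union>i. a i)) \<subseteq> (\<Union>i. N i)"
      using N(2) by fast
    ultimately show ?case by (intro bexI)
  qed
qed

text \<open>Independence passes from cylinders to the sigma-algebra they generate, and from there to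
  events of \<open>Y\<close> by \<open>augmented_filtration_approx\<close>. Measurability on
  \<open>M\<close> is a separate hypothesis, since the augmented filtration may contain sets that
  are not events of \<open>M\<close>.\<close>

lemma (in prob_space) indep_var_step_integral:
  assumes W: "brownian_motion M T W" and s: "0 \<le> s" "s \<le> T"
    and Y: "Y \<in> borel_measurable M" "Y \<in> borel_measurable (augmented_filtration M W s)"
    and u: "mono_on {..n} u" "u ` {..n} \<subseteq> {s..T}"
  shows "indep_var borel Y borel (step_integral W n u c)"
proof -
  let ?G = "step_integral W n u c"
  let ?GS = "{?G -` B \<inter> space M | B. B \<in> sets borel}"
  let ?YS = "{Y -` B \<inter> space M | B. B \<in> sets borel}"
  have G: "?G \<in> borel_measurable M"
    by (rule step_integral_measurable, rule brownian_motion_measurable[OF W]) (use u s in auto)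
  have Int_stable: "Int_stable {Z -` B \<inter> space M | B. B \<in> sets borel}" for Z :: "'a \<Rightarrow> real"
  proof (rule Int_stableI)
    fix a b assume "a \<in> {Z -` B \<inter> space M | B. B \<in> sets borel}" "b \<in> {Z -` B \<inter> space M | B. B \<in> sets borel}"
    then obtain A B where "a = Z -` A \<inter> space M" "b = Z -` B \<inter> space M" "A \<in> sets borel" "B \<in> sets borel"
      by blast
    then show "a \<inter> b \<in> {Z -` B \<inter> space M | B. B \<in> sets borel}"
      by (intro CollectI exI[of _ "A \<inter> B"]) auto
  qed
  have GS: "?GS \<subseteq> events" and YS: "?YS \<subseteq> events"
    using G Y(1) by (auto intro: measurable_sets)
  have "indep_set (past_cylinders M W s) ?GS"
  proof (rule indep_setI[OF past_cylinders_subset_sets[OF W s(2)] GS])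
    fix a b assume "a \<in> past_cylinders M W s" "b \<in> ?GS"
    then obtain J A B where ab: "a = {\<omega>\<in>space M. \<forall>x\<in>J. W x \<omega> \<in> A x}" "finite J" "J \<subseteq> {0..s}"
      "\<forall>x\<in>J. A x \<in> sets borel" "b = ?G -` B \<inter> space M" "B \<in> sets borel"
      unfolding past_cylinders_def by blast
    then show "prob (a \<inter> b) = prob a * prob b"
      using step_integral_indep_cylinder[OF W s ab(2,3) _ u ab(6), of A] by simp
  qed
  then have indep: "indep_set (sigma_sets (space M) (past_cylinders M W s)) (sigma_sets (space M) ?GS)"
    by (rule indep_set_sigma_sets[OF _ Int_stable_past_cylinders Int_stable])
  have "indep_set ?YS ?GS"
  proof (rule indep_setI[OF YS GS])
    fix a b assume a: "a \<in> ?YS" and b: "b \<in> ?GS"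
    then obtain B where B: "a = Y -` B \<inter> space M" "B \<in> sets borel" by blast
    have "space (augmented_filtration M W s) = space M"
      unfolding augmented_filtration_def by (simp add: space_measure_of_conv)
    then have "a \<in> sets (augmented_filtration M W s)"
      using measurable_sets[OF Y(2) B(2)] B(1) by simp
    from augmented_filtration_approx[OF this] obtain E N
      where E: "E \<in> sigma_sets (space M) (past_cylinders M W s)" "N \<in> null_sets M" "(a - E) \<union> (E - a) \<subseteq> N"
      by blast
    have ev: "a \<in> events" "b \<in> events" "E \<in> events"
      using a b GS YS indep E(1) unfolding indep_sets2_eq by blast+
    have ae: "AE \<omega> in M. \<omega> \<in> a \<longleftrightarrow> \<omega> \<in> E"
      using AE_not_in[OF E(2)] E(3) by (auto elim!: eventually_mono)
    have "prob (a \<inter> b) = prob (E \<inter> b)" "prob a = prob E"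
      using ae ev by (auto intro!: finite_measure_eq_AE elim!: eventually_mono)
    moreover have "prob (E \<inter> b) = prob E * prob b"
      using indep E(1) b unfolding indep_sets2_eq by (blast intro: sigma_sets.Basic)
    ultimately show "prob (a \<inter> b) = prob a * prob b" by simp
  qed
  then show ?thesis
    unfolding indep_var_eq using G Y(1) indep_set_sigma_sets[OF _ Int_stable Int_stable] by auto
qed

section \<open>Anti-concentration of Wiener integrals\<close>

lemma (in prob_space) prob_abs_add_normal_le:
  assumes indep: "indep_var borel Y borel G"
    and G: "distributed M lborel G (normal_density 0 \<sigma>)" and "0 < \<sigma>" "0 \<le> r"
  shows "prob {\<omega>\<in>space M. \<bar>Y \<omega> + G \<omega>\<bar> \<le> r} \<le> r / \<sigma>"
proof -
  have meas [measurable]: "Y \<in> borel_measurable M" "G \<in> borel_measurable M"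
    using indep_var_rv1[OF indep] indep_var_rv2[OF indep] by auto
  let ?S = "{p :: real \<times> real. \<bar>fst p + snd p\<bar> \<le> r}"
  have "{p \<in> space (borel \<Otimes>\<^sub>M borel). \<bar>fst p + snd p\<bar> \<le> r} \<in> sets (borel \<Otimes>\<^sub>M borel)"
    by measurable
  then have S: "?S \<in> sets (borel \<Otimes>\<^sub>M borel)"
    by (simp add: space_pair_measure)
  interpret G: prob_space "distr M borel G" by (rule prob_space_distr) simp
  interpret Y: prob_space "distr M borel Y" by (rule prob_space_distr) simp
  \<comment> \<open>The maximum of the density is 1 / (sqrt (2 pi) \<sigma>), and 2 pi \<ge>
    4.\<close>
  have dens: "normal_density 0 \<sigma> x \<le> 1 / (2 * \<sigma>)" for x
  proof -
    have "2 * \<sigma> = sqrt (4 * \<sigma>\<^sup>2)"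
      using \<open>0 < \<sigma>\<close> by (simp add: real_sqrt_mult)
    also have "\<dots> \<le> sqrt (2 * pi * \<sigma>\<^sup>2)"
      using pi_ge_two by (intro real_sqrt_le_mono mult_right_mono) auto
    finally have "1 / sqrt (2 * pi * \<sigma>\<^sup>2) \<le> 1 / (2 * \<sigma>)"
      using \<open>0 < \<sigma>\<close> by (intro divide_left_mono) auto
    moreover have "normal_density 0 \<sigma> x \<le> 1 / sqrt (2 * pi * \<sigma>\<^sup>2) * 1"
      unfolding normal_density_def by (intro mult_left_mono) auto
    ultimately show ?thesis by linarith
  qed
  \<comment> \<open>An interval of length 2 r has mass at most 2 r / (2 \<sigma>) wherever it is
    centred, so integrating over the law of \<open>Y\<close> preserves the bound.\<close>
  have slice: "emeasure (distr M borel G) (Pair y -` ?S) \<le> ennreal (r / \<sigma>)" for y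
  proof -
    have eq: "Pair y -` ?S = {- r - y..r - y}" by auto
    have "distr M borel G = distr M lborel G" by (rule distr_cong) auto
    also have "\<dots> = density lborel (normal_density 0 \<sigma>)"
      using G by (rule distributed_distr_eq_density)
    finally have "emeasure (distr M borel G) (Pair y -` ?S)
        = (\<integral>\<^sup>+x. ennreal (normal_density 0 \<sigma> x) * indicator {- r - y..r - y} x \<partial>lborel)"
      unfolding eq by (simp add: emeasure_density)
    also have "\<dots> \<le> (\<integral>\<^sup>+x. ennreal (1 / (2 * \<sigma>)) * indicator {- r - y..r - y} x \<partial>lborel)"
      by (intro nn_integral_mono mult_right_mono ennreal_leI dens) auto
    also have "\<dots> = ennreal (1 / (2 * \<sigma>)) * ennreal (2 * r)"
      using \<open>0 \<le> r\<close> by (simp add: nn_integral_cmult)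
    also have "\<dots> = ennreal (r / \<sigma>)"
      using \<open>0 \<le> r\<close> \<open>0 < \<sigma>\<close> by (simp flip: ennreal_mult)
    finally show ?thesis .
  qed
  have "emeasure M {\<omega>\<in>space M. \<bar>Y \<omega> + G \<omega>\<bar> \<le> r}
      = emeasure (distr M (borel \<Otimes>\<^sub>M borel) (\<lambda>\<omega>. (Y \<omega>, G \<omega>))) ?S"
    using S by (subst emeasure_distr) (auto intro!: arg_cong[where f = "emeasure M"])
  also have "distr M (borel \<Otimes>\<^sub>M borel) (\<lambda>\<omega>. (Y \<omega>, G \<omega>)) = distr M borel Y \<Otimes>\<^sub>M distr M borel G"
    using indep unfolding indep_var_distribution_eq by simp
  also have "emeasure (distr M borel Y \<Otimes>\<^sub>M distr M borel G) ?S
      = (\<integral>\<^sup>+y. emeasure (distr M borel G) (Pair y -` ?S) \<partial>distr M borel Y)"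
    using S by (intro G.emeasure_pair_measure_alt) auto
  also have "\<dots> \<le> (\<integral>\<^sup>+y. ennreal (r / \<sigma>) \<partial>distr M borel Y)"
    by (intro nn_integral_mono slice)
  also have "\<dots> = ennreal (r / \<sigma>)"
    using Y.emeasure_space_1 by simp
  finally show ?thesis
    using \<open>0 \<le> r\<close> \<open>0 < \<sigma>\<close> by (simp add: emeasure_eq_measure)
qed

lemma (in prob_space) tendsto_prob_of_L2:
  fixes Z :: "nat \<Rightarrow> 'a \<Rightarrow> real"
  assumes Z: "\<And>k. Z k \<in> borel_measurable M" and "0 < \<eta>"
    and lim: "(\<lambda>k. \<integral>\<^sup>+\<omega>. ennreal ((Z k \<omega>)\<^sup>2) \<partial>M) \<longlonglongrightarrow> 0"
  shows "(\<lambda>k. prob {\<omega>\<in>space M. \<eta> \<le> \<bar>Z k \<omega>\<bar>}) \<longlonglongrightarrow> 0"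
proof -
  have "emeasure M {\<omega>\<in>space M. \<eta> \<le> \<bar>Z k \<omega>\<bar>} \<le> ennreal (1 / \<eta>\<^sup>2) * (\<integral>\<^sup>+\<omega>. ennreal ((Z k \<omega>)\<^sup>2) \<partial>M)" for k
  proof -
    have "{\<omega>\<in>space M. \<eta> \<le> \<bar>Z k \<omega>\<bar>} \<subseteq> {\<omega>\<in>space M. 1 \<le> ennreal (1 / \<eta>\<^sup>2) * ennreal ((Z k \<omega>)\<^sup>2)}"
    proof safe
      fix \<omega> assume "\<eta> \<le> \<bar>Z k \<omega>\<bar>"
      then have "\<eta>\<^sup>2 \<le> (Z k \<omega>)\<^sup>2"
        using \<open>0 < \<eta>\<close> by (metis abs_of_pos power2_le_iff_abs_le less_imp_le power2_abs abs_ge_zero power_mono)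
      then show "1 \<le> ennreal (1 / \<eta>\<^sup>2) * ennreal ((Z k \<omega>)\<^sup>2)"
        using \<open>0 < \<eta>\<close> by (simp flip: ennreal_mult)
    qed
    then have "emeasure M {\<omega>\<in>space M. \<eta> \<le> \<bar>Z k \<omega>\<bar>}
        \<le> emeasure M {\<omega>\<in>space M. 1 \<le> ennreal (1 / \<eta>\<^sup>2) * ennreal ((Z k \<omega>)\<^sup>2)}"
      using Z[of k] by (intro emeasure_mono) measurable
    also have "\<dots> \<le> ennreal (1 / \<eta>\<^sup>2) * (\<integral>\<^sup>+\<omega>. ennreal ((Z k \<omega>)\<^sup>2) * indicator (space M) \<omega> \<partial>M)"
      using Z[of k] nn_integral_Markov_inequality[of "\<lambda>\<omega>. ennreal ((Z k \<omega>)\<^sup>2)" "space M" M "ennreal (1 / \<eta>\<^sup>2)"]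
      by simp
    also have "(\<integral>\<^sup>+\<omega>. ennreal ((Z k \<omega>)\<^sup>2) * indicator (space M) \<omega> \<partial>M) = (\<integral>\<^sup>+\<omega>. ennreal ((Z k \<omega>)\<^sup>2) \<partial>M)"
      by (intro nn_integral_cong) auto
    finally show ?thesis .
  qed
  note bound = this
  have lim': "(\<lambda>k. ennreal (1 / \<eta>\<^sup>2) * (\<integral>\<^sup>+\<omega>. ennreal ((Z k \<omega>)\<^sup>2) \<partial>M)) \<longlonglongrightarrow> 0"
    using ennreal_tendsto_cmult[OF _ lim, of "ennreal (1 / \<eta>\<^sup>2)"] by simp
  have "(\<lambda>k. emeasure M {\<omega>\<in>space M. \<eta> \<le> \<bar>Z k \<omega>\<bar>}) \<longlonglongrightarrow> 0"
    by (rule tendsto_sandwich[OF _ _ tendsto_const lim']) (simp_all add: bound)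
  then have "(\<lambda>k. ennreal (prob {\<omega>\<in>space M. \<eta> \<le> \<bar>Z k \<omega>\<bar>})) \<longlonglongrightarrow> ennreal 0"
    by (simp add: emeasure_eq_measure)
  then show ?thesis
    by (subst (asm) tendsto_ennreal_iff) auto
qed

text \<open>Truncating the partition points at s from above and from below avoids locating the cell
  that contains s: the values of \<open>W\<close> at the minimum and the maximum always add up to W
  s + W x, and W s cancels in differences.\<close>

lemma step_integral_split:
  "step_integral W n u c \<omega>
    = step_integral W n (\<lambda>i. min s (u i)) c \<omega> + step_integral W n (\<lambda>i. max s (u i)) c \<omega>"
proof -
  have sum: "W (min s x) \<omega> + W (max s x) \<omega> = W s \<omega> + W x \<omega>" for x
    by (auto simp: min_def max_def)
  have diff: "W y \<omega> - W x \<omega> = (W (min s y) \<omega> - W (min s x) \<omega>) + (W (max s y) \<omega> - W (max s x) \<omega>)" for x y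
    using sum[of x] sum[of y] by linarith
  show ?thesis
    unfolding step_integral_def sum.distrib[symmetric] distrib_left[symmetric]
    by (rule sum.cong[OF refl arg_cong[OF diff]])
qed

lemma step_fun_max:
  "step_fun n (\<lambda>i. max s (u i)) c x = step_fun n u c x * indicator {s<..} x"
  unfolding step_fun_def sum_distrib_right
  by (intro sum.cong refl) (auto split: split_indicator)

text \<open>Conditionally on the past up to time \<open>s\<close> the variable \<open>Bt\<close> is Gaussian with variance
  \<open>\<integral>\<^sub>s\<^sup>t f\<^sup>2\<close>. To avoid conditional laws the estimate is derived for the approximating step
  integrals, which split at \<open>s\<close> into a part measurable with respect to the past and an independent
  Gaussian part.\<close>

lemma (in prob_space) small_ball_estimate:
  assumes W: "brownian_motion M T W" and st: "0 \<le> s" "s < t" "t \<le> T"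
    and Y: "Y \<in> borel_measurable M" "Y \<in> borel_measurable (augmented_filtration M W s)"
    and Bt: "has_wiener_integral M W t f Bt" and Bs: "has_wiener_integral M W s g Bs"
    and V: "0 < V" "ennreal V \<le> (\<integral>\<^sup>+x\<in>{s<..<t}. ennreal ((f x)\<^sup>2) \<partial>lborel)" and r: "0 < r"
  shows "prob {\<omega>\<in>space M. \<bar>Y \<omega> + (Bt \<omega> - Bs \<omega>)\<bar> \<le> r} \<le> 4 * r / sqrt V"
proof -
  obtain n u c where Bt_meas: "Bt \<in> borel_measurable M" and f_meas: "set_borel_measurable lborel {0<..<t} f"
    and u: "\<And>k. mono_on {..n k} (u k)" "\<And>k. u k ` {..n k} \<subseteq> {0..t}"
    and lim_f: "(\<lambda>k. \<integral>\<^sup>+x\<in>{0<..<t}. ennreal ((f x - step_fun (n k) (u k) (c k) x)\<^sup>2) \<partial>lborel) \<longlonglongrightarrow> 0"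
    and lim_Bt: "(\<lambda>k. \<integral>\<^sup>+\<omega>. ennreal ((Bt \<omega> - step_integral W (n k) (u k) (c k) \<omega>)\<^sup>2) \<partial>M) \<longlonglongrightarrow> 0"
    using Bt unfolding has_wiener_integral_def by blast
  obtain n' u' c' where Bs_meas: "Bs \<in> borel_measurable M"
    and u': "\<And>k. mono_on {..n' k} (u' k)" "\<And>k. u' k ` {..n' k} \<subseteq> {0..s}"
    and lim_Bs: "(\<lambda>k. \<integral>\<^sup>+\<omega>. ennreal ((Bs \<omega> - step_integral W (n' k) (u' k) (c' k) \<omega>)\<^sup>2) \<partial>M) \<longlonglongrightarrow> 0"
    using Bs unfolding has_wiener_integral_def by blast
  define S where "S k = step_integral W (n k) (u k) (c k)" for k
  define S' where "S' k = step_integral W (n' k) (u' k) (c' k)" for k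
  define P where "P k = step_integral W (n k) (\<lambda>i. min s (u k i)) (c k)" for k
  define G where "G k = step_integral W (n k) (\<lambda>i. max s (u k i)) (c k)" for k
  have S_eq: "S k \<omega> = P k \<omega> + G k \<omega>" for k \<omega>
    unfolding S_def P_def G_def by (rule step_integral_split)
  have WM: "W x \<in> borel_measurable M" if "x \<in> {0..T}" for x
    using W that by (rule brownian_motion_measurable)
  have WA: "W x \<in> borel_measurable (augmented_filtration M W s)" if "x \<in> {0..s}" for x
  proof (rule measurableI)
    have sp: "space (augmented_filtration M W s) = space M"
      unfolding augmented_filtration_def by (simp add: space_measure_of_conv)
    have sub: "{W r -` A \<inter> space M | r A. r \<in> {0..s} \<and> A \<in> sets borel} \<union> null_sets (completion M) \<subseteq> Pow (space M)"
      using sets.sets_into_space[of _ "completion M"] by (auto simp: null_sets_def)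
    fix A :: "real set" assume "A \<in> sets borel"
    then have "W x -` A \<inter> space M \<in> {W r -` A \<inter> space M | r A. r \<in> {0..s} \<and> A \<in> sets borel}"
      using that by blast
    then show "W x -` A \<inter> space (augmented_filtration M W s) \<in> sets (augmented_filtration M W s)"
      unfolding sp unfolding augmented_filtration_def sets_measure_of[OF sub]
      by (intro sigma_sets.Basic UnI1)
  qed simp
  have sT: "s \<le> T" using st by simp
  have bounds: "0 \<le> u k i" "u k i \<le> t" if "i \<le> n k" for k i
    using u(2)[of k] that unfolding image_subset_iff by simp_all
  have bounds': "0 \<le> u' k i" "u' k i \<le> s" if "i \<le> n' k" for k i
    using u'(2)[of k] that unfolding image_subset_iff by simp_all
  have boundsT: "u k i \<le> T" if "i \<le> n k" for k i
    using bounds(2)[OF that] st(3) by linarith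
  have boundsT': "u' k i \<le> T" if "i \<le> n' k" for k i
    using bounds'(2)[OF that] sT by linarith
  have S_meas: "S k \<in> borel_measurable M" for k
    unfolding S_def using st sT bounds[of _ k] boundsT[of _ k] by (intro step_integral_measurable WM) simp
  have S'_meas: "S' k \<in> borel_measurable M" "S' k \<in> borel_measurable (augmented_filtration M W s)" for k
    unfolding S'_def using st sT bounds'[of _ k] boundsT'[of _ k] by (intro step_integral_measurable WM WA; simp; fail)+
  have P_meas: "P k \<in> borel_measurable M" "P k \<in> borel_measurable (augmented_filtration M W s)" for k
    unfolding P_def using st sT bounds[of _ k] boundsT[of _ k] by (intro step_integral_measurable WM WA; simp; fail)+
  have max_mono: "mono_on {..n k} (\<lambda>i. max s (u k i))" for k
    by (intro mono_onI max.mono order_refl mono_onD[OF u(1)])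
  have max_range: "(\<lambda>i. max s (u k i)) ` {..n k} \<subseteq> {s..T}" for k
    using sT boundsT[of _ k] by auto
  have max_range0: "(\<lambda>i. max s (u k i)) ` {..n k} \<subseteq> {0..T}" for k
    by (rule order_trans[OF max_range]) (use st in auto)
  have event: "eventually (\<lambda>k. (\<integral>\<^sup>+x\<in>{0<..<t}. ennreal ((f x - step_fun (n k) (u k) (c k) x)\<^sup>2) \<partial>lborel)
      < ennreal (V / 4)) sequentially"
    using V(1) by (intro order_tendstoD(2)[OF lim_f]) simp
  \<comment> \<open>The final constant 4 is 2 * 2: the radius is doubled to absorb the approximation
    errors, and the bound V / 4 for the variance halves the standard deviation.\<close>
  have main: "prob {\<omega>\<in>space M. \<bar>Y \<omega> - S' k \<omega> + P k \<omega> + G k \<omega>\<bar> \<le> 2 * r} \<le> 4 * r / sqrt V"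
    if k: "(\<integral>\<^sup>+x\<in>{0<..<t}. ennreal ((f x - step_fun (n k) (u k) (c k) x)\<^sup>2) \<partial>lborel) < ennreal (V / 4)" for k
  proof -
    let ?sf = "step_fun (n k) (u k) (c k)"
    let ?sg = "step_fun (n k) (\<lambda>i. max s (u k i)) (c k)"
    let ?I = "\<integral>\<^sup>+x. ennreal ((?sg x)\<^sup>2) \<partial>lborel"
    have "?I \<noteq> \<infinity>"
    proof -
      let ?u = "\<lambda>i. max s (u k i)"
      have "finite (?u ` {..n k})" "?u ` {..n k} \<noteq> {}" by auto
      then obtain m and v :: "nat \<Rightarrow> real" where v: "strict_mono_on {..m} v" "v ` {..m} = ?u ` {..n k}"
        using finite_set_strict_enumeration by blast
      have "?sg = step_fun m v (\<lambda>j. ?sg (v (Suc j)))"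
        using v(2) by (intro ext step_fun_refine[OF v(1) max_mono]) simp
      then obtain d where "?sg = step_fun m v d" by blast
      then show ?thesis
        using nn_integral_step_fun_square[OF v(1), of d] by simp
    qed
    then obtain V' where V': "?I = ennreal V'" "0 \<le> V'"
      by (cases ?I) auto
    \<comment> \<open>Integrating f^2 \<le> 2 (f - g)^2 + 2 g^2 over (s, t), with g the step
      function, gives V \<le> 2 (V / 4) + 2 V', that is V' \<ge> V / 4.\<close>
    have "ennreal V \<le> (\<integral>\<^sup>+x. ennreal 2 * (ennreal ((f x - ?sf x)\<^sup>2) * indicator {0<..<t} x)
        + ennreal 2 * ennreal ((?sg x)\<^sup>2) \<partial>lborel)"
    proof (rule order_trans[OF V(2) nn_integral_mono])
      fix x :: real
      have sq: "(f x)\<^sup>2 \<le> 2 * (f x - ?sf x)\<^sup>2 + 2 * (?sf x)\<^sup>2"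
        using sum_squares_ge_zero[of "f x - 2 * ?sf x" 0] by (simp add: power2_eq_square algebra_simps)
      show "ennreal ((f x)\<^sup>2) * indicator {s<..<t} x
          \<le> ennreal 2 * (ennreal ((f x - ?sf x)\<^sup>2) * indicator {0<..<t} x) + ennreal 2 * ennreal ((?sg x)\<^sup>2)"
      proof (cases "x \<in> {s<..<t}")
        case True
        then have "?sg x = ?sf x" "x \<in> {0<..<t}"
          using st by (auto simp: step_fun_max)
        with sq True show ?thesis
          by (simp add: ennreal_leI flip: ennreal_mult ennreal_plus del: ennreal_numeral)
      qed simp
    qed
    also have "\<dots> = ennreal 2 * (\<integral>\<^sup>+x\<in>{0<..<t}. ennreal ((f x - ?sf x)\<^sup>2) \<partial>lborel) + ennreal 2 * ?I"
    proof (subst nn_integral_add)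
      have "(\<lambda>x. ennreal ((f x - ?sf x)\<^sup>2) * indicator {0<..<t} x)
          = (\<lambda>x. ennreal ((indicator {0<..<t} x *\<^sub>R f x - ?sf x)\<^sup>2) * indicator {0<..<t} x)"
        by (auto split: split_indicator)
      moreover have "(\<lambda>x. indicator {0<..<t} x *\<^sub>R f x) \<in> borel_measurable lborel"
        using f_meas unfolding set_borel_measurable_def .
      ultimately have [measurable]: "(\<lambda>x. ennreal ((f x - ?sf x)\<^sup>2) * indicator {0<..<t} x) \<in> borel_measurable lborel"
        by simp
      show "(\<lambda>x. ennreal 2 * (ennreal ((f x - ?sf x)\<^sup>2) * indicator {0<..<t} x)) \<in> borel_measurable lborel"
        by measurable
      show "(\<integral>\<^sup>+x. ennreal 2 * (ennreal ((f x - ?sf x)\<^sup>2) * indicator {0<..<t} x) \<partial>lborel)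
          + (\<integral>\<^sup>+x. ennreal 2 * ennreal ((?sg x)\<^sup>2) \<partial>lborel)
        = ennreal 2 * (\<integral>\<^sup>+x\<in>{0<..<t}. ennreal ((f x - ?sf x)\<^sup>2) \<partial>lborel) + ennreal 2 * ?I"
        by (simp add: nn_integral_cmult)
    qed simp
    also have "\<dots> \<le> ennreal 2 * ennreal (V / 4) + ennreal 2 * ennreal V'"
      using k V' by (intro add_mono mult_left_mono) auto
    also have "\<dots> = ennreal (V / 2 + 2 * V')"
      using V(1) V'(2) by (simp flip: ennreal_mult ennreal_plus del: ennreal_numeral)
    finally have "V / 4 \<le> V'"
      using V(1) V'(2) by (subst (asm) ennreal_le_iff) auto
    then have pos: "0 < V'" using V(1) by linarith
    have "indep_var borel (\<lambda>\<omega>. Y \<omega> - S' k \<omega> + P k \<omega>) borel (G k)"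
      unfolding G_def
      by (rule indep_var_step_integral[OF W _ _ _ _ max_mono max_range])
        (use st Y S'_meas[of k] P_meas[of k] in \<open>auto intro!: borel_measurable_add borel_measurable_diff\<close>)
    moreover have "distributed M lborel (G k) (normal_density 0 (sqrt V'))"
      unfolding G_def by (rule distributed_step_integral[OF W max_mono max_range0 pos V'(1)])
    ultimately have "prob {\<omega>\<in>space M. \<bar>Y \<omega> - S' k \<omega> + P k \<omega> + G k \<omega>\<bar> \<le> 2 * r} \<le> 2 * r / sqrt V'"
      by (rule prob_abs_add_normal_le) (use pos r in auto)
    also have "\<dots> \<le> 2 * r / sqrt (V / 4)"
      using \<open>V / 4 \<le> V'\<close> V(1) pos r by (intro divide_left_mono real_sqrt_le_mono) auto
    also have "\<dots> = 4 * r / sqrt V"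
      by (simp add: real_sqrt_divide)
    finally show ?thesis .
  qed
  \<comment> \<open>Each of the two approximation errors may take r / 2, which together with r makes
    the radius 2 r of \<open>main\<close>.\<close>
  let ?p = "\<lambda>k. prob {\<omega>\<in>space M. r / 2 \<le> \<bar>Bt \<omega> - S k \<omega>\<bar>}"
  let ?q = "\<lambda>k. prob {\<omega>\<in>space M. r / 2 \<le> \<bar>Bs \<omega> - S' k \<omega>\<bar>}"
  let ?A = "{\<omega>\<in>space M. \<bar>Y \<omega> + (Bt \<omega> - Bs \<omega>)\<bar> \<le> r}"
  have "?p \<longlonglongrightarrow> 0"
    by (rule tendsto_prob_of_L2) (use Bt_meas S_meas r lim_Bt in \<open>auto simp: S_def\<close>)
  moreover have "?q \<longlonglongrightarrow> 0"
    by (rule tendsto_prob_of_L2) (use Bs_meas S'_meas r lim_Bs in \<open>auto simp: S'_def\<close>)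
  ultimately have "(\<lambda>k. 4 * r / sqrt V + ?p k + ?q k) \<longlonglongrightarrow> 4 * r / sqrt V + 0 + 0"
    by (intro tendsto_intros)
  moreover have "eventually (\<lambda>k. prob ?A \<le> 4 * r / sqrt V + ?p k + ?q k) sequentially"
    using event
  proof eventually_elim
    case (elim k)
    let ?E = "{\<omega>\<in>space M. \<bar>Y \<omega> - S' k \<omega> + P k \<omega> + G k \<omega>\<bar> \<le> 2 * r}"
    let ?Bp = "{\<omega>\<in>space M. r / 2 \<le> \<bar>Bt \<omega> - S k \<omega>\<bar>}"
    let ?Bq = "{\<omega>\<in>space M. r / 2 \<le> \<bar>Bs \<omega> - S' k \<omega>\<bar>}"
    note [measurable] = Y(1) S_meas[of k] S'_meas(1)[of k] Bt_meas Bs_meas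
    have E: "?E = {\<omega>\<in>space M. \<bar>Y \<omega> - S' k \<omega> + S k \<omega>\<bar> \<le> 2 * r}"
      unfolding S_eq by (simp add: add.assoc)
    have ev: "?E \<in> events" "?Bp \<in> events" "?Bq \<in> events"
      unfolding E by measurable
    have "?A \<subseteq> ?E \<union> ?Bp \<union> ?Bq"
      unfolding E by (auto simp: abs_if split: if_splits)
    then have "prob ?A \<le> prob (?E \<union> ?Bp \<union> ?Bq)"
      using ev by (intro finite_measure_mono) auto
    also have "\<dots> \<le> prob ?E + prob ?Bp + prob ?Bq"
      using ev measure_Un_le[of "?E \<union> ?Bp" M ?Bq] measure_Un_le[of ?E M ?Bp] by auto
    finally show ?case using main[OF elim] by linarith
  qed
  ultimately have "prob ?A \<le> 4 * r / sqrt V + 0 + 0"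
    by (rule tendsto_lowerbound) simp
  then show ?thesis by simp
qed

section \<open>Laws and limits of random variables\<close>

text \<open>For a non-measurable \<open>f\<close> the set function defining \<open>distr M N f\<close> may fail to be a measure, and
  then \<open>distr M N f\<close> is zero. So measurability of the drift component on \<open>M\<close> is not needed to read off
  probabilities from an equality of laws.\<close>

lemma emeasure_distr_nonmeasurable:
  assumes "emeasure (distr M N f) B \<noteq> 0" "A \<in> sets N"
  shows "emeasure (distr M N f) A = emeasure M (f -` A \<inter> space M)"
proof -
  have "measure_space (space N) (sets N) (\<lambda>A. emeasure M (f -` A \<inter> space M))"
    using assms(1) unfolding distr_def
    by (subst (asm) emeasure_measure_of_conv) (auto simp: sets.sigma_sets_eq split: if_splits)
  then show ?thesis
    unfolding distr_def using assms(2) by (subst emeasure_measure_of_conv) (simp add: sets.sigma_sets_eq)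
qed

text \<open>Continuity makes the law on \<open>M'\<close> a probability measure. The equality then
  gives the law on \<open>M\<close> nonzero mass, as \<open>emeasure_distr_nonmeasurable\<close>
  requires. The map \<open>g\<close> will be a component projection.\<close>

lemma path_law_marginal:
  assumes eq: "path_law M' T Z' = path_law M T Z" and "prob_space M'"
    and Z': "continuous_process M' T Z'" and t: "t \<in> {0..T}" and g: "g \<in> borel_measurable borel" and A: "A \<in> sets borel"
  shows "emeasure M' {\<omega>\<in>space M'. g (Z' t \<omega>) \<in> A} = emeasure M {\<omega>\<in>space M. g (Z t \<omega>) \<in> A}"
proof -
  interpret M': prob_space M' by fact
  let ?P = "PiM {0..T} (\<lambda>_. borel)"
  have meas: "(\<lambda>\<omega>. \<lambda>t\<in>{0..T}. Z' t \<omega>) \<in> measurable M' ?P"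
    using Z' by (intro measurable_restrict) (auto simp: continuous_process_def)
  have [measurable]: "(\<lambda>f. f t) \<in> measurable ?P borel"
    using t by (rule measurable_component_singleton)
  have S: "{f\<in>space ?P. g (f t) \<in> A} \<in> sets ?P"
    using g A by measurable
  have "emeasure (path_law M' T Z') (space ?P) = 1"
    unfolding path_law_def
    using prob_space.emeasure_space_1[OF M'.prob_space_distr[OF meas]] by simp
  then have "emeasure (path_law M T Z) (space ?P) \<noteq> 0" unfolding eq by simp
  then have "emeasure (path_law M T Z) {f\<in>space ?P. g (f t) \<in> A}
      = emeasure M ((\<lambda>\<omega>. \<lambda>t\<in>{0..T}. Z t \<omega>) -` {f\<in>space ?P. g (f t) \<in> A} \<inter> space M)"
    unfolding path_law_def by (rule emeasure_distr_nonmeasurable[OF _ S])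
  also have "(\<lambda>\<omega>. \<lambda>t\<in>{0..T}. Z t \<omega>) -` {f\<in>space ?P. g (f t) \<in> A} \<inter> space M = {\<omega>\<in>space M. g (Z t \<omega>) \<in> A}"
    using t by (auto simp: space_PiM)
  finally have "emeasure (path_law M T Z) {f\<in>space ?P. g (f t) \<in> A} = emeasure M {\<omega>\<in>space M. g (Z t \<omega>) \<in> A}" .
  moreover have "emeasure (path_law M' T Z') {f\<in>space ?P. g (f t) \<in> A} = emeasure M' {\<omega>\<in>space M'. g (Z' t \<omega>) \<in> A}"
    unfolding path_law_def
    by (subst emeasure_distr[OF meas S], rule arg_cong[where f = "emeasure M'"]) (use t in \<open>auto simp: space_PiM\<close>)
  ultimately show ?thesis using eq by simp
qed

lemma path_law_marginal_distr:
  assumes "path_law M' T Z' = path_law M T Z" "prob_space M'" "continuous_process M' T Z'" "t \<in> {0..T}"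
    and g: "g \<in> borel_measurable borel"
    and Z: "(\<lambda>\<omega>. g (Z t \<omega>)) \<in> borel_measurable M"
  shows "distr M' borel (\<lambda>\<omega>. g (Z' t \<omega>)) = distr M borel (\<lambda>\<omega>. g (Z t \<omega>))"
proof (rule measure_eqI)
  fix A assume "A \<in> sets (distr M' borel (\<lambda>\<omega>. g (Z' t \<omega>)))"
  then have A: "A \<in> sets borel" by simp
  have [measurable]: "Z' t \<in> borel_measurable M'"
    using assms by (auto simp: continuous_process_def)
  have Z': "(\<lambda>\<omega>. g (Z' t \<omega>)) \<in> borel_measurable M'"
    using g by measurable
  have eqs: "(\<lambda>\<omega>. g (Z' t \<omega>)) -` A \<inter> space M' = {\<omega>\<in>space M'. g (Z' t \<omega>) \<in> A}"
    "(\<lambda>\<omega>. g (Z t \<omega>)) -` A \<inter> space M = {\<omega>\<in>space M. g (Z t \<omega>) \<in> A}" by auto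
  show "emeasure (distr M' borel (\<lambda>\<omega>. g (Z' t \<omega>))) A = emeasure (distr M borel (\<lambda>\<omega>. g (Z t \<omega>))) A"
    unfolding emeasure_distr[OF Z' A] emeasure_distr[OF Z A] eqs
    by (rule path_law_marginal[OF assms(1-4) g A])
qed simp

section \<open>Almost sure limits and convergence in L2\<close>

lemma nn_integral_le_liminf_AE:
  assumes u: "\<And>i. u i \<in> borel_measurable M" and lim: "AE x in M. (\<lambda>i. u i x) \<longlonglongrightarrow> v x"
  shows "integral\<^sup>N M v \<le> liminf (\<lambda>i. integral\<^sup>N M (u i))"
proof -
  have "integral\<^sup>N M v = (\<integral>\<^sup>+x. liminf (\<lambda>i. u i x) \<partial>M)"
    using lim by (intro nn_integral_cong_AE) (auto elim!: eventually_mono simp: lim_imp_Liminf)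
  also have "\<dots> \<le> liminf (\<lambda>i. integral\<^sup>N M (u i))"
    by (rule nn_integral_liminf[OF u])
  finally show ?thesis .
qed

text \<open>By Fatou's lemma the second moment of the limit is at most the lower limit of the second
  moments, which is 0.\<close>

lemma (in prob_space) AE_zero_of_L2_null:
  assumes u: "\<And>i. u i \<in> borel_measurable M" and lim: "AE x in M. (\<lambda>i. u i x) \<longlonglongrightarrow> v x"
    and v: "v \<in> borel_measurable M"
    and L2: "(\<lambda>i. \<integral>\<^sup>+x. ennreal ((u i x :: real)\<^sup>2) \<partial>M) \<longlonglongrightarrow> 0"
  shows "AE x in M. v x = 0"
proof -
  have "(\<integral>\<^sup>+x. ennreal ((v x)\<^sup>2) \<partial>M) \<le> liminf (\<lambda>i. \<integral>\<^sup>+x. ennreal ((u i x)\<^sup>2) \<partial>M)"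
    using u lim by (intro nn_integral_le_liminf_AE) (auto elim!: eventually_mono intro!: tendsto_intros)
  also have "\<dots> = 0"
    using L2 by (intro lim_imp_Liminf) auto
  finally have "(\<integral>\<^sup>+x. ennreal ((v x)\<^sup>2) \<partial>M) = 0" by simp
  then show ?thesis
    using v by (subst (asm) nn_integral_0_iff_AE) auto
qed

text \<open>The characteristic functions all equal that of \<mu>, and by dominated convergence they
  tend to that of the limit.\<close>

lemma (in prob_space) distr_AE_limit:
  fixes Z :: "nat \<Rightarrow> 'a \<Rightarrow> real"
  assumes Z: "\<And>l. Z l \<in> borel_measurable M" "Zlim \<in> borel_measurable M"
    and law: "\<And>l. distr M borel (Z l) = \<mu>" and lim: "AE \<omega> in M. (\<lambda>l. Z l \<omega>) \<longlonglongrightarrow> Zlim \<omega>"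
  shows "distr M borel Zlim = \<mu>"
proof (rule Levy_uniqueness)
  show "real_distribution (distr M borel Zlim)"
    using Z by (intro real_distribution_distr) auto
  show "real_distribution \<mu>"
    unfolding law[of 0, symmetric] using Z by (intro real_distribution_distr) auto
  show "char (distr M borel Zlim) = char \<mu>"
  proof
    fix \<theta>
    have int: "char (distr M borel Y) \<theta> = (CLINT \<omega>|M. iexp (\<theta> * Y \<omega>))" if "Y \<in> borel_measurable M" for Y
      unfolding char_def using that by (subst integral_distr) auto
    have "(\<lambda>l. CLINT \<omega>|M. iexp (\<theta> * Z l \<omega>)) \<longlonglongrightarrow> (CLINT \<omega>|M. iexp (\<theta> * Zlim \<omega>))"
    proof (rule integral_dominated_convergence[where w = "\<lambda>_. 1"])
      show "AE \<omega> in M. (\<lambda>l. iexp (\<theta> * Z l \<omega>)) \<longlonglongrightarrow> iexp (\<theta> * Zlim \<omega>)"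
        using lim by (auto elim!: eventually_mono intro!: tendsto_intros)
    qed (use Z in auto)
    then have "(\<lambda>l. char \<mu> \<theta>) \<longlonglongrightarrow> char (distr M borel Zlim) \<theta>"
      unfolding int[OF Z(1), symmetric] int[OF Z(2), symmetric] law .
    then show "char (distr M borel Zlim) \<theta> = char \<mu> \<theta>"
      by (simp add: LIMSEQ_const_iff)
  qed
qed

text \<open>By the parallelogram identity \<open>E (Z\<^sub>l - Z)\<^sup>2 = 2 E Z\<^sub>l\<^sup>2 + 2 E Z\<^sup>2 - E (Z\<^sub>l + Z)\<^sup>2\<close>, where
  the first two terms are constant and Fatou's lemma applies to the last one.\<close>

lemma (in prob_space) L2_convergence_same_law:
  fixes Z :: "nat \<Rightarrow> 'a \<Rightarrow> real"
  assumes Z: "\<And>l. Z l \<in> borel_measurable M" "Zlim \<in> borel_measurable M"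
    and law: "\<And>l. distr M borel (Z l) = \<mu>" and lim: "AE \<omega> in M. (\<lambda>l. Z l \<omega>) \<longlonglongrightarrow> Zlim \<omega>"
    and fin: "(\<integral>\<^sup>+x. ennreal (x\<^sup>2) \<partial>\<mu>) < \<infinity>"
  shows "(\<lambda>l. \<integral>\<^sup>+\<omega>. ennreal ((Z l \<omega> - Zlim \<omega>)\<^sup>2) \<partial>M) \<longlonglongrightarrow> 0"
    and "(\<integral>\<^sup>+\<omega>. ennreal ((Z l \<omega> - Zlim \<omega>)\<^sup>2) \<partial>M) < \<infinity>"
proof -
  note [measurable] = Z
  obtain v where v: "(\<integral>\<^sup>+x. ennreal (x\<^sup>2) \<partial>\<mu>) = ennreal v" "0 \<le> v"
    using fin by (cases "\<integral>\<^sup>+x. ennreal (x\<^sup>2) \<partial>\<mu>") auto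
  have second: "(\<integral>\<^sup>+\<omega>. ennreal ((Y \<omega>)\<^sup>2) \<partial>M) = ennreal v" if "distr M borel Y = \<mu>" "Y \<in> borel_measurable M" for Y
    unfolding v(1)[symmetric] that(1)[symmetric] using that(2) by (subst nn_integral_distr) auto
  note Zl2 = second[OF law Z(1)]
  note Zlim2 = second[OF distr_AE_limit[OF Z law lim] Z(2)]
  define \<alpha> where "\<alpha> l = (\<integral>\<^sup>+\<omega>. ennreal ((Z l \<omega> - Zlim \<omega>)\<^sup>2) \<partial>M)" for l
  define \<beta> where "\<beta> l = (\<integral>\<^sup>+\<omega>. ennreal ((Z l \<omega> + Zlim \<omega>)\<^sup>2) \<partial>M)" for l
  have sum: "\<alpha> l + \<beta> l = ennreal (4 * v)" for l
  proof -
    have "\<alpha> l + \<beta> l = (\<integral>\<^sup>+\<omega>. ennreal 2 * ennreal ((Z l \<omega>)\<^sup>2) + ennreal 2 * ennreal ((Zlim \<omega>)\<^sup>2) \<partial>M)"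
      unfolding \<alpha>_def \<beta>_def
    proof (subst nn_integral_add[symmetric])
      have "ennreal ((x - y)\<^sup>2) + ennreal ((x + y)\<^sup>2) = ennreal 2 * ennreal (x\<^sup>2) + ennreal 2 * ennreal (y\<^sup>2)"
        for x y :: real
      proof -
        have "ennreal ((x - y)\<^sup>2) + ennreal ((x + y)\<^sup>2) = ennreal ((x - y)\<^sup>2 + (x + y)\<^sup>2)"
          by (simp only: ennreal_plus zero_le_power2)
        also have "(x - y)\<^sup>2 + (x + y)\<^sup>2 = 2 * x\<^sup>2 + 2 * y\<^sup>2"
          by (simp add: power2_eq_square algebra_simps)
        finally show ?thesis
          by (simp add: ennreal_plus ennreal_mult del: ennreal_numeral)
      qed
      then show "(\<integral>\<^sup>+\<omega>. ennreal ((Z l \<omega> - Zlim \<omega>)\<^sup>2) + ennreal ((Z l \<omega> + Zlim \<omega>)\<^sup>2) \<partial>M)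
          = (\<integral>\<^sup>+\<omega>. ennreal 2 * ennreal ((Z l \<omega>)\<^sup>2) + ennreal 2 * ennreal ((Zlim \<omega>)\<^sup>2) \<partial>M)"
        by (intro nn_integral_cong)
    qed auto
    also have "\<dots> = ennreal 2 * ennreal v + ennreal 2 * ennreal v"
      by (subst nn_integral_add) (auto simp: nn_integral_cmult Zl2 Zlim2)
    also have "\<dots> = ennreal (4 * v)"
      using v(2) by (simp flip: ennreal_mult ennreal_plus del: ennreal_numeral)
    finally show ?thesis .
  qed
  have fin_\<alpha>: "\<alpha> l < \<infinity>" for l
    using sum[of l] by (metis ennreal_add_eq_top ennreal_neq_top infinity_ennreal_def less_top)
  then show "(\<integral>\<^sup>+\<omega>. ennreal ((Z l \<omega> - Zlim \<omega>)\<^sup>2) \<partial>M) < \<infinity>"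
    unfolding \<alpha>_def .
  have fin_\<beta>: "\<beta> l < \<infinity>" for l
    using sum[of l] by (metis ennreal_add_eq_top ennreal_neq_top infinity_ennreal_def less_top)
  have "ennreal (4 * v) = (\<integral>\<^sup>+\<omega>. ennreal ((Zlim \<omega> + Zlim \<omega>)\<^sup>2) \<partial>M)"
  proof -
    have "(\<integral>\<^sup>+\<omega>. ennreal ((Zlim \<omega> + Zlim \<omega>)\<^sup>2) \<partial>M) = (\<integral>\<^sup>+\<omega>. ennreal 4 * ennreal ((Zlim \<omega>)\<^sup>2) \<partial>M)"
      by (intro nn_integral_cong) (simp add: power2_eq_square algebra_simps flip: ennreal_mult del: ennreal_numeral)
    also have "\<dots> = ennreal 4 * ennreal v"
      using Zlim2 by (subst nn_integral_cmult) auto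
    also have "\<dots> = ennreal (4 * v)"
      using v(2) by (simp add: ennreal_mult del: ennreal_numeral)
    finally show ?thesis ..
  qed
  also have "\<dots> \<le> liminf \<beta>"
    unfolding \<beta>_def[abs_def]
  proof (rule nn_integral_le_liminf_AE)
    show "AE \<omega> in M. (\<lambda>l. ennreal ((Z l \<omega> + Zlim \<omega>)\<^sup>2)) \<longlonglongrightarrow> ennreal ((Zlim \<omega> + Zlim \<omega>)\<^sup>2)"
      using lim by eventually_elim (intro tendsto_ennrealI tendsto_power tendsto_add tendsto_const)
  qed simp
  finally have liminf: "ennreal (4 * v) \<le> liminf \<beta>" .
  have "(\<lambda>l. enn2real (\<alpha> l)) \<longlonglongrightarrow> 0"
  proof (rule tendstoI)
    fix e :: real assume "0 < e"
    \<comment> \<open>\<open>ennreal\<close> sends negative numbers to 0, so the strict inequality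
      may fail if 4 v < e; in that case \<alpha> l \<le> 4 v is already below e.\<close>
    have "eventually (\<lambda>l. ennreal (4 * v - e) < \<beta> l \<or> 4 * v < e) sequentially"
    proof (cases "4 * v < e")
      case False
      then have "ennreal (4 * v - e) < ennreal (4 * v)"
        using \<open>0 < e\<close> by (intro ennreal_lessI) auto
      then show ?thesis
        using liminf unfolding le_Liminf_iff by (auto elim: eventually_mono)
    qed simp
    then show "eventually (\<lambda>l. dist (enn2real (\<alpha> l)) 0 < e) sequentially"
    proof eventually_elim
      case (elim l)
      obtain x y where xy: "\<alpha> l = ennreal x" "\<beta> l = ennreal y" "0 \<le> x" "0 \<le> y"
        using fin_\<alpha>[of l] fin_\<beta>[of l] by (cases "\<alpha> l"; cases "\<beta> l") auto
      then have "x + y = 4 * v"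
        using sum[of l] v(2) by (simp flip: ennreal_plus)
      moreover have "4 * v - e < y \<or> 4 * v < e"
        using elim xy by (cases "4 * v < e") (auto simp: ennreal_less_iff)
      ultimately show ?case
        using xy \<open>0 < e\<close> by auto
    qed
  qed
  then have "(\<lambda>l. ennreal (enn2real (\<alpha> l))) \<longlonglongrightarrow> ennreal 0"
    by (rule tendsto_ennrealI)
  then show "(\<lambda>l. \<integral>\<^sup>+\<omega>. ennreal ((Z l \<omega> - Zlim \<omega>)\<^sup>2) \<partial>M) \<longlonglongrightarrow> 0"
    using fin_\<alpha> unfolding \<alpha>_def[symmetric] by (simp add: ennreal_enn2real)
qed

text \<open>Continuity from above. With a product instead of the quotient |Z| / n the events
  decrease from n = 0 on; with the quotient the event for n = 0 would be empty, because
  \<open>x / 0 = 0\<close>.\<close>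

lemma (in prob_space) tendsto_prob_abs_ge_of_nat:
  fixes Z :: "'a \<Rightarrow> real"
  assumes Z [measurable]: "Z \<in> borel_measurable M" and "0 < \<delta>"
  shows "(\<lambda>n. prob {\<omega>\<in>space M. real n * \<delta> \<le> \<bar>Z \<omega>\<bar>}) \<longlonglongrightarrow> 0"
proof -
  let ?A = "\<lambda>n. {\<omega>\<in>space M. real n * \<delta> \<le> \<bar>Z \<omega>\<bar>}"
  have "(\<lambda>n. prob (?A n)) \<longlonglongrightarrow> prob (\<Inter>n. ?A n)"
  proof (rule finite_Lim_measure_decseq)
    show "decseq ?A"
    proof (intro decseq_SucI subsetI CollectI conjI)
      fix n \<omega> assume "\<omega> \<in> ?A (Suc n)"
      then show "\<omega> \<in> space M" "real n * \<delta> \<le> \<bar>Z \<omega>\<bar>"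
        using \<open>0 < \<delta>\<close> by (auto simp: algebra_simps)
    qed
  qed auto
  moreover have "(\<Inter>n. ?A n) = {}"
  proof -
    have "\<exists>n. \<omega> \<notin> ?A n" for \<omega>
    proof -
      obtain n where "\<bar>Z \<omega>\<bar> / \<delta> < real n" using reals_Archimedean2 by blast
      then show ?thesis using \<open>0 < \<delta>\<close> by (intro exI[of _ n]) (auto simp: field_simps)
    qed
    then show ?thesis by blast
  qed
  ultimately show ?thesis by simp
qed

lemma (in prob_space) tendsto_prob_of_AE:
  fixes Z :: "nat \<Rightarrow> 'a \<Rightarrow> real"
  assumes Z [measurable]: "\<And>l. Z l \<in> borel_measurable M" and "0 < \<delta>"
    and lim: "AE \<omega> in M. (\<lambda>l. Z l \<omega>) \<longlonglongrightarrow> 0"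
  shows "(\<lambda>l. prob {\<omega>\<in>space M. \<delta> \<le> \<bar>Z l \<omega>\<bar>}) \<longlonglongrightarrow> 0"
proof -
  let ?A = "\<lambda>l. {\<omega>\<in>space M. \<delta> \<le> \<bar>Z l \<omega>\<bar>}"
  have "(\<lambda>l. \<integral>\<omega>. indicator (?A l) \<omega> \<partial>M) \<longlonglongrightarrow> (\<integral>\<omega>. 0 \<partial>M :: real)"
  proof (rule integral_dominated_convergence[where w = "\<lambda>_. 1"])
    show "AE \<omega> in M. (\<lambda>l. indicator (?A l) \<omega> :: real) \<longlonglongrightarrow> 0"
      using lim
    proof eventually_elim
      case (elim \<omega>)
      then have "eventually (\<lambda>l. \<bar>Z l \<omega>\<bar> < \<delta>) sequentially"
        using \<open>0 < \<delta>\<close> by (auto dest!: tendstoD simp: dist_real_def)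
      then have "eventually (\<lambda>l. indicator (?A l) \<omega> = (0::real)) sequentially"
        by eventually_elim auto
      then show ?case by (rule tendsto_eventually)
    qed
  qed auto
  then show ?thesis by simp
qed

section \<open>Drift integrals\<close>

text \<open>Freezes the time at the ends of \<open>{0..T}\<close>, so that joint measurability can
  be stated on the whole line although a process is arbitrary outside that interval.\<close>

definition clip :: "real \<Rightarrow> real \<Rightarrow> real" where
  "clip T s = max 0 (min T s)"

lemma clip_mem: "0 \<le> T \<Longrightarrow> clip T s \<in> {0..T}"
  by (auto simp: clip_def)

lemma clip_id: "s \<in> {0..T} \<Longrightarrow> clip T s = s"
  by (auto simp: clip_def)

text \<open>Rounding the time down to a multiple of 1 / n leaves countably many times and hence a
  jointly measurable map; by path continuity these maps converge to the process.\<close>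

lemma continuous_process_joint_measurable:
  fixes X :: "real \<Rightarrow> 'a \<Rightarrow> real"
  assumes X: "continuous_process M T X" and "0 \<le> T"
  shows "(\<lambda>(s, \<omega>). X (clip T s) \<omega>) \<in> borel_measurable (borel \<Otimes>\<^sub>M M)"
proof (rule borel_measurable_LIMSEQ_metric[where
      f = "\<lambda>n p. X (clip T (real_of_int \<lfloor>real n * fst p\<rfloor> / real n)) (snd p)"])
  let ?r = "\<lambda>n s. real_of_int \<lfloor>real n * s\<rfloor> / real n"
  fix n :: nat
  have "(\<lambda>p. (\<lambda>i p. X (clip T (real_of_int i / real n)) (snd p)) \<lfloor>real n * fst p\<rfloor> p)
      \<in> borel_measurable (borel \<Otimes>\<^sub>M M)"
  proof (rule measurable_compose_countable[where g = "\<lambda>p. \<lfloor>real n * fst p\<rfloor>"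
        and f = "\<lambda>i p. X (clip T (real_of_int i / real n)) (snd p)"])
    fix i :: int
    have [measurable]: "X (clip T (real_of_int i / real n)) \<in> borel_measurable M"
      using X clip_mem[OF \<open>0 \<le> T\<close>] by (auto simp: continuous_process_def)
    show "(\<lambda>p. X (clip T (real_of_int i / real n)) (snd p)) \<in> borel_measurable (borel \<Otimes>\<^sub>M M)"
      by measurable
  qed measurable
  then show "(\<lambda>p. X (clip T (?r n (fst p))) (snd p)) \<in> borel_measurable (borel \<Otimes>\<^sub>M M)"
    by simp
next
  let ?r = "\<lambda>n s. real_of_int \<lfloor>real n * s\<rfloor> / real n"
  fix p :: "real \<times> 'a" assume "p \<in> space (borel \<Otimes>\<^sub>M M)"
  then have \<omega>: "snd p \<in> space M" by (auto simp: space_pair_measure)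
  have "(\<lambda>n. ?r n (fst p)) \<longlonglongrightarrow> fst p"
  proof (rule LIMSEQ_I)
    fix e :: real assume "0 < e"
    then obtain n0 where n0: "1 / e < real n0" using reals_Archimedean2 by blast
    have "norm (?r n (fst p) - fst p) < e" if "n0 \<le> n" for n
    proof -
      have n: "1 / e < real n" using n0 that by (meson less_le_trans of_nat_le_iff)
      then have "0 < real n" using \<open>0 < e\<close> by (meson less_trans zero_less_divide_1_iff)
      have "\<bar>real_of_int \<lfloor>real n * fst p\<rfloor> - real n * fst p\<bar> \<le> 1"
        by linarith
      then have "\<bar>real_of_int \<lfloor>real n * fst p\<rfloor> - real n * fst p\<bar> / real n \<le> 1 / real n"
        using \<open>0 < real n\<close> by (intro divide_right_mono) auto
      also have "\<bar>real_of_int \<lfloor>real n * fst p\<rfloor> - real n * fst p\<bar> / real n = \<bar>?r n (fst p) - fst p\<bar>"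
        using \<open>0 < real n\<close> by (subst abs_div_pos) (auto simp: diff_divide_distrib)
      finally have "\<bar>?r n (fst p) - fst p\<bar> \<le> 1 / real n" .
      also have "\<dots> < e" using n \<open>0 < e\<close> \<open>0 < real n\<close> by (simp add: field_simps)
      finally show ?thesis by simp
    qed
    then show "\<exists>no. \<forall>n\<ge>no. norm (?r n (fst p) - fst p) < e" by blast
  qed
  then have "(\<lambda>n. clip T (?r n (fst p))) \<longlonglongrightarrow> clip T (fst p)"
    unfolding clip_def by (intro tendsto_intros)
  moreover have "continuous_on {0..T} (\<lambda>s. X s (snd p))"
    using X \<omega> by (auto simp: continuous_process_def)
  ultimately have "(\<lambda>n. X (clip T (?r n (fst p))) (snd p)) \<longlonglongrightarrow> X (clip T (fst p)) (snd p)"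
    using clip_mem[OF \<open>0 \<le> T\<close>] by (intro continuous_on_tendsto_compose[of "{0..T}" "\<lambda>s. X s (snd p)"]) auto
  then show "(\<lambda>n. X (clip T (?r n (fst p))) (snd p)) \<longlonglongrightarrow> (case p of (s, \<omega>) \<Rightarrow> X (clip T s) \<omega>)"
    by (simp add: case_prod_unfold)
qed

text \<open>Extends the drift by 0 off the strip and passes from the Borel sets of the plane to the
  product sigma-algebra, the form that compositions need.\<close>

lemma drift_measurable_extension:
  fixes b :: "real \<Rightarrow> real \<Rightarrow> real"
  assumes "(\<lambda>(t, x). b t x) \<in> borel_measurable (restrict_space borel ({0..T} \<times> UNIV))"
  shows "(\<lambda>(t, x). indicator {0..T} t *\<^sub>R b t x) \<in> borel_measurable (borel \<Otimes>\<^sub>M borel)"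
proof -
  have "{0..T} \<times> (UNIV :: real set) \<in> sets borel"
    by (intro borel_closed closed_Times) auto
  then have "(\<lambda>p. indicator ({0..T} \<times> UNIV) p *\<^sub>R (case p of (t, x) \<Rightarrow> b t x)) \<in> borel_measurable borel"
    using assms by (subst (asm) borel_measurable_restrict_space_iff) auto
  then show ?thesis
    unfolding borel_prod by (simp add: case_prod_unfold indicator_def mem_Times_iff)
qed

lemma drift_integral_measurable:
  fixes b :: "real \<Rightarrow> real \<Rightarrow> real"
  assumes b: "(\<lambda>(t, x). b t x) \<in> borel_measurable (restrict_space borel ({0..T} \<times> UNIV))"
    and X: "continuous_process M T X" and "0 \<le> T" "t \<le> T"
  shows "drift_integral b X t \<in> borel_measurable M"
proof -
  note [measurable] = drift_measurable_extension[OF b] continuous_process_joint_measurable[OF X \<open>0 \<le> T\<close>]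
  have "(\<lambda>\<omega>. \<integral>s. indicator {0..t} s *\<^sub>R (indicator {0..T} s *\<^sub>R b s (X (clip T s) \<omega>)) \<partial>lborel) \<in> borel_measurable M"
  proof (rule lborel.borel_measurable_lebesgue_integral)
    have "(\<lambda>p. (\<lambda>(t, x). indicator {0..T} t *\<^sub>R b t x) (snd p, (\<lambda>(s, \<omega>). X (clip T s) \<omega>) (snd p, fst p)))
        \<in> borel_measurable (M \<Otimes>\<^sub>M borel)"
      by measurable
    then have [measurable]: "(\<lambda>p. indicator {0..T} (snd p) *\<^sub>R b (snd p) (X (clip T (snd p)) (fst p)))
        \<in> borel_measurable (M \<Otimes>\<^sub>M lborel)"
      by (simp cong: measurable_cong_sets)
    show "(\<lambda>(\<omega>, s). indicator {0..t} s *\<^sub>R (indicator {0..T} s *\<^sub>R b s (X (clip T s) \<omega>))) \<in> borel_measurable (M \<Otimes>\<^sub>M lborel)"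
      unfolding case_prod_unfold by measurable
  qed
  moreover have "(\<lambda>\<omega>. \<integral>s. indicator {0..t} s *\<^sub>R (indicator {0..T} s *\<^sub>R b s (X (clip T s) \<omega>)) \<partial>lborel)
      = drift_integral b X t"
    unfolding drift_integral_def[abs_def] set_lebesgue_integral_def
    by (intro ext Bochner_Integration.integral_cong refl)
      (use \<open>t \<le> T\<close> in \<open>auto simp: clip_id split: split_indicator\<close>)
  ultimately show ?thesis by simp
qed

lemma drift_set_integrable:
  fixes b :: "real \<Rightarrow> real \<Rightarrow> real"
  assumes b: "(\<lambda>(t, x). b t x) \<in> borel_measurable (restrict_space borel ({0..T} \<times> UNIV))"
    and bound: "\<forall>t\<in>{0..T}. \<forall>x. \<bar>b t x\<bar> \<le> c"
    and x: "continuous_on {0..T} x" and A: "A \<in> sets borel" "A \<subseteq> {0..T}"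
  shows "set_integrable lborel A (\<lambda>s. b s (x s))"
proof -
  have [measurable]: "(\<lambda>(t, x). indicator {0..T} t *\<^sub>R b t x) \<in> borel_measurable (borel \<Otimes>\<^sub>M borel)"
    by (rule drift_measurable_extension[OF b])
  \<comment> \<open>Off \<open>{0..T}\<close> the path is arbitrary, so it is set to 0 there before
    it enters the drift.\<close>
  have "(\<lambda>s. indicator {0..T} s *\<^sub>R x s) \<in> borel_measurable borel"
    using borel_measurable_continuous_on_indicator[OF _ x] by simp
  then have "(\<lambda>s. (\<lambda>(t, x). indicator {0..T} t *\<^sub>R b t x) (s, indicator {0..T} s *\<^sub>R x s)) \<in> borel_measurable borel"
    by measurable
  then have [measurable]: "(\<lambda>s. indicator {0..T} s *\<^sub>R b s (indicator {0..T} s *\<^sub>R x s)) \<in> borel_measurable borel"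
    by simp
  have "integrable lborel (\<lambda>s. indicator A s *\<^sub>R (indicator {0..T} s *\<^sub>R b s (indicator {0..T} s *\<^sub>R x s)))"
  proof (rule Bochner_Integration.integrable_bound)
    show "integrable lborel (\<lambda>s. c * indicator {0..T} s :: real)"
      by (intro integrable_mult_right integrable_real_indicator) (auto simp: emeasure_lborel_Icc_eq)
    show "(\<lambda>s. indicator A s *\<^sub>R (indicator {0..T} s *\<^sub>R b s (indicator {0..T} s *\<^sub>R x s))) \<in> borel_measurable lborel"
      using A(1) by measurable
    show "AE s in lborel. norm (indicator A s *\<^sub>R (indicator {0..T} s *\<^sub>R b s (indicator {0..T} s *\<^sub>R x s)))
        \<le> norm (c * indicator {0..T} s :: real)"
      using bound by (intro AE_I2) (auto split: split_indicator intro!: order_trans[OF _ abs_ge_self])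
  qed
  then show ?thesis
    unfolding set_integrable_def
    by (rule Bochner_Integration.integrable_cong[THEN iffD1, OF refl, rotated])
      (use A(2) in \<open>auto split: split_indicator\<close>)
qed

lemma drift_integral_diff_le:
  fixes b :: "real \<Rightarrow> real \<Rightarrow> real"
  assumes b: "(\<lambda>(t, x). b t x) \<in> borel_measurable (restrict_space borel ({0..T} \<times> UNIV))"
    and bound: "\<forall>t\<in>{0..T}. \<forall>x. \<bar>b t x\<bar> \<le> c"
    and x: "continuous_on {0..T} (\<lambda>s. X s \<omega>)" and st: "0 \<le> s" "s \<le> t" "t \<le> T"
  shows "\<bar>drift_integral b X t \<omega> - drift_integral b X s \<omega>\<bar> \<le> c * (t - s)"
proof -
  let ?f = "\<lambda>s. b s (X s \<omega>)"
  have int: "set_integrable lborel A ?f" if "A \<in> sets borel" "A \<subseteq> {0..T}" for A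
    by (rule drift_set_integrable[OF b bound x that])
  have sub: "{s<..t} \<subseteq> {0..T}" using st by auto
  have "(LBINT s:{0..s} \<union> {s<..t}. ?f s) = (LBINT s:{0..s}. ?f s) + (LBINT s:{s<..t}. ?f s)"
    using st by (intro set_integral_Un int) auto
  also have "{0..s} \<union> {s<..t} = {0..t}" using st by auto
  finally have "\<bar>drift_integral b X t \<omega> - drift_integral b X s \<omega>\<bar> = norm (LBINT s:{s<..t}. ?f s)"
    unfolding drift_integral_def by simp
  also have "\<dots> \<le> (\<integral>r. norm (indicator {s<..t} r *\<^sub>R ?f r) \<partial>lborel)"
    unfolding set_lebesgue_integral_def by (rule integral_norm_bound)
  also have "\<dots> \<le> (\<integral>r. c * indicator {s<..t} r \<partial>lborel)"
  proof (rule integral_mono)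
    show "integrable lborel (\<lambda>r. norm (indicator {s<..t} r *\<^sub>R ?f r))"
      using int[OF _ sub] unfolding set_integrable_def by (intro integrable_norm) simp
    show "integrable lborel (\<lambda>r. c * indicator {s<..t} r :: real)"
      using st by (intro integrable_mult_right integrable_real_indicator) (auto simp: emeasure_lborel_Icc_eq)
    show "norm (indicator {s<..t} r *\<^sub>R ?f r) \<le> c * indicator {s<..t} r" for r
      using bound st by (auto split: split_indicator)
  qed
  also have "\<dots> = c * (t - s)" using st by simp
  finally show ?thesis .
qed

lemma drift_integral_tendsto:
  fixes b :: "real \<Rightarrow> real \<Rightarrow> real"
  assumes b: "(\<lambda>(t, x). b t x) \<in> borel_measurable (restrict_space borel ({0..T} \<times> UNIV))"
    and bound: "\<forall>t\<in>{0..T}. \<forall>x. \<bar>b t x\<bar> \<le> c"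
    and x: "\<And>l. continuous_on {0..T} (\<lambda>s. X l s \<omega>)" "continuous_on {0..T} (\<lambda>s. Xlim s \<omega>)"
    and lim: "\<And>s. s \<in> {0..T} \<Longrightarrow> (\<lambda>l. X l s \<omega>) \<longlonglongrightarrow> Xlim s \<omega>"
    and cont: "AE s in lborel. s \<in> {0..T} \<longrightarrow> isCont (b s) (Xlim s \<omega>)"
    and "t \<le> T"
  shows "(\<lambda>l. drift_integral b (X l) t \<omega>) \<longlonglongrightarrow> drift_integral b Xlim t \<omega>"
  unfolding drift_integral_def set_lebesgue_integral_def
proof (rule integral_dominated_convergence[where w = "\<lambda>s. \<bar>c\<bar> * indicator {0..T} s"])
  have sub: "{0..t} \<subseteq> {0..T}" using \<open>t \<le> T\<close> by auto
  have "integrable lborel (\<lambda>s. indicator {0..t} s *\<^sub>R b s (y s))" if "continuous_on {0..T} y" for y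
    using drift_set_integrable[OF b bound that _ sub] unfolding set_integrable_def by simp
  then show "(\<lambda>s. indicator {0..t} s *\<^sub>R b s (Xlim s \<omega>)) \<in> borel_measurable lborel"
    and "(\<lambda>s. indicator {0..t} s *\<^sub>R b s (X l s \<omega>)) \<in> borel_measurable lborel" for l
    using x by blast+
  show "integrable lborel (\<lambda>s. \<bar>c\<bar> * indicator {0..T} s :: real)"
    by (intro integrable_mult_right integrable_real_indicator) (auto simp: emeasure_lborel_Icc_eq)
  show "AE s in lborel. (\<lambda>l. indicator {0..t} s *\<^sub>R b s (X l s \<omega>)) \<longlonglongrightarrow> indicator {0..t} s *\<^sub>R b s (Xlim s \<omega>)"
    using cont
  proof eventually_elim
    case (elim s)
    show ?case
    proof (cases "s \<in> {0..t}")
      case True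
      with sub have s: "s \<in> {0..T}" by blast
      with elim have "isCont (b s) (Xlim s \<omega>)" by blast
      then have "(\<lambda>l. b s (X l s \<omega>)) \<longlonglongrightarrow> b s (Xlim s \<omega>)"
        by (rule isCont_tendsto_compose[OF _ lim[OF s]])
      then show ?thesis using True by simp
    qed simp
  qed
  show "AE s in lborel. norm (indicator {0..t} s *\<^sub>R b s (X l s \<omega>)) \<le> \<bar>c\<bar> * indicator {0..T} s" for l
    using bound sub by (intro AE_I2) (auto split: split_indicator intro!: order_trans[OF _ abs_ge_self])
qed

text \<open>A point that is no breakpoint lies in one of the open pieces: the leftmost one, or the
  one that follows the last breakpoint below it.\<close>

lemma piecewise_Lipschitz_isCont:
  assumes a: "1 \<le> m" "strict_mono_on {1..m} a"
    and Lip: "\<And>j x y. j \<le> m \<Longrightarrow> x \<in> piece a m j \<Longrightarrow> y \<in> piece a m j \<Longrightarrow> \<bar>f x - f y\<bar> \<le> L * \<bar>x - y\<bar>"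
    and "0 < L" and x: "x \<notin> a ` {1..m}"
  shows "isCont f x"
proof -
  obtain j where j: "j \<le> m" "x \<in> piece a m j"
  proof (cases "x < a 1")
    case True
    then show ?thesis by (intro that[of 0]) (auto simp: piece_def)
  next
    case False
    define J where "J = {j\<in>{1..m}. a j < x}"
    have "1 \<in> J" using False x a by (force simp: J_def)
    moreover have "finite J" by (auto simp: J_def)
    ultimately have J: "Max J \<in> J" "\<And>i. i \<in> J \<Longrightarrow> i \<le> Max J"
      by (auto intro: Max_in)
    show ?thesis
    proof (rule that[of "Max J"])
      show "Max J \<le> m" using J by (auto simp: J_def)
      have "x < a (Suc (Max J))" if "Max J \<noteq> m"
      proof (rule ccontr)
        assume "\<not> x < a (Suc (Max J))"
        moreover have "Suc (Max J) \<in> {1..m}" using that J by (auto simp: J_def)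
        ultimately have "Suc (Max J) \<in> J" using x by (force simp: J_def)
        then show False using J(2) by force
      qed
      then show "x \<in> piece a m (Max J)"
        using J(1) by (auto simp: piece_def J_def)
    qed
  qed
  have "open (piece a m j)" by (auto simp: piece_def)
  have "L-lipschitz_on (piece a m j) f"
    using Lip[OF j(1)] \<open>0 < L\<close> by (intro lipschitz_onI) (auto simp: dist_real_def)
  then have "continuous_on (piece a m j) f"
    by (rule lipschitz_on_continuous_on)
  then show ?thesis
    using \<open>open (piece a m j)\<close> j(2) by (simp add: continuous_on_eq_continuous_at)
qed

section \<open>Small ball probabilities of the solutions\<close>

text \<open>Only the left half of (s, t) is used. There t - x is at least d = (t - s) / 2, which
  bounds the kernel below by a multiple of d powr (H - 1/2); the length d of the half interval
  raises the squared bound to order d powr (2 H).\<close>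

lemma nn_integral_volterra_kernel_ge:
  assumes H: "1/2 < H" "H < 1" and st: "0 \<le> s" "s < t"
  shows "ennreal ((volterra_const H * ((t - s) / 2) powr H)\<^sup>2)
    \<le> (\<integral>\<^sup>+x\<in>{s<..<t}. ennreal ((volterra_kernel H t x)\<^sup>2) \<partial>lborel)"
proof -
  define d where "d = (t - s) / 2"
  have d: "0 < d" "s + d < t" "t - (s + d) = d" using st by (auto simp: d_def field_simps)
  define K where "K = volterra_const H * d powr (H - 1/2)"
  have "0 < volterra_const H" using H by (rule volterra_const_pos)
  then have "0 \<le> K" by (simp add: K_def)
  have "(volterra_const H * d powr H)\<^sup>2 = K\<^sup>2 * d"
  proof -
    have "d powr H = d powr (H - 1/2) * d powr (1/2)"
      by (simp flip: powr_add)
    moreover have "(d powr (1/2))\<^sup>2 = d" using d by (simp add: powr_half_sqrt)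
    ultimately show ?thesis by (simp add: K_def power_mult_distrib)
  qed
  then have "ennreal ((volterra_const H * d powr H)\<^sup>2) = ennreal (K\<^sup>2) * emeasure lborel {s<..<s + d}"
    using d by (simp add: ennreal_mult)
  also have "\<dots> = (\<integral>\<^sup>+x. ennreal (K\<^sup>2) * indicator {s<..<s + d} x \<partial>lborel)"
    by (simp add: nn_integral_cmult)
  also have "\<dots> \<le> (\<integral>\<^sup>+x\<in>{s<..<t}. ennreal ((volterra_kernel H t x)\<^sup>2) \<partial>lborel)"
  proof (intro nn_integral_mono)
    fix x
    show "ennreal (K\<^sup>2) * indicator {s<..<s + d} x \<le> ennreal ((volterra_kernel H t x)\<^sup>2) * indicator {s<..<t} x"
    proof (cases "x \<in> {s<..<s + d}")
      case True
      then have x: "0 < x" "x \<le> t" "d \<le> t - x" "x \<in> {s<..<t}" using st d by auto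
      have "K \<le> volterra_const H * (t - x) powr (H - 1/2)"
        unfolding K_def using x d H \<open>0 < volterra_const H\<close> by (intro mult_left_mono powr_mono2) auto
      also have "\<dots> \<le> volterra_kernel H t x"
        using x H by (intro volterra_kernel_ge) auto
      finally have "K\<^sup>2 \<le> (volterra_kernel H t x)\<^sup>2"
        using \<open>0 \<le> K\<close> by (intro power_mono)
      then show ?thesis using x True by (simp add: ennreal_leI)
    qed simp
  qed
  finally show ?thesis unfolding d_def .
qed

text \<open>Let \<delta> = t - s. If X t is within \<delta> of y and the increment of
  \<open>B\<^sub>1\<close> divided by n is below \<delta>, then X s - y plus the increment of
  \<open>B\<^sub>2\<close> is at most \<delta> + \<delta> + c \<delta> in absolute value, the last
  term coming from the drift; hence the factor 2 + c. Here X s - y plays the role of the past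
  variable in \<open>small_ball_estimate\<close>.\<close>

lemma (in prob_space) solution_small_ball:
  fixes b :: "real \<Rightarrow> real \<Rightarrow> real"
  assumes fBm: "completely_correlated_fBm M T W H\<^sub>1 H\<^sub>2 B\<^sub>1 B\<^sub>2" and H2: "1/2 < H\<^sub>2" "H\<^sub>2 < 1"
    and b: "(\<lambda>(t, x). b t x) \<in> borel_measurable (restrict_space borel ({0..T} \<times> UNIV))"
    and c: "0 < c" "\<forall>t\<in>{0..T}. \<forall>x. \<bar>b t x\<bar> \<le> c"
    and sol: "strong_solution M T W x\<^sub>0 b (\<lambda>t \<omega>. 1 / real n * B\<^sub>1 t \<omega> + B\<^sub>2 t \<omega>) X" and n: "1 \<le> n"
    and st: "0 \<le> s" "s < t" "t \<le> T"
  shows "prob {\<omega>\<in>space M. \<bar>X t \<omega> - y\<bar> < t - s}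
    \<le> prob {\<omega>\<in>space M. real n * (t - s) \<le> \<bar>B\<^sub>1 t \<omega> - B\<^sub>1 s \<omega>\<bar>}
      + 4 * ((2 + c) * (t - s)) / (volterra_const H\<^sub>2 * ((t - s) / 2) powr H\<^sub>2)"
proof -
  have W: "brownian_motion M T W" and fbm: "continuous_process M T B\<^sub>1" "continuous_process M T B\<^sub>2"
    and rep: "represented_by M T W H\<^sub>2 B\<^sub>2"
    using fBm unfolding completely_correlated_fBm_def fractional_brownian_motion_def by auto
  have X: "continuous_process M T X" "\<And>t. t \<in> {0..T} \<Longrightarrow> X t \<in> borel_measurable (augmented_filtration M W t)"
    and eq: "AE \<omega> in M. \<forall>t\<in>{0..T}. X t \<omega> = x\<^sub>0 + drift_integral b X t \<omega> + (1 / real n * B\<^sub>1 t \<omega> + B\<^sub>2 t \<omega>)"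
    using sol unfolding strong_solution_def satisfies_equation_def by auto
  have mem: "s \<in> {0..T}" "t \<in> {0..T}" using st by auto
  have [measurable]: "X s \<in> borel_measurable M" "X t \<in> borel_measurable M"
    "B\<^sub>1 s \<in> borel_measurable M" "B\<^sub>1 t \<in> borel_measurable M"
    "B\<^sub>2 s \<in> borel_measurable M" "B\<^sub>2 t \<in> borel_measurable M"
    using X(1) fbm mem unfolding continuous_process_def by blast+
  let ?V = "(volterra_const H\<^sub>2 * ((t - s) / 2) powr H\<^sub>2)\<^sup>2"
  have pos: "0 < volterra_const H\<^sub>2 * ((t - s) / 2) powr H\<^sub>2"
    using volterra_const_pos[OF H2] st by simp
  let ?A = "{\<omega>\<in>space M. \<bar>X t \<omega> - y\<bar> < t - s}"
  let ?E1 = "{\<omega>\<in>space M. real n * (t - s) \<le> \<bar>B\<^sub>1 t \<omega> - B\<^sub>1 s \<omega>\<bar>}"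
  let ?E2 = "{\<omega>\<in>space M. \<bar>(X s \<omega> - y) + (B\<^sub>2 t \<omega> - B\<^sub>2 s \<omega>)\<bar> \<le> (2 + c) * (t - s)}"
  have "prob ?E2 \<le> 4 * ((2 + c) * (t - s)) / sqrt ?V"
  proof (rule small_ball_estimate[OF W st])
    show "(\<lambda>\<omega>. X s \<omega> - y) \<in> borel_measurable (augmented_filtration M W s)"
      using X(2)[OF mem(1)] by (intro borel_measurable_diff) auto
    show "has_wiener_integral M W t (volterra_kernel H\<^sub>2 t) (B\<^sub>2 t)"
      "has_wiener_integral M W s (volterra_kernel H\<^sub>2 s) (B\<^sub>2 s)"
      using rep mem unfolding represented_by_def by blast+
    show "ennreal ?V \<le> (\<integral>\<^sup>+x\<in>{s<..<t}. ennreal ((volterra_kernel H\<^sub>2 t x)\<^sup>2) \<partial>lborel)"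
      using H2 st(1,2) by (rule nn_integral_volterra_kernel_ge)
  qed (use pos c st in auto)
  also have "sqrt ?V = volterra_const H\<^sub>2 * ((t - s) / 2) powr H\<^sub>2"
    using pos by (simp only: real_sqrt_abs abs_of_pos)
  finally have E2: "prob ?E2 \<le> 4 * ((2 + c) * (t - s)) / (volterra_const H\<^sub>2 * ((t - s) / 2) powr H\<^sub>2)" .
  have "AE \<omega> in M. \<omega> \<in> ?A \<longrightarrow> \<omega> \<in> ?E1 \<union> ?E2"
    using eq AE_space
  proof eventually_elim
    case (elim \<omega>)
    have "continuous_on {0..T} (\<lambda>s. X s \<omega>)"
      using X(1) elim(2) by (auto simp: continuous_process_def)
    then have drift: "\<bar>drift_integral b X t \<omega> - drift_integral b X s \<omega>\<bar> \<le> c * (t - s)"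
      using st by (intro drift_integral_diff_le[OF b c(2)]) auto
    have X_eq: "X t \<omega> = x\<^sub>0 + drift_integral b X t \<omega> + (1 / real n * B\<^sub>1 t \<omega> + B\<^sub>2 t \<omega>)"
      "X s \<omega> = x\<^sub>0 + drift_integral b X s \<omega> + (1 / real n * B\<^sub>1 s \<omega> + B\<^sub>2 s \<omega>)"
      using elim(1) mem by blast+
    show ?case
    proof (intro impI, rule ccontr)
      assume A: "\<omega> \<in> ?A" and "\<omega> \<notin> ?E1 \<union> ?E2"
      then have nE: "\<bar>B\<^sub>1 t \<omega> - B\<^sub>1 s \<omega>\<bar> < real n * (t - s)"
        "(2 + c) * (t - s) < \<bar>(X s \<omega> - y) + (B\<^sub>2 t \<omega> - B\<^sub>2 s \<omega>)\<bar>"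
        using elim(2) by auto
      have "\<bar>1 / real n * B\<^sub>1 t \<omega> - 1 / real n * B\<^sub>1 s \<omega>\<bar> = \<bar>B\<^sub>1 t \<omega> - B\<^sub>1 s \<omega>\<bar> / real n"
        using n by (subst abs_div_pos) (auto simp: diff_divide_distrib)
      also have "\<dots> < t - s" using nE(1) n by (simp add: field_simps)
      finally have "\<bar>1 / real n * B\<^sub>1 t \<omega> - 1 / real n * B\<^sub>1 s \<omega>\<bar> < t - s" .
      moreover have "(2 + c) * (t - s) = (t - s) + (t - s) + c * (t - s)" by (simp add: algebra_simps)
      moreover have "\<bar>X t \<omega> - y\<bar> < t - s" using A by simp
      ultimately show False using drift nE(2) X_eq by linarith
    qed
  qed
  then have "prob ?A \<le> prob (?E1 \<union> ?E2)"
    by (intro finite_measure_mono_AE) (auto, measurable)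
  also have "\<dots> \<le> prob ?E1 + prob ?E2"
    by (intro measure_Un_le) measurable
  finally show ?thesis using E2 by linarith
qed

text \<open>The covariance formula yields integrability of \<open>(B t)\<^sup>2\<close> only if \<open>t \<noteq> 0\<close>, since the Bochner
  integral of a non-integrable function is 0.\<close>

lemma fBm_second_moment_finite:
  assumes fbm: "fractional_brownian_motion M T H B" and rep: "represented_by M T W H B" and t: "t \<in> {0..T}"
  shows "(\<integral>\<^sup>+\<omega>. ennreal ((B t \<omega>)\<^sup>2) \<partial>M) < \<infinity>"
proof (cases "t = 0")
  case True
  from rep t have "has_wiener_integral M W t (volterra_kernel H t) (B t)"
    unfolding represented_by_def by blast
  then obtain n u c where u: "\<And>k. u k ` {..n k} \<subseteq> {0..t}"
    and lim: "(\<lambda>k::nat. \<integral>\<^sup>+\<omega>. ennreal ((B t \<omega> - step_integral W (n k) (u k) (c k) \<omega>)\<^sup>2) \<partial>M) \<longlonglongrightarrow> 0"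
    unfolding has_wiener_integral_def by blast
  \<comment> \<open>All partition points are 0, so the step integrals vanish and the null sequence
    \<open>lim\<close> is constantly the second moment.\<close>
  have "u k i = 0" if "i \<le> n k" for k i
    using u[of k] that True unfolding image_subset_iff by force
  then have "step_integral W (n k) (u k) (c k) \<omega> = 0" for k \<omega>
    unfolding step_integral_def by (intro sum.neutral) simp
  then show ?thesis using lim by (simp add: LIMSEQ_const_iff)
next
  case False
  have "(\<integral>\<omega>. B t \<omega> * B t \<omega> \<partial>M) = (\<bar>t\<bar> powr (2 * H) + \<bar>t\<bar> powr (2 * H) - \<bar>t - t\<bar> powr (2 * H)) / 2"
    using fbm t unfolding fractional_brownian_motion_def by blast
  with False have "(\<integral>\<omega>. B t \<omega> * B t \<omega> \<partial>M) \<noteq> 0" by simp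
  then have "integrable M (\<lambda>\<omega>. B t \<omega> * B t \<omega>)"
    using not_integrable_integral_eq by blast
  then have "(\<integral>\<^sup>+\<omega>. ennreal (norm (B t \<omega> * B t \<omega>)) \<partial>M) < \<infinity>"
    unfolding integrable_iff_bounded by blast
  then show ?thesis by (simp add: power2_eq_square)
qed

section \<open>Identification of the limit\<close>

lemma continuous_process_compose:
  assumes "continuous_process M T Z" "continuous_on UNIV g"
  shows "continuous_process M T (\<lambda>t \<omega>. g (Z t \<omega>))"
  unfolding continuous_process_def
proof (intro conjI ballI)
  fix t assume "t \<in> {0..T}"
  with assms(1) have "Z t \<in> borel_measurable M" unfolding continuous_process_def by simp
  then show "(\<lambda>\<omega>. g (Z t \<omega>)) \<in> borel_measurable M"
    by (rule measurable_compose[OF _ borel_measurable_continuous_onI[OF assms(2)]])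
next
  fix \<omega> assume "\<omega> \<in> space M"
  with assms(1) have "continuous_on {0..T} (\<lambda>t. Z t \<omega>)" unfolding continuous_process_def by simp
  then show "continuous_on {0..T} (\<lambda>t. g (Z t \<omega>))"
    by (rule continuous_on_compose2[OF assms(2)]) simp
qed

text \<open>For d > 0 the expression is a constant times d powr (1 - H).\<close>

lemma small_ball_bound_tendsto:
  fixes H C \<kappa> :: real
  assumes "H < 1" "0 < \<kappa>"
  shows "((\<lambda>d. 4 * (C * d) / (\<kappa> * (d / 2) powr H)) \<longlongrightarrow> 0) (at_right 0)"
proof -
  have "((\<lambda>d::real. d powr (1 - H)) \<longlongrightarrow> 0 powr (1 - H)) (at_right 0)"
  proof (rule tendsto_powr'[OF tendsto_ident_at tendsto_const])
    have "eventually (\<lambda>d::real. 0 \<le> d) (at_right 0)"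
      using eventually_at_right_less[of "0::real"] by eventually_elim simp
    then show "(0::real) \<noteq> 0 \<or> 0 < 1 - H \<and> eventually (\<lambda>d::real. 0 \<le> d) (at_right 0)"
      using assms by simp
  qed
  then have lim: "((\<lambda>d. (4 * C * 2 powr H / \<kappa>) * d powr (1 - H)) \<longlongrightarrow> (4 * C * 2 powr H / \<kappa>) * 0) (at_right (0::real))"
    by (intro tendsto_mult tendsto_const) simp
  have ev: "eventually (\<lambda>d. (4 * C * 2 powr H / \<kappa>) * d powr (1 - H) = 4 * (C * d) / (\<kappa> * (d / 2) powr H)) (at_right 0)"
    unfolding eventually_at_right_field
  proof (intro exI[of _ 1] conjI allI impI)
    fix d :: real assume "0 < d"
    then have "d powr (1 - H) = d / d powr H" by (simp add: powr_diff)
    moreover have "(d / 2) powr H = d powr H / 2 powr H" using \<open>0 < d\<close> by (simp add: powr_divide)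
    ultimately show "(4 * C * 2 powr H / \<kappa>) * d powr (1 - H) = 4 * (C * d) / (\<kappa> * (d / 2) powr H)"
      using assms(2) \<open>0 < d\<close> by (simp add: field_simps)
  qed simp
  show ?thesis
    using lim unfolding tendsto_cong[OF ev] by simp
qed

text \<open>The countably many rational times share one exceptional null set. They are dense in
  \<open>{0..T}\<close> because 0 < T, and continuity covers the other times.\<close>

lemma AE_all_zero_of_continuous:
  fixes C :: "real \<Rightarrow> 'a \<Rightarrow> real"
  assumes C: "continuous_process M T C" and "0 < T" and zero: "\<And>t. t \<in> {0..T} \<Longrightarrow> AE \<omega> in M. C t \<omega> = 0"
  shows "AE \<omega> in M. \<forall>t\<in>{0..T}. C t \<omega> = 0"
proof -
  have "AE \<omega> in M. \<forall>q. real_of_rat q \<in> {0..T} \<longrightarrow> C (real_of_rat q) \<omega> = 0"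
    unfolding AE_all_countable using zero by (auto intro: AE_I2)
  then show ?thesis
    using AE_space
  proof eventually_elim
    case (elim \<omega>)
    have cont: "continuous_on {0..T} (\<lambda>t. C t \<omega>)"
      using C elim(2) by (auto simp: continuous_process_def)
    show ?case
    proof (rule ballI, rule ccontr)
      fix t assume t: "t \<in> {0..T}" and "C t \<omega> \<noteq> 0"
      then obtain d where d: "0 < d" "\<And>r. r \<in> {0..T} \<Longrightarrow> dist r t < d \<Longrightarrow> dist (C r \<omega>) (C t \<omega>) < \<bar>C t \<omega>\<bar>"
        using cont unfolding continuous_on_iff by (metis zero_less_abs_iff)
      have "max 0 (t - d) < min T (t + d)" using t d \<open>0 < T\<close> by auto
      then obtain q where q: "max 0 (t - d) < real_of_rat q" "real_of_rat q < min T (t + d)"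
        using of_rat_dense by blast
      then have "C (real_of_rat q) \<omega> = 0" using elim(1) by auto
      moreover have "dist (C (real_of_rat q) \<omega>) (C t \<omega>) < \<bar>C t \<omega>\<bar>"
        using q by (intro d(2)) (auto simp: dist_real_def)
      ultimately show False by (simp add: dist_real_def)
    qed
  qed
qed

theorem theorem4p4:
  fixes T H\<^sub>1 H\<^sub>2 x\<^sub>0 c L :: real
    and b :: "real \<Rightarrow> real \<Rightarrow> real"
    and a :: "nat \<Rightarrow> real" and m :: nat
    and M :: "'a measure" and W B\<^sub>1 B\<^sub>2 :: "real \<Rightarrow> 'a \<Rightarrow> real"
    and X :: "nat \<Rightarrow> real \<Rightarrow> 'a \<Rightarrow> real"
    and N :: "nat \<Rightarrow> nat"
    and M' :: "'b measure"
    and Xv Av B\<^sub>1v B\<^sub>2v :: "nat \<Rightarrow> real \<Rightarrow> 'b \<Rightarrow> real"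
    and Xlim Alim Clim B\<^sub>2lim X' :: "real \<Rightarrow> 'b \<Rightarrow> real"
  assumes T: "0 < T"
    and H1: "0 < H\<^sub>1" "H\<^sub>1 \<le> 1/2"
    and H2: "1/2 < H\<^sub>2" "H\<^sub>2 < 1"
    and b_measurable:
      "(\<lambda>(t, x). b t x) \<in> borel_measurable (restrict_space borel ({0..T} \<times> UNIV))"
    and B1: "0 < c" "\<forall>t\<in>{0..T}. \<forall>x. \<bar>b t x\<bar> \<le> c"
    and B2: "1 \<le> m" "strict_mono_on {1..m} a" "0 < L"
      "\<forall>j\<le>m. \<forall>t\<in>{0..T}. \<forall>x\<in>piece a m j. \<forall>y\<in>piece a m j. \<bar>b t x - b t y\<bar> \<le> L * \<bar>x - y\<bar>"
    and M: "prob_space M"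
    and fBm: "completely_correlated_fBm M T W H\<^sub>1 H\<^sub>2 B\<^sub>1 B\<^sub>2"
    and X: "\<forall>n\<ge>1. strong_solution M T W x\<^sub>0 b (\<lambda>t \<omega>. 1 / real n * B\<^sub>1 t \<omega> + B\<^sub>2 t \<omega>) (X n)"
    and N: "strict_mono N" "\<forall>l. 1 \<le> N l"
    and M': "prob_space M'"
    and versions_continuous: "\<forall>l. continuous_process M' T
      (\<lambda>t \<omega>. (Xv l t \<omega>, Av l t \<omega>, B\<^sub>1v l t \<omega> / real (N l), B\<^sub>2v l t \<omega>))"
    and versions_law: "\<forall>l.
      path_law M' T
        (\<lambda>t \<omega>. (Xv l t \<omega>, Av l t \<omega>, B\<^sub>1v l t \<omega> / real (N l), B\<^sub>2v l t \<omega>)) =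
      path_law M T
        (\<lambda>t \<omega>. (X (N l) t \<omega>, drift_integral b (X (N l)) t \<omega>, B\<^sub>1 t \<omega> / real (N l), B\<^sub>2 t \<omega>))"
    and versions_equation: "\<forall>l.
      satisfies_equation M' T x\<^sub>0 b
        (\<lambda>t \<omega>. 1 / real (N l) * B\<^sub>1v l t \<omega> + B\<^sub>2v l t \<omega>) (Xv l)"
    and limit_continuous: "continuous_process M' T
      (\<lambda>t \<omega>. (Xlim t \<omega>, Alim t \<omega>, Clim t \<omega>, B\<^sub>2lim t \<omega>))"
    and convergence: "AE \<omega> in M'. uniform_limit {0..T}
      (\<lambda>l t. (Xv l t \<omega>, Av l t \<omega>, B\<^sub>1v l t \<omega> / real (N l), B\<^sub>2v l t \<omega>))
      (\<lambda>t. (Xlim t \<omega>, Alim t \<omega>, Clim t \<omega>, B\<^sub>2lim t \<omega>)) sequentially"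
    and X': "\<forall>t\<in>{0..T}. \<forall>\<omega>\<in>space M'. X' t \<omega> = x\<^sub>0 + drift_integral b Xlim t \<omega> + B\<^sub>2lim t \<omega>"
  shows "(AE \<omega> in M'. \<forall>t\<in>{0..T}. Xlim t \<omega> = X' t \<omega>) \<and>
    (\<forall>t\<in>{0..T}.
       (\<forall>l. integrable M' (\<lambda>\<omega>. (Xv l t \<omega> - X' t \<omega>)\<^sup>2)) \<and>
       (\<lambda>l. prob_space.expectation M' (\<lambda>\<omega>. (Xv l t \<omega> - X' t \<omega>)\<^sup>2)) \<longlonglongrightarrow> 0)"
proof -
  interpret M: prob_space M by (rule M)
  interpret M': prob_space M' by (rule M')
  have fbm1: "fractional_brownian_motion M T H\<^sub>1 B\<^sub>1" and fbm2: "fractional_brownian_motion M T H\<^sub>2 B\<^sub>2"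
    and rep1: "represented_by M T W H\<^sub>1 B\<^sub>1" and rep2: "represented_by M T W H\<^sub>2 B\<^sub>2"
    using fBm unfolding completely_correlated_fBm_def by auto
  have B_meas: "B\<^sub>1 t \<in> borel_measurable M" "B\<^sub>2 t \<in> borel_measurable M" if "t \<in> {0..T}" for t
    using fbm1 fbm2 that unfolding fractional_brownian_motion_def continuous_process_def by auto
  define Cv where "Cv l t \<omega> = B\<^sub>1v l t \<omega> / real (N l)" for l t \<omega>
  let ?Zv = "\<lambda>l t \<omega>. (Xv l t \<omega>, Av l t \<omega>, Cv l t \<omega>, B\<^sub>2v l t \<omega>)"
  let ?Zlim = "\<lambda>t \<omega>. (Xlim t \<omega>, Alim t \<omega>, Clim t \<omega>, B\<^sub>2lim t \<omega>)"
  let ?Z = "\<lambda>l t \<omega>. (X (N l) t \<omega>, drift_integral b (X (N l)) t \<omega>, B\<^sub>1 t \<omega> / real (N l), B\<^sub>2 t \<omega>)"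
  let ?pX = "\<lambda>z :: real \<times> real \<times> real \<times> real. fst z"
  let ?pC = "\<lambda>z :: real \<times> real \<times> real \<times> real. fst (snd (snd z))"
  let ?pB = "\<lambda>z :: real \<times> real \<times> real \<times> real. snd (snd (snd z))"
  have cont_p: "continuous_on UNIV ?pX" "continuous_on UNIV ?pC" "continuous_on UNIV ?pB"
    by (intro continuous_intros)+
  note meas_p = cont_p[THEN borel_measurable_continuous_onI]
  have Zv: "continuous_process M' T (?Zv l)" for l
    using versions_continuous unfolding Cv_def by blast
  have law: "path_law M' T (?Zv l) = path_law M T (?Z l)" for l
    using versions_law unfolding Cv_def by blast
  have Xv: "continuous_process M' T (Xv l)" and Cv: "continuous_process M' T (Cv l)"
    and B2v: "continuous_process M' T (B\<^sub>2v l)" for l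
    using continuous_process_compose[OF Zv cont_p(1), of l] continuous_process_compose[OF Zv cont_p(2), of l]
      continuous_process_compose[OF Zv cont_p(3), of l] by simp_all
  have Xlim: "continuous_process M' T Xlim" and Clim: "continuous_process M' T Clim"
    and B2lim: "continuous_process M' T B\<^sub>2lim"
    using continuous_process_compose[OF limit_continuous cont_p(1)]
      continuous_process_compose[OF limit_continuous cont_p(2)]
      continuous_process_compose[OF limit_continuous cont_p(3)] by simp_all
  have proc_meas: "Y t \<in> borel_measurable M'" if "continuous_process M' T Y" "t \<in> {0..T}" for Y :: "real \<Rightarrow> 'b \<Rightarrow> real" and t
    using that unfolding continuous_process_def by blast
  have proc_cont: "continuous_on {0..T} (\<lambda>t. Y t \<omega>)" if "continuous_process M' T Y" "\<omega> \<in> space M'" for Y :: "real \<Rightarrow> 'b \<Rightarrow> real" and \<omega>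
    using that unfolding continuous_process_def by blast
  have conv: "AE \<omega> in M'. \<forall>t\<in>{0..T}. (\<lambda>l. Xv l t \<omega>) \<longlonglongrightarrow> Xlim t \<omega> \<and>
      (\<lambda>l. Cv l t \<omega>) \<longlonglongrightarrow> Clim t \<omega> \<and> (\<lambda>l. B\<^sub>2v l t \<omega>) \<longlonglongrightarrow> B\<^sub>2lim t \<omega>"
    using convergence
  proof eventually_elim
    case (elim \<omega>)
    show ?case
    proof
      fix t assume "t \<in> {0..T}"
      then have lim: "(\<lambda>l. ?Zv l t \<omega>) \<longlonglongrightarrow> ?Zlim t \<omega>"
        using elim unfolding Cv_def by (intro tendsto_uniform_limitI)
      show "(\<lambda>l. Xv l t \<omega>) \<longlonglongrightarrow> Xlim t \<omega> \<and>
          (\<lambda>l. Cv l t \<omega>) \<longlonglongrightarrow> Clim t \<omega> \<and> (\<lambda>l. B\<^sub>2v l t \<omega>) \<longlonglongrightarrow> B\<^sub>2lim t \<omega>"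
        using tendsto_fst[OF lim] tendsto_fst[OF tendsto_snd[OF tendsto_snd[OF lim]]]
          tendsto_snd[OF tendsto_snd[OF tendsto_snd[OF lim]]] by simp
    qed
  qed
  have N_lim: "filterlim N at_top sequentially"
    using N(1) by (rule filterlim_subseq)

  \<comment> \<open>Absence of atoms at positive times\<close>
  have no_atom: "AE \<omega> in M'. Xlim t \<omega> \<noteq> y" if t: "0 < t" "t \<le> T" for t y
  proof -
    let ?g = "\<lambda>d. 4 * ((2 + c) * d) / (volterra_const H\<^sub>2 * (d / 2) powr H\<^sub>2)"
    have tT: "t \<in> {0..T}" using t by simp
    have [measurable]: "Xlim t \<in> borel_measurable M'" "Xv l t \<in> borel_measurable M'" for l
      using proc_meas[OF Xlim tT] proc_meas[OF Xv tT] by auto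
    have bound: "M'.prob {\<omega>\<in>space M'. Xlim t \<omega> = y} \<le> ?g d" if d: "0 < d" "d < t" for d
    proof -
      let ?B = "\<lambda>n. M.prob {\<omega>\<in>space M. real n * d \<le> \<bar>B\<^sub>1 t \<omega> - B\<^sub>1 (t - d) \<omega>\<bar>}"
      let ?D = "\<lambda>l. M'.prob {\<omega>\<in>space M'. d \<le> \<bar>Xv l t \<omega> - Xlim t \<omega>\<bar>}"
      have "(\<lambda>l. ?B (N l)) \<longlonglongrightarrow> 0"
        using B_meas[of t] B_meas[of "t - d"] t d
        by (intro filterlim_compose[OF M.tendsto_prob_abs_ge_of_nat N_lim]) auto
      moreover have "?D \<longlonglongrightarrow> 0"
      proof (rule M'.tendsto_prob_of_AE)
        show "AE \<omega> in M'. (\<lambda>l. Xv l t \<omega> - Xlim t \<omega>) \<longlonglongrightarrow> 0"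
          using conv by eventually_elim (use tT in \<open>auto simp: LIM_zero_iff\<close>)
      qed (use d in auto)
      ultimately have "(\<lambda>l. ?B (N l) + ?g d + ?D l) \<longlonglongrightarrow> 0 + ?g d + 0"
        by (intro tendsto_add tendsto_const)
      moreover have "M'.prob {\<omega>\<in>space M'. Xlim t \<omega> = y} \<le> ?B (N l) + ?g d + ?D l" for l
      proof -
        let ?E = "{\<omega>\<in>space M'. \<bar>Xv l t \<omega> - y\<bar> < d}"
        have "{x. \<bar>x - y\<bar> < d} = ball y d" by (auto simp: dist_real_def)
        then have "{x. \<bar>x - y\<bar> < d} \<in> sets borel" by simp
        from path_law_marginal[OF law M' Zv tT meas_p(1) this]
        have "emeasure M' ?E = emeasure M {\<omega>\<in>space M. \<bar>X (N l) t \<omega> - y\<bar> < d}"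
          by simp
        then have "M'.prob ?E = M.prob {\<omega>\<in>space M. \<bar>X (N l) t \<omega> - y\<bar> < t - (t - d)}"
          by (simp add: measure_def)
        also have "\<dots> \<le> ?B (N l) + ?g d"
          using M.solution_small_ball[OF fBm H2 b_measurable B1, of x\<^sub>0 "N l" "X (N l)" "t - d" t y] X N(2) t d
          by simp
        finally have E: "M'.prob ?E \<le> ?B (N l) + ?g d" .
        \<comment> \<open>If the limit equals y, then the approximation is within d of y or at
          distance at least d from its limit.\<close>
        have "M'.prob {\<omega>\<in>space M'. Xlim t \<omega> = y} \<le> M'.prob (?E \<union> {\<omega>\<in>space M'. d \<le> \<bar>Xv l t \<omega> - Xlim t \<omega>\<bar>})"
          by (intro M'.finite_measure_mono) auto
        also have "\<dots> \<le> M'.prob ?E + ?D l"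
          by (intro measure_Un_le) measurable
        finally show ?thesis using E by linarith
      qed
      ultimately have "M'.prob {\<omega>\<in>space M'. Xlim t \<omega> = y} \<le> 0 + ?g d + 0"
        by (intro tendsto_lowerbound[OF _ always_eventually]) auto
      then show ?thesis by simp
    qed
    have "(?g \<longlongrightarrow> 0) (at_right 0)"
      using H2(2) volterra_const_pos[OF H2] by (rule small_ball_bound_tendsto)
    moreover have "eventually (\<lambda>d. M'.prob {\<omega>\<in>space M'. Xlim t \<omega> = y} \<le> ?g d) (at_right 0)"
      unfolding eventually_at_right_field using bound t(1) by blast
    ultimately have "M'.prob {\<omega>\<in>space M'. Xlim t \<omega> = y} \<le> 0"
      by (rule tendsto_lowerbound) simp
    then have "M'.prob {\<omega>\<in>space M'. Xlim t \<omega> = y} = 0"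
      using measure_nonneg[of M'] by (simp add: order_antisym)
    then show ?thesis
      by (subst (asm) M'.prob_eq_0) auto
  qed

  \<comment> \<open>Null occupation time of the discontinuities\<close>
  let ?F = "a ` {1..m}"
  have avoid: "AE \<omega> in M'. AE s in lborel. s \<in> {0..T} \<longrightarrow> Xlim s \<omega> \<notin> ?F"
  proof -
    interpret P: pair_sigma_finite lborel M' ..
    have "?F \<in> sets borel" by (intro borel_closed finite_imp_closed) simp
    moreover have [measurable]: "(\<lambda>p. Xlim (clip T (fst p)) (snd p)) \<in> borel_measurable (lborel \<Otimes>\<^sub>M M')"
      using continuous_process_joint_measurable[OF Xlim less_imp_le[OF T]]
      by (simp add: case_prod_unfold cong: measurable_cong_sets)
    ultimately have set: "{p\<in>space (lborel \<Otimes>\<^sub>M M'). fst p \<in> {0<..T} \<longrightarrow> Xlim (clip T (fst p)) (snd p) \<notin> ?F}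
        \<in> sets (lborel \<Otimes>\<^sub>M M')"
      by measurable
    \<comment> \<open>Time 0 is left out because the initial value may be a breakpoint; it is
      restored below as a single point of Lebesgue measure 0.\<close>
    have "AE s in lborel. AE \<omega> in M'. s \<in> {0<..T} \<longrightarrow> Xlim (clip T s) \<omega> \<notin> ?F"
    proof (rule AE_I2)
      fix s :: real
      show "AE \<omega> in M'. s \<in> {0<..T} \<longrightarrow> Xlim (clip T s) \<omega> \<notin> ?F"
      proof (cases "s \<in> {0<..T}")
        case True
        then have "AE \<omega> in M'. \<forall>i\<in>{1..m}. Xlim s \<omega> \<noteq> a i"
          using no_atom[of s] by (intro AE_finite_allI) auto
        then show ?thesis
        proof eventually_elim
          case (elim \<omega>)
          then show ?case using True by (auto simp: clip_id)
        qed
      next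
        case False
        then show ?thesis by (intro AE_I2 impI) blast
      qed
    qed
    then have "AE \<omega> in M'. AE s in lborel. s \<in> {0<..T} \<longrightarrow> Xlim (clip T s) \<omega> \<notin> ?F"
      using P.AE_commute[of "\<lambda>s \<omega>. s \<in> {0<..T} \<longrightarrow> Xlim (clip T s) \<omega> \<notin> ?F"] set by simp
    then show ?thesis
    proof eventually_elim
      case (elim \<omega>)
      then show ?case
        using AE_lborel_singleton[of "0::real"]
        by eventually_elim (auto simp: clip_id)
    qed
  qed

  \<comment> \<open>Convergence of the drift integrals\<close>
  have drift_conv: "AE \<omega> in M'. \<forall>t\<in>{0..T}. (\<lambda>l. drift_integral b (Xv l) t \<omega>) \<longlonglongrightarrow> drift_integral b Xlim t \<omega>"
    using avoid conv AE_space
  proof eventually_elim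
    case (elim \<omega>)
    show ?case
    proof
      fix t assume "t \<in> {0..T}"
      have cont: "AE s in lborel. s \<in> {0..T} \<longrightarrow> isCont (b s) (Xlim s \<omega>)"
        using elim(1)
      proof eventually_elim
        case (elim s)
        show ?case
        proof
          assume s: "s \<in> {0..T}"
          then show "isCont (b s) (Xlim s \<omega>)"
            using elim B2(4) by (intro piecewise_Lipschitz_isCont[OF B2(1,2) _ B2(3)]) auto
        qed
      qed
      show "(\<lambda>l. drift_integral b (Xv l) t \<omega>) \<longlonglongrightarrow> drift_integral b Xlim t \<omega>"
      proof (rule drift_integral_tendsto[OF b_measurable B1(2)])
        show "AE s in lborel. s \<in> {0..T} \<longrightarrow> isCont (b s) (Xlim s \<omega>)"
          by (rule cont)
        show "continuous_on {0..T} (\<lambda>s. Xv l s \<omega>)" for l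
          by (rule proc_cont[OF Xv elim(3)])
        show "continuous_on {0..T} (\<lambda>s. Xlim s \<omega>)"
          by (rule proc_cont[OF Xlim elim(3)])
        show "(\<lambda>l. Xv l s \<omega>) \<longlonglongrightarrow> Xlim s \<omega>" if "s \<in> {0..T}" for s
          using elim(2) that by blast
      qed (use \<open>t \<in> {0..T}\<close> in simp)
    qed
  qed

  \<comment> \<open>Vanishing of the scaled rough noise\<close>
  have Cv_L2: "(\<lambda>l. \<integral>\<^sup>+\<omega>. ennreal ((Cv l t \<omega>)\<^sup>2) \<partial>M') \<longlonglongrightarrow> 0"
    and Cv_fin: "\<And>l. (\<integral>\<^sup>+\<omega>. ennreal ((Cv l t \<omega>)\<^sup>2) \<partial>M') < \<infinity>" if t: "t \<in> {0..T}" for t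
  proof -
    obtain v where v: "(\<integral>\<^sup>+\<omega>. ennreal ((B\<^sub>1 t \<omega>)\<^sup>2) \<partial>M) = ennreal v" "0 \<le> v"
      using fBm_second_moment_finite[OF fbm1 rep1 t] by (cases "\<integral>\<^sup>+\<omega>. ennreal ((B\<^sub>1 t \<omega>)\<^sup>2) \<partial>M") auto
    have eq: "(\<integral>\<^sup>+\<omega>. ennreal ((Cv l t \<omega>)\<^sup>2) \<partial>M') = ennreal (v * (1 / real (N l))\<^sup>2)" for l
    proof -
      have B: "(\<lambda>\<omega>. B\<^sub>1 t \<omega> / real (N l)) \<in> borel_measurable M"
        using B_meas(1)[OF t] by simp
      then have distr: "distr M' borel (Cv l t) = distr M borel (\<lambda>\<omega>. B\<^sub>1 t \<omega> / real (N l))"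
        using path_law_marginal_distr[OF law M' Zv t meas_p(2), of l] by simp
      have "(\<integral>\<^sup>+\<omega>. ennreal ((Cv l t \<omega>)\<^sup>2) \<partial>M') = (\<integral>\<^sup>+x. ennreal (x\<^sup>2) \<partial>distr M' borel (Cv l t))"
        using proc_meas[OF Cv t] by (subst nn_integral_distr) auto
      also have "\<dots> = (\<integral>\<^sup>+\<omega>. ennreal ((B\<^sub>1 t \<omega> / real (N l))\<^sup>2) \<partial>M)"
        unfolding distr using B by (subst nn_integral_distr) auto
      also have "\<dots> = (\<integral>\<^sup>+\<omega>. ennreal ((1 / real (N l))\<^sup>2) * ennreal ((B\<^sub>1 t \<omega>)\<^sup>2) \<partial>M)"
        by (intro nn_integral_cong) (simp add: power_divide flip: ennreal_mult)
      also have "\<dots> = ennreal ((1 / real (N l))\<^sup>2) * ennreal v"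
        using B_meas(1)[OF t] v(1) by (subst nn_integral_cmult) auto
      also have "\<dots> = ennreal (v * (1 / real (N l))\<^sup>2)"
        using v(2) by (simp add: mult.commute flip: ennreal_mult)
      finally show ?thesis .
    qed
    then show "\<And>l. (\<integral>\<^sup>+\<omega>. ennreal ((Cv l t \<omega>)\<^sup>2) \<partial>M') < \<infinity>" by simp
    have "(\<lambda>l. v * (1 / real (N l))\<^sup>2) \<longlonglongrightarrow> v * 0\<^sup>2"
      by (intro tendsto_mult tendsto_const tendsto_power filterlim_compose[OF lim_1_over_n N_lim])
    then have "(\<lambda>l. ennreal (v * (1 / real (N l))\<^sup>2)) \<longlonglongrightarrow> ennreal (v * 0\<^sup>2)"
      by (rule tendsto_ennrealI)
    then show "(\<lambda>l. \<integral>\<^sup>+\<omega>. ennreal ((Cv l t \<omega>)\<^sup>2) \<partial>M') \<longlonglongrightarrow> 0"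
      unfolding eq by simp
  qed
  have Clim_zero: "AE \<omega> in M'. \<forall>t\<in>{0..T}. Clim t \<omega> = 0"
  proof (rule AE_all_zero_of_continuous[OF Clim T])
    fix t assume t: "t \<in> {0..T}"
    show "AE \<omega> in M'. Clim t \<omega> = 0"
    proof (rule M'.AE_zero_of_L2_null[OF proc_meas[OF Cv t] _ proc_meas[OF Clim t] Cv_L2[OF t]])
      show "AE \<omega> in M'. (\<lambda>l. Cv l t \<omega>) \<longlonglongrightarrow> Clim t \<omega>"
        using conv by eventually_elim (use t in blast)
    qed
  qed

  \<comment> \<open>The limit equation\<close>
  have eqs: "AE \<omega> in M'. \<forall>l. \<forall>t\<in>{0..T}. Xv l t \<omega> = x\<^sub>0 + drift_integral b (Xv l) t \<omega> + (Cv l t \<omega> + B\<^sub>2v l t \<omega>)"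
    using versions_equation unfolding satisfies_equation_def AE_all_countable Cv_def by simp
  have limit_eq: "AE \<omega> in M'. \<forall>t\<in>{0..T}. Xlim t \<omega> = X' t \<omega>"
    using eqs conv drift_conv Clim_zero AE_space
  proof eventually_elim
    case (elim \<omega>)
    show ?case
    proof
      fix t assume t: "t \<in> {0..T}"
      have "(\<lambda>l. x\<^sub>0 + drift_integral b (Xv l) t \<omega> + (Cv l t \<omega> + B\<^sub>2v l t \<omega>))
          \<longlonglongrightarrow> x\<^sub>0 + drift_integral b Xlim t \<omega> + (Clim t \<omega> + B\<^sub>2lim t \<omega>)"
        using elim(2,3) t by (intro tendsto_add tendsto_const) blast+
      then have "(\<lambda>l. Xv l t \<omega>) \<longlonglongrightarrow> x\<^sub>0 + drift_integral b Xlim t \<omega> + (Clim t \<omega> + B\<^sub>2lim t \<omega>)"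
        using elim(1) t by simp
      moreover have "(\<lambda>l. Xv l t \<omega>) \<longlonglongrightarrow> Xlim t \<omega>"
        using elim(2) t by blast
      ultimately have "Xlim t \<omega> = x\<^sub>0 + drift_integral b Xlim t \<omega> + (Clim t \<omega> + B\<^sub>2lim t \<omega>)"
        by (rule LIMSEQ_unique[symmetric])
      then show "Xlim t \<omega> = X' t \<omega>"
        using elim(4,5) t X' by simp
    qed
  qed

  \<comment> \<open>Convergence in L2\<close>
  have L2: "(\<forall>l. integrable M' (\<lambda>\<omega>. (Xv l t \<omega> - X' t \<omega>)\<^sup>2)) \<and>
      (\<lambda>l. M'.expectation (\<lambda>\<omega>. (Xv l t \<omega> - X' t \<omega>)\<^sup>2)) \<longlonglongrightarrow> 0" if t: "t \<in> {0..T}" for t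
  proof -
    define D where "D l \<omega> = drift_integral b (Xv l) t \<omega> - drift_integral b Xlim t \<omega>" for l \<omega>
    have drift_meas: "drift_integral b Y t \<in> borel_measurable M'" if "continuous_process M' T Y" for Y
      using t T by (intro drift_integral_measurable[OF b_measurable that]) auto
    have [measurable]: "D l \<in> borel_measurable M'" for l
      unfolding D_def[abs_def] using drift_meas[OF Xv] drift_meas[OF Xlim] by (intro borel_measurable_diff)
    note [measurable] = proc_meas[OF Cv t] proc_meas[OF B2v t] proc_meas[OF B2lim t] proc_meas[OF Xv t]
    have [measurable]: "X' t \<in> borel_measurable M'"
    proof -
      have "(\<lambda>\<omega>. x\<^sub>0 + drift_integral b Xlim t \<omega> + B\<^sub>2lim t \<omega>) \<in> borel_measurable M'"
        using drift_meas[OF Xlim] by measurable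
      then show ?thesis using X' t by (subst measurable_cong) auto
    qed
    \<comment> \<open>Each drift integral is at most c T, by the increment bound from time 0, where
      it is an integral over a single point and vanishes.\<close>
    have D_bound: "\<bar>D l \<omega>\<bar> \<le> 2 * (c * T)" if "\<omega> \<in> space M'" for l \<omega>
    proof -
      have "\<bar>drift_integral b Y t \<omega>\<bar> \<le> c * T" if Y: "continuous_process M' T Y" for Y
      proof -
        have "drift_integral b Y 0 \<omega> = 0"
          unfolding drift_integral_def set_lebesgue_integral_def
          using AE_lborel_singleton[of "0::real"]
          by (intro integral_eq_zero_AE) (auto elim!: eventually_mono)
        moreover have "\<bar>drift_integral b Y t \<omega> - drift_integral b Y 0 \<omega>\<bar> \<le> c * (t - 0)"
          using t proc_cont[OF Y \<open>\<omega> \<in> space M'\<close>]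
          by (intro drift_integral_diff_le[OF b_measurable B1(2)]) auto
        moreover have "c * t \<le> c * T" using t B1(1) by simp
        ultimately show ?thesis by simp
      qed
      from this[OF Xv, of l] this[OF Xlim] show ?thesis unfolding D_def by linarith
    qed
    have D_sq: "(D l \<omega>)\<^sup>2 \<le> (2 * (c * T))\<^sup>2" if "\<omega> \<in> space M'" for l \<omega>
      using power_mono[OF D_bound[OF that] abs_ge_zero, of l 2] unfolding power2_abs .
    have D_fin: "(\<integral>\<^sup>+\<omega>. ennreal ((D l \<omega>)\<^sup>2) \<partial>M') \<le> ennreal ((2 * (c * T))\<^sup>2)" for l
    proof -
      have "(\<integral>\<^sup>+\<omega>. ennreal ((D l \<omega>)\<^sup>2) \<partial>M') \<le> (\<integral>\<^sup>+\<omega>. ennreal ((2 * (c * T))\<^sup>2) \<partial>M')"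
        by (intro nn_integral_mono ennreal_leI D_sq)
      then show ?thesis by (simp add: M'.emeasure_space_1)
    qed
    have D_L2: "(\<lambda>l. \<integral>\<^sup>+\<omega>. ennreal ((D l \<omega>)\<^sup>2) \<partial>M') \<longlonglongrightarrow> (\<integral>\<^sup>+\<omega>. 0 \<partial>M')"
    proof (rule nn_integral_dominated_convergence[where w = "\<lambda>_. ennreal ((2 * (c * T))\<^sup>2)"])
      show "AE \<omega> in M'. (\<lambda>l. ennreal ((D l \<omega>)\<^sup>2)) \<longlonglongrightarrow> 0"
        using drift_conv
      proof eventually_elim
        case (elim \<omega>)
        then have "(\<lambda>l. D l \<omega>) \<longlonglongrightarrow> 0"
          using t unfolding D_def by (simp add: LIM_zero_iff)
        then have "(\<lambda>l. (D l \<omega>)\<^sup>2) \<longlonglongrightarrow> 0\<^sup>2" by (rule tendsto_power)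
        then have "(\<lambda>l. ennreal ((D l \<omega>)\<^sup>2)) \<longlonglongrightarrow> ennreal (0\<^sup>2)" by (rule tendsto_ennrealI)
        then show ?case by simp
      qed
      show "AE \<omega> in M'. ennreal ((D l \<omega>)\<^sup>2) \<le> ennreal ((2 * (c * T))\<^sup>2)" for l
        by (intro AE_I2 ennreal_leI D_sq)
    qed (auto simp: M'.emeasure_space_1)
    have B_law: "distr M' borel (B\<^sub>2v l t) = distr M borel (B\<^sub>2 t)" for l
      using path_law_marginal_distr[OF law M' Zv t meas_p(3), of l] B_meas(2)[OF t] by simp
    have B_conv: "AE \<omega> in M'. (\<lambda>l. B\<^sub>2v l t \<omega>) \<longlonglongrightarrow> B\<^sub>2lim t \<omega>"
      using conv by eventually_elim (use t in blast)
    have B_moment: "(\<integral>\<^sup>+x. ennreal (x\<^sup>2) \<partial>distr M borel (B\<^sub>2 t)) < \<infinity>"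
      using fBm_second_moment_finite[OF fbm2 rep2 t] B_meas(2)[OF t] by (subst nn_integral_distr) auto
    note B_L2 = M'.L2_convergence_same_law[OF proc_meas[OF B2v t] proc_meas[OF B2lim t] B_law B_conv B_moment]
    let ?I = "\<lambda>l. \<integral>\<^sup>+\<omega>. ennreal ((Xv l t \<omega> - X' t \<omega>)\<^sup>2) \<partial>M'"
    let ?J = "\<lambda>l. ennreal 3 * ((\<integral>\<^sup>+\<omega>. ennreal ((D l \<omega>)\<^sup>2) \<partial>M') + (\<integral>\<^sup>+\<omega>. ennreal ((Cv l t \<omega>)\<^sup>2) \<partial>M')
        + (\<integral>\<^sup>+\<omega>. ennreal ((B\<^sub>2v l t \<omega> - B\<^sub>2lim t \<omega>)\<^sup>2) \<partial>M'))"
    \<comment> \<open>The equation for the version and the definition of X' split the difference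
      into a drift part, the scaled rough noise and the error in \<open>B\<^sub>2\<close>.\<close>
    have I_le: "?I l \<le> ?J l" for l
    proof -
      have "?I l \<le> (\<integral>\<^sup>+\<omega>. ennreal 3 * (ennreal ((D l \<omega>)\<^sup>2) + ennreal ((Cv l t \<omega>)\<^sup>2)
          + ennreal ((B\<^sub>2v l t \<omega> - B\<^sub>2lim t \<omega>)\<^sup>2)) \<partial>M')"
      proof (rule nn_integral_mono_AE)
        show "AE \<omega> in M'. ennreal ((Xv l t \<omega> - X' t \<omega>)\<^sup>2) \<le> ennreal 3 * (ennreal ((D l \<omega>)\<^sup>2)
            + ennreal ((Cv l t \<omega>)\<^sup>2) + ennreal ((B\<^sub>2v l t \<omega> - B\<^sub>2lim t \<omega>)\<^sup>2))"
          using eqs AE_space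
        proof eventually_elim
          case (elim \<omega>)
          \<comment> \<open>The right side minus the left side is the sum of the three squared
            pairwise differences.\<close>
          have sq: "(x + y + z)\<^sup>2 \<le> 3 * (x\<^sup>2 + y\<^sup>2 + z\<^sup>2)" for x y z :: real
            using zero_le_power2[of "x - y"] zero_le_power2[of "y - z"] zero_le_power2[of "x - z"]
            by (simp add: power2_eq_square algebra_simps)
          have "Xv l t \<omega> = x\<^sub>0 + drift_integral b (Xv l) t \<omega> + (Cv l t \<omega> + B\<^sub>2v l t \<omega>)"
            using elim(1) t by blast
          moreover have "X' t \<omega> = x\<^sub>0 + drift_integral b Xlim t \<omega> + B\<^sub>2lim t \<omega>"
            using X' t elim(2) by blast
          ultimately have "Xv l t \<omega> - X' t \<omega> = D l \<omega> + Cv l t \<omega> + (B\<^sub>2v l t \<omega> - B\<^sub>2lim t \<omega>)"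
            unfolding D_def by simp
          then have "(Xv l t \<omega> - X' t \<omega>)\<^sup>2 \<le> 3 * ((D l \<omega>)\<^sup>2 + (Cv l t \<omega>)\<^sup>2 + (B\<^sub>2v l t \<omega> - B\<^sub>2lim t \<omega>)\<^sup>2)"
            using sq by simp
          then show ?case
            by (simp add: ennreal_leI flip: ennreal_mult ennreal_plus del: ennreal_numeral)
        qed
      qed
      also have "\<dots> = ?J l"
        by (simp add: nn_integral_cmult nn_integral_add)
      finally show ?thesis .
    qed
    have J_fin: "?J l < \<infinity>" for l
      using le_less_trans[OF D_fin ennreal_less_top, of l] Cv_fin[OF t, of l] B_L2(2)[of l]
      by (simp add: ennreal_mult_less_top)
    have "?J \<longlonglongrightarrow> ennreal 3 * (0 + 0 + 0)"
      using D_L2 by (intro ennreal_tendsto_cmult tendsto_add Cv_L2[OF t] B_L2(1)) simp_all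
    then have J_lim: "?J \<longlonglongrightarrow> 0" by simp
    have I_lim: "?I \<longlonglongrightarrow> 0"
      by (rule tendsto_sandwich[OF _ _ tendsto_const J_lim]) (simp_all only: I_le zero_le eventually_True)
    have I_fin: "?I l < \<infinity>" for l
      using I_le J_fin by (rule le_less_trans)
    have int: "integrable M' (\<lambda>\<omega>. (Xv l t \<omega> - X' t \<omega>)\<^sup>2)" for l
      by (rule integrableI_bounded) (use I_fin[of l] in auto)
    have "ennreal (M'.expectation (\<lambda>\<omega>. (Xv l t \<omega> - X' t \<omega>)\<^sup>2)) = ?I l" for l
      by (rule nn_integral_eq_integral[symmetric]) (use int in auto)
    then have "(\<lambda>l. ennreal (M'.expectation (\<lambda>\<omega>. (Xv l t \<omega> - X' t \<omega>)\<^sup>2))) \<longlonglongrightarrow> ennreal 0"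
      using I_lim by simp
    then have "(\<lambda>l. M'.expectation (\<lambda>\<omega>. (Xv l t \<omega> - X' t \<omega>)\<^sup>2)) \<longlonglongrightarrow> 0"
      by (subst (asm) tendsto_ennreal_iff) auto
    with int show ?thesis by blast
  qed
  show ?thesis
    using limit_eq L2 by blast
qed

end
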